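(* Let $k$ be a field, let $n\ge 1$, and let $\mathcal{H}_n$ be the $0$-Hecke algebra of the symmetric group $S_n$ over $k$. Then the dimension over $k$ of the center of $\mathcal{H}_n$ is $$\dim_k Z(\mathcal{H}_n)=\sum_{\lambda\vdash n}\frac{n_\lambda!}{m_\lambda},$$ where the sum runs over all partitions $\lambda$ of $n$, $n_\lambda$ is the number of even parts of $\lambda$ (counted with multiplicity), and $m_\lambda=\prod_{j\ge 1} i_j!$ with $i_j=i_j(\lambda)$ the number of parts of $\lambda$ equal to $2j$.
   Context: The $0$-Hecke algebra $\mathcal{H}_n$ is the unital associative $k$-algebra generated by $T_1,\dots,T_{n-1}$ with relations $T_iT_{i+1}T_i=T_{i+1}T_iT_{i+1}$, $T_iT_j=T_jT_i$ for $|i-j|>1$, and $T_i^2=T_i$. It has a $k$-basis $\{T_w\}_{w\in S_n}$, where $T_w=T_{i_1}\cdots T_{i_l}$ for any reduced expression $w=s_{i_1}\cdots s_{i_l}$, $s_i=(i\;\,i+1)$. $Z(\cdot)$ denotes the center. *)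

theory Defs
  imports
    "HOL-Library.Multiset"
    "HOL-Library.Poly_Mapping"
    "HOL-Algebra.QuotRing"
    "HOL-Algebra.Embedded_Algebras"
begin

text \<open>
  The free monoid on letters indexed by natural numbers, written additively: with this instance the
  convolution product of \<^theory>\<open>HOL-Library.Poly_Mapping\<close> makes finitely supported functions
  on words into the free associative algebra.
\<close>

datatype word = Word (letters: "nat list")

instantiation word :: monoid_add
begin

definition zero_word :: word
  where "0 = Word []"

definition plus_word :: "word \<Rightarrow> word \<Rightarrow> word"
  where "u + v = Word (letters u @ letters v)"

instance
  by standard (simp_all add: zero_word_def plus_word_def)

end

definition gen :: "nat \<Rightarrow> word \<Rightarrow>\<^sub>0 'k::field"
  where "gen i = Poly_Mapping.single (Word [i]) 1"

definition scalar :: "'k \<Rightarrow> word \<Rightarrow>\<^sub>0 'k::field"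
  where "scalar c = Poly_Mapping.single 0 c"

text \<open>The free associative algebra over \<open>'k\<close> on the letters \<open>1, \<dots>, n - 1\<close>.\<close>

definition free_algebra :: "'k::field itself \<Rightarrow> nat \<Rightarrow> (word \<Rightarrow>\<^sub>0 'k) ring"
  where "free_algebra _ n =
    \<lparr>carrier = {p. \<forall>w \<in> Poly_Mapping.keys p. set (letters w) \<subseteq> {1..<n}},
     mult = (*), one = 1, zero = 0, add = (+)\<rparr>"

definition hecke_relators :: "nat \<Rightarrow> (word \<Rightarrow>\<^sub>0 'k::field) set"
  where "hecke_relators n =
    {gen i * gen (i + 1) * gen i - gen (i + 1) * gen i * gen (i + 1) | i.
       i \<in> {1..<n} \<and> i + 1 \<in> {1..<n}} \<union>
    {gen i * gen j - gen j * gen i | i j.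
       i \<in> {1..<n} \<and> j \<in> {1..<n} \<and> \<bar>int i - int j\<bar> > 1} \<union>
    {gen i * gen i - gen i | i. i \<in> {1..<n}}"

text \<open>Ideals in \<^theory>\<open>HOL-Algebra.Ideal\<close> are two-sided.\<close>

definition hecke_ideal :: "'k::field itself \<Rightarrow> nat \<Rightarrow> (word \<Rightarrow>\<^sub>0 'k) set"
  where "hecke_ideal K n = Idl\<^bsub>free_algebra K n\<^esub> (hecke_relators n)"

definition hecke_algebra :: "'k::field itself \<Rightarrow> nat \<Rightarrow> (word \<Rightarrow>\<^sub>0 'k) set ring"
  where "hecke_algebra K n = free_algebra K n Quot hecke_ideal K n"

text \<open>
  The copy of the ground field inside the algebra. Scalar multiplication by \<open>c\<close> is multiplication
  by the image of \<open>c\<close>, so dimension over \<open>'k\<close> is dimension over this subfield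
  (see \<open>subfield_hecke_scalars\<close>).
\<close>

definition hecke_scalars :: "'k::field itself \<Rightarrow> nat \<Rightarrow> (word \<Rightarrow>\<^sub>0 'k) set set"
  where "hecke_scalars K n =
    (\<lambda>c. hecke_ideal K n +>\<^bsub>free_algebra K n\<^esub> scalar c) ` UNIV"

definition ring_center :: "('a, 'b) ring_scheme \<Rightarrow> 'a set"
  where "ring_center R =
    {z \<in> carrier R. \<forall>x \<in> carrier R. z \<otimes>\<^bsub>R\<^esub> x = x \<otimes>\<^bsub>R\<^esub> z}"

definition partitions :: "nat \<Rightarrow> nat multiset set"
  where "partitions n = {l. 0 \<notin># l \<and> sum_mset l = n}"

definition num_even_parts :: "nat multiset \<Rightarrow> nat"
  where "num_even_parts l = size (filter_mset even l)"

text \<open>Indices \<open>j\<close> for which \<open>2 * j\<close> is not a part would only contribute factors \<open>0! = 1\<close>.\<close>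

definition even_mult_fact :: "nat multiset \<Rightarrow> nat"
  where "even_mult_fact l = (\<Prod>j | j \<ge> 1 \<and> 2 * j \<in># l. fact (count l (2 * j)))"

text \<open>Well-definedness: the quotient is a ring, the scalars form a subfield, the sum is finite.\<close>

lemma keys_mult_word:
  fixes p q :: "word \<Rightarrow>\<^sub>0 'k::field"
  shows "Poly_Mapping.keys (p * q) \<subseteq>
    {u + v | u v. u \<in> Poly_Mapping.keys p \<and> v \<in> Poly_Mapping.keys q}"
  by (rule keys_mult)

lemma ring_free_algebra: "ring (free_algebra K n)"
proof (rule ringI)
  show "abelian_group (free_algebra K n)"
  proof (rule abelian_groupI)
    fix x y
    assume "x \<in> carrier (free_algebra K n)" "y \<in> carrier (free_algebra K n)"
    then show "x \<oplus>\<^bsub>free_algebra K n\<^esub> y \<in> carrier (free_algebra K n)"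
      using Poly_Mapping.keys_add[of x y] by (auto simp: free_algebra_def)
  next
    fix x
    assume "x \<in> carrier (free_algebra K n)"
    then show "\<exists>y\<in>carrier (free_algebra K n).
        y \<oplus>\<^bsub>free_algebra K n\<^esub> x = \<zero>\<^bsub>free_algebra K n\<^esub>"
      by (intro bexI[of _ "- x"]) (auto simp: free_algebra_def)
  qed (auto simp: free_algebra_def add_ac)
next
  show "Group.monoid (free_algebra K n)"
  proof (rule monoidI)
    fix x y
    assume "x \<in> carrier (free_algebra K n)" "y \<in> carrier (free_algebra K n)"
    then show "x \<otimes>\<^bsub>free_algebra K n\<^esub> y \<in> carrier (free_algebra K n)"
      using keys_mult_word[of x y] by (fastforce simp: free_algebra_def plus_word_def)
  qed (auto simp: free_algebra_def mult.assoc zero_word_def)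
qed (auto simp: free_algebra_def algebra_simps)

lemma lookup_mult_zero_word:
  fixes p q :: "word \<Rightarrow>\<^sub>0 'k::field"
  shows "Poly_Mapping.lookup (p * q) 0 = Poly_Mapping.lookup p 0 * Poly_Mapping.lookup q 0"
proof -
  have *: "(0 = u + v) \<longleftrightarrow> u = 0 \<and> v = 0" for u v :: word
    by (cases u; cases v) (auto simp: zero_word_def plus_word_def)
  have "Sum_any (\<lambda>v. Poly_Mapping.lookup q v when 0 = u + v) = (Poly_Mapping.lookup q 0 when u = 0)" for u :: word
    by (cases "u = 0") (simp_all add: *)
  then show ?thesis
    by (simp add: lookup_mult mult_when)
qed

lemma scalar_in_free_algebra: "scalar c \<in> carrier (free_algebra K n)"
  by (auto simp: free_algebra_def scalar_def zero_word_def)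

lemma hecke_relators_subset:
  "hecke_relators n \<subseteq> carrier (free_algebra (K :: 'k::field itself) n)"
proof -
  interpret ring "free_algebra K n"
    by (rule ring_free_algebra)
  have g: "gen i \<in> carrier (free_algebra K n)" if "i \<in> {1..<n}" for i
    using that by (auto simp: free_algebra_def gen_def)
  have m: "x * y \<in> carrier (free_algebra K n)"
    if "x \<in> carrier (free_algebra K n)" "y \<in> carrier (free_algebra K n)" for x y
    using m_closed[OF that] by (simp add: free_algebra_def)
  have d: "x - y \<in> carrier (free_algebra K n)"
    if "x \<in> carrier (free_algebra K n)" "y \<in> carrier (free_algebra K n)" for x y
    using that keys_diff[of x y] by (auto simp: free_algebra_def)
  show ?thesis
    unfolding hecke_relators_def by (auto intro!: d m g)
qed

lemma ideal_hecke_ideal: "ideal (hecke_ideal K n) (free_algebra K n)"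
  unfolding hecke_ideal_def
  by (rule ring.genideal_ideal[OF ring_free_algebra hecke_relators_subset])

lemma ring_hecke_algebra: "ring (hecke_algebra K n)"
  unfolding hecke_algebra_def by (rule ideal.quotient_is_ring[OF ideal_hecke_ideal])

lemma zero_hecke_algebra: "\<zero>\<^bsub>hecke_algebra K n\<^esub> = hecke_ideal K n"
  by (simp add: hecke_algebra_def FactRing_def)

lemma lookup_hecke_ideal:
  assumes "p \<in> hecke_ideal (K :: 'k::field itself) n"
  shows "Poly_Mapping.lookup p 0 = 0"
proof -
  interpret ring "free_algebra K n"
    by (rule ring_free_algebra)
  let ?A = "{p \<in> carrier (free_algebra K n). Poly_Mapping.lookup p 0 = 0}"
  have minv: "\<ominus>\<^bsub>free_algebra K n\<^esub> x = - x" if "x \<in> carrier (free_algebra K n)" for x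
    by (rule minus_equality) (use that in \<open>auto simp: free_algebra_def\<close>)
  have "ideal ?A (free_algebra K n)"
  proof (rule idealI[OF ring_free_algebra])
    show "subgroup ?A (add_monoid (free_algebra K n))"
    proof (rule group.subgroupI)
      show "Group.group (add_monoid (free_algebra K n))"
        by (rule a_group)
      show "inv\<^bsub>add_monoid (free_algebra K n)\<^esub> a \<in> ?A" if "a \<in> ?A" for a
        using that minv[of a] by (auto simp: a_inv_def free_algebra_def)
      show "a \<otimes>\<^bsub>add_monoid (free_algebra K n)\<^esub> b \<in> ?A" if "a \<in> ?A" "b \<in> ?A" for a b
        using that a_closed[of a b] by (auto simp: free_algebra_def lookup_add)
    qed (auto simp: free_algebra_def intro!: exI[of _ 0])
  next
    fix a x
    assume a: "a \<in> ?A" and x: "x \<in> carrier (free_algebra K n)"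
    show "x \<otimes>\<^bsub>free_algebra K n\<^esub> a \<in> ?A" "a \<otimes>\<^bsub>free_algebra K n\<^esub> x \<in> ?A"
      using a x m_closed[of a x] m_closed[of x a]
      by (auto simp: free_algebra_def lookup_mult_zero_word)
  qed
  moreover have "hecke_relators n \<subseteq> ?A"
  proof
    fix x :: "word \<Rightarrow>\<^sub>0 'k"
    assume x: "x \<in> hecke_relators n"
    have gen: "Poly_Mapping.lookup (gen i :: word \<Rightarrow>\<^sub>0 'k) 0 = 0" for i
      by (simp add: gen_def lookup_single zero_word_def)
    have "Poly_Mapping.lookup x 0 = 0"
      using x by (auto simp: hecke_relators_def lookup_minus lookup_mult_zero_word gen)
    then show "x \<in> ?A"
      using x hecke_relators_subset[of n K] by auto
  qed
  ultimately have "hecke_ideal K n \<subseteq> ?A"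
    unfolding hecke_ideal_def by (rule genideal_minimal)
  then show ?thesis
    using assms by auto
qed

lemma subfield_hecke_scalars: "subfield (hecke_scalars (K :: 'k::field itself) n) (hecke_algebra K n)"
proof -
  let ?F = "free_algebra K n" and ?H = "hecke_algebra K n"
  let ?h = "\<lambda>p. hecke_ideal K n +>\<^bsub>?F\<^esub> p"
  interpret F: ring ?F
    by (rule ring_free_algebra)
  interpret H: ring ?H
    by (rule ring_hecke_algebra)
  interpret h: ring_hom_ring ?F ?H ?h
    unfolding hecke_algebra_def by (rule ideal.rcos_ring_hom_ring[OF ideal_hecke_ideal])
  have sc [simp]: "scalar c \<in> carrier ?F" for c
    by (rule scalar_in_free_algebra)
  define s where "s c = ?h (scalar c)" for c
  have range: "hecke_scalars K n = range s"
    by (simp add: hecke_scalars_def s_def)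
  have closed: "s c \<in> carrier ?H" for c
    unfolding s_def by (rule h.hom_closed[OF sc])
  have one: "s 1 = \<one>\<^bsub>?H\<^esub>"
    using h.hom_one by (simp add: s_def free_algebra_def scalar_def)
  have zero: "s 0 = \<zero>\<^bsub>?H\<^esub>"
    using h.hom_zero by (simp add: s_def free_algebra_def scalar_def)
  have add: "s a \<oplus>\<^bsub>?H\<^esub> s b = s (a + b)" for a b
    using h.hom_add[OF sc sc, of a b]
    by (simp add: s_def free_algebra_def scalar_def single_add)
  have mult: "s a \<otimes>\<^bsub>?H\<^esub> s b = s (a * b)" for a b
    using h.hom_mult[OF sc sc, of a b]
    by (simp add: s_def free_algebra_def scalar_def mult_single)
  have inj: "a = 0" if "s a = \<zero>\<^bsub>?H\<^esub>" for a
  proof -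
    have "scalar a \<in> s a"
      unfolding s_def
      by (rule abelian_subgroup.a_rcos_self[OF _ sc])
        (rule abelian_subgroupI3[OF ideal.axioms(1)[OF ideal_hecke_ideal] F.is_abelian_group])
    then have "scalar a \<in> hecke_ideal K n"
      unfolding that zero_hecke_algebra .
    from lookup_hecke_ideal[OF this] show ?thesis
      by (simp add: scalar_def)
  qed
  have uminus: "\<ominus>\<^bsub>?H\<^esub> s a = s (- a)" for a
    by (rule H.minus_equality[OF _ closed closed]) (simp add: add zero)
  have subc: "subcring (range s) ?H"
  proof (rule H.subcringI)
    show "subring (range s) ?H"
    proof (rule H.subringI)
      show "\<one>\<^bsub>?H\<^esub> \<in> range s"
        by (metis one rangeI)
    qed (auto simp: closed add mult uminus)
  qed (auto simp: mult mult.commute)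
  show ?thesis
    unfolding range
  proof (rule H.subfieldI[OF subc])
    have unit: "s a \<in> Units (?H\<lparr>carrier := range s\<rparr>)" if "a \<noteq> 0" for a
    proof -
      have "s (inverse a) \<otimes>\<^bsub>?H\<^esub> s a = \<one>\<^bsub>?H\<^esub>" "s a \<otimes>\<^bsub>?H\<^esub> s (inverse a) = \<one>\<^bsub>?H\<^esub>"
        using that by (simp_all add: mult one)
      then show ?thesis
        unfolding Units_def by auto
    qed
    have zero_notin: "\<zero>\<^bsub>?H\<^esub> \<notin> Units (?H\<lparr>carrier := range s\<rparr>)"
    proof
      assume "\<zero>\<^bsub>?H\<^esub> \<in> Units (?H\<lparr>carrier := range s\<rparr>)"
      then obtain b where "s b \<otimes>\<^bsub>?H\<^esub> \<zero>\<^bsub>?H\<^esub> = \<one>\<^bsub>?H\<^esub>"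
        by (auto simp: Units_def)
      then have "s 1 = \<zero>\<^bsub>?H\<^esub>"
        using closed by (simp add: one)
      from inj[OF this] show False
        by simp
    qed
    have sub: "Units (?H\<lparr>carrier := range s\<rparr>) \<subseteq> range s"
      by (auto simp: Units_def)
    show "Units (?H\<lparr>carrier := range s\<rparr>) = range s - {\<zero>\<^bsub>?H\<^esub>}"
    proof (intro equalityI subsetI)
      fix x
      assume "x \<in> range s - {\<zero>\<^bsub>?H\<^esub>}"
      then obtain a where a: "x = s a" "s a \<noteq> \<zero>\<^bsub>?H\<^esub>"
        by auto
      then have "a \<noteq> 0"
        using zero by metis
      then show "x \<in> Units (?H\<lparr>carrier := range s\<rparr>)"
        using unit a(1) by simp
    next
      fix x
      assume x: "x \<in> Units (?H\<lparr>carrier := range s\<rparr>)"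
      then have "x \<noteq> \<zero>\<^bsub>?H\<^esub>"
        using zero_notin by metis
      with x sub show "x \<in> range s - {\<zero>\<^bsub>?H\<^esub>}"
        by fast
    qed
  qed
qed

lemma finite_partitions: "finite (partitions n)"
proof (rule finite_subset)
  show "finite (mset ` {xs. set xs \<subseteq> {1..n} \<and> length xs \<le> n})"
    by (intro finite_imageI finite_lists_length_le) simp
  show "partitions n \<subseteq> mset ` {xs. set xs \<subseteq> {1..n} \<and> length xs \<le> n}"
  proof
    fix l
    assume l: "l \<in> partitions n"
    obtain xs where xs: "l = mset xs"
      by (metis ex_mset)
    have sum: "sum_list xs = n" and pos: "0 \<notin> set xs"
      using l by (auto simp: partitions_def xs sum_mset_sum_list)
    have "length ys \<le> sum_list ys" if "0 \<notin> set ys" for ys :: "nat list"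
      using that by (induction ys) auto
    with pos sum have "length xs \<le> n"
      by auto
    moreover have "set xs \<subseteq> {1..n}"
      using pos sum member_le_sum_list[of _ xs] by (auto simp: Suc_le_eq intro: gr0I)
    ultimately show "l \<in> mset ` {xs. set xs \<subseteq> {1..n} \<and> length xs \<le> n}"
      using xs by auto
  qed
qed

end

theory Submission
  imports Defs "HOL-Combinatorics.Cycles" "HOL-Combinatorics.Multiset_Permutations"
begin

text \<open>
  The 0-Hecke algebra is the algebra of the monoid of words modulo the Hecke relations, whose
  elements correspond to permutations. After a twist by signs, the equations for the coefficients of
  a central element say that they are constant on the classes of permutations generated by
  \<open>sort_left i y \<sim> sort_right i y\<close>, so the dimension is the number of classes.

  In terms of words, the classes are generated by the Hecke relations and by rotating a letter \<open>i\<close>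
  at the front to \<open>n - i\<close> at the back. Splitting off the end nodes of the Dynkin diagram and always
  passing to shorter words, one reaches a word given by a composition of \<open>n\<close> whose even parts come
  first, in any order, and whose odd parts follow in decreasing order. This bounds the number of
  classes from above.

  Conversely, each such composition gives a permutation with nested cycles of these lengths. The
  even parts are recovered from the initial segments \<open>{1..a}\<close> that the permutation exchanges with
  the final ones. The odd parts are recovered from max-plus traces of powers of the rank matrix: for
  odd \<open>k\<close>, twice the trace of the \<open>k\<close>-th power is \<open>n k\<close> minus the sum of \<open>min p k\<close> over the odd
  parts \<open>p\<close>.
\<close>

unbundle no m_inv_syntax

text \<open>The reflection i -> n - i comes from the longest element w0, because w0 s_i = s_(n-i)
  w0. A word w is read as the permutation w0 w, so a letter i in front sorts on the left at n - i,
  while a letter i at the back sorts on the right at i. The classes of words are thus a basis of the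
  quotient of the algebra by all T_i h - h T_(n-i), a twisted cocenter whose dual is the center.
  Even and odd parts behave differently for a reason of parity. A cyclic sequence of zeros and ones
  descends at most half as often as it is long, and exactly half is possible only for even length.
  In the trace of an odd power each odd cycle therefore causes a defect and an even cycle causes
  none. These traces recover the odd parts, without their order, and are blind to the even parts.
  The second invariant is needed for the even parts, and it also sees their order.\<close>

fun canonical :: "nat list \<Rightarrow> bool"
where
  "canonical [] \<longleftrightarrow> True"
| "canonical (p # ps) \<longleftrightarrow> 0 < p \<and> canonical ps \<and> (odd p \<longrightarrow> (\<forall>q\<in>set ps. odd q \<and> q \<le> p))"

lemma canonical_zero: "canonical ps \<Longrightarrow> 0 \<notin> set ps"
  by (induction ps) auto

section \<open>Twisted conjugacy of words\<close>

text \<open>Letters range over all natural numbers, and membership in \<open>{1..<n}\<close> is a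
  separate side condition, preserved because the relations keep the set of letters. One congruence
  thus serves every rank and survives \<open>shift\<close>.\<close>

inductive hecke_rel :: "nat list \<Rightarrow> nat list \<Rightarrow> bool"
where
  idem: "hecke_rel [i, i] [i]"
| comm: "Suc i < j \<or> Suc j < i \<Longrightarrow> hecke_rel [i, j] [j, i]"
| braid: "hecke_rel [i, Suc i, i] [Suc i, i, Suc i]"

inductive hecke_eq :: "nat list \<Rightarrow> nat list \<Rightarrow> bool"  (infix \<open>\<approx>\<close> 50)
where
  rel: "hecke_rel l r \<Longrightarrow> u @ l @ v \<approx> u @ r @ v"
| refl: "w \<approx> w"
| sym: "v \<approx> w \<Longrightarrow> w \<approx> v"
| trans: "u \<approx> v \<Longrightarrow> v \<approx> w \<Longrightarrow> u \<approx> w"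

declare hecke_eq.refl [simp, intro]
declare hecke_eq.trans [trans]

text \<open>Under \<open>word_perm\<close> the two sides of \<open>rotate\<close> become
  \<open>sort_left (n - i)\<close> and \<open>sort_right (n - i)\<close> of one permutation, which
  is the generating relation of \<open>sort_equiv\<close>.\<close>

inductive twisted_conj :: "nat \<Rightarrow> nat list \<Rightarrow> nat list \<Rightarrow> bool"
  for n :: nat
where
  hecke: "v \<approx> w \<Longrightarrow> twisted_conj n v w"
| rotate: "1 \<le> i \<Longrightarrow> i < n \<Longrightarrow> twisted_conj n (i # w) (w @ [n - i])"
| sym: "twisted_conj n v w \<Longrightarrow> twisted_conj n w v"
| trans: "twisted_conj n u v \<Longrightarrow> twisted_conj n v w \<Longrightarrow> twisted_conj n u w"

declare twisted_conj.trans [trans]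

lemma hecke_eq_context: "v \<approx> w \<Longrightarrow> x @ v @ y \<approx> x @ w @ y"
proof (induction rule: hecke_eq.induct)
  case (rel l r u v)
  show ?case
    using hecke_eq.rel[OF rel, of "x @ u" "v @ y"] by simp
qed (auto intro: hecke_eq.sym hecke_eq.trans)

lemma hecke_eq_append: "u \<approx> u' \<Longrightarrow> v \<approx> v' \<Longrightarrow> u @ v \<approx> u' @ v'"
  using hecke_eq_context[of u u' "[]" v] hecke_eq_context[of v v' u' "[]"]
  by (auto intro: hecke_eq.trans)

lemma hecke_eq_Cons: "v \<approx> v' \<Longrightarrow> i # v \<approx> i # v'"
  using hecke_eq_append[of "[i]" "[i]" v v'] by simp

lemma hecke_eq_appendL: "u \<approx> u' \<Longrightarrow> u @ v \<approx> u' @ v"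
  by (rule hecke_eq_append) auto

lemma hecke_eq_appendR: "v \<approx> v' \<Longrightarrow> u @ v \<approx> u @ v'"
  by (rule hecke_eq_append) auto

definition far :: "nat list \<Rightarrow> nat list \<Rightarrow> bool"
  where "far u v \<longleftrightarrow> (\<forall>i\<in>set u. \<forall>j\<in>set v. Suc i < j \<or> Suc j < i)"

lemma hecke_eq_letter_commute: "far [i] v \<Longrightarrow> i # v \<approx> v @ [i]"
proof (induction v)
  case (Cons j v)
  have "i # j # v \<approx> j # i # v"
    using hecke_eq.rel[OF hecke_rel.comm, of i j "[]" v] Cons.prems by (auto simp: far_def)
  also have "\<dots> \<approx> j # v @ [i]"
    using Cons by (auto intro!: hecke_eq_Cons simp: far_def)
  finally show ?case
    by simp
qed simp

lemma hecke_eq_commute: "far u v \<Longrightarrow> u @ v \<approx> v @ u"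
proof (induction u)
  case (Cons i u)
  have "i # u @ v \<approx> i # v @ u"
    using Cons by (auto intro!: hecke_eq_Cons simp: far_def)
  also have "\<dots> \<approx> (v @ [i]) @ u"
    using hecke_eq_appendL[OF hecke_eq_letter_commute[of i v], of u] Cons.prems
    by (auto simp: far_def)
  finally show ?case
    by simp
qed simp

lemma hecke_eq_set: "v \<approx> w \<Longrightarrow> set v = set w"
proof (induction rule: hecke_eq.induct)
  case (rel l r u v)
  then have "set l = set r"
    by (induction rule: hecke_rel.induct) auto
  then show ?case
    by simp
qed auto

lemma twisted_conj_refl [simp]: "twisted_conj n w w"
  by (simp add: twisted_conj.hecke)

lemma twisted_conj_hecke_left [trans]: "u \<approx> v \<Longrightarrow> twisted_conj n v w \<Longrightarrow> twisted_conj n u w"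
  by (blast intro: twisted_conj.hecke twisted_conj.trans)

lemma twisted_conj_hecke_right [trans]: "twisted_conj n u v \<Longrightarrow> v \<approx> w \<Longrightarrow> twisted_conj n u w"
  by (blast intro: twisted_conj.hecke twisted_conj.trans)

lemma twisted_conj_rotate:
  "set u \<subseteq> {1..<n} \<Longrightarrow> twisted_conj n (u @ v) (v @ map (\<lambda>i. n - i) u)"
proof (induction u arbitrary: v)
  case (Cons i u)
  have "twisted_conj n (i # u @ v) ((u @ v) @ [n - i])"
    by (rule twisted_conj.rotate) (use Cons.prems in auto)
  also have "twisted_conj n \<dots> ((v @ [n - i]) @ map (\<lambda>i. n - i) u)"
    using Cons.IH[of "v @ [n - i]"] Cons.prems by simp
  finally show ?case
    by simp
qed simp

lemma twisted_conj_rotate':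
  assumes "set v \<subseteq> {1..<n}"
  shows "twisted_conj n (u @ v) (map (\<lambda>i. n - i) v @ u)"
proof -
  have "map (\<lambda>i. n - i) (map (\<lambda>i. n - i) v) = v"
    using assms by (induction v) auto
  then have "twisted_conj n (map (\<lambda>i. n - i) v @ u) (u @ v)"
    using twisted_conj_rotate[of "map (\<lambda>i. n - i) v" n u] assms by fastforce
  then show ?thesis
    by (rule twisted_conj.sym)
qed

section \<open>Descending runs and parabolic coset forms\<close>

definition down :: "nat \<Rightarrow> nat \<Rightarrow> nat list"
  where "down a b = rev [b..<Suc a]"

lemma set_down [simp]: "set (down a b) = {b..a}"
  by (auto simp: down_def)

lemma length_down [simp]: "length (down a b) = Suc a - b"
  by (simp add: down_def del: upt_Suc)

lemma down_empty [simp]: "a < b \<Longrightarrow> down a b = []"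
  by (simp add: down_def)

lemma down_Cons: "b \<le> Suc a \<Longrightarrow> down (Suc a) b = Suc a # down a b"
  by (simp add: down_def)

lemma down_snoc: "b \<le> a \<Longrightarrow> down a b = down a (Suc b) @ [b]"
  by (simp add: down_def upt_rec)

lemma down_split:
  assumes "b \<le> c" "c \<le> a"
  shows "down a b = down a (Suc c) @ down c b"
proof -
  have "[b..<Suc a] = [b..<Suc c] @ [Suc c..<Suc a]"
    using assms upt_add_eq_append[of b "Suc c" "a - c"] by simp
  then show ?thesis
    by (simp add: down_def del: upt_Suc)
qed

lemma map_add_down: "map (\<lambda>i. i + k) (down a b) = down (a + k) (b + k)"
proof -
  have "map (\<lambda>i. i + k) [b..<Suc a] = [b + k..<Suc a + k]"
    by (rule nth_equalityI) (auto simp del: upt_Suc)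
  then show ?thesis
    by (simp add: down_def flip: rev_map del: upt_Suc)
qed

lemma down_absorb_front:
  assumes "b \<le> a"
  shows "a # down a b \<approx> down a b"
proof -
  have "\<exists>w. down a b = a # w"
    using assms down_Cons[of b "a - 1"] by (cases a) (auto simp: down_def)
  then obtain w where "down a b = a # w"
    by blast
  then show ?thesis
    using hecke_eq.rel[OF hecke_rel.idem, of "[]" a w] by simp
qed

lemma down_absorb_back:
  assumes "b \<le> a"
  shows "down a b @ [b] \<approx> down a b"
  unfolding down_snoc[OF assms] using hecke_eq.rel[OF hecke_rel.idem, of "down a (Suc b)" b "[]"] by simp

text \<open>The letter \<open>i\<close> commutes with the letters above \<open>Suc i\<close>, the
  braid relation turns \<open>i, Suc i, i\<close> into \<open>Suc i, i, Suc i\<close>, and the new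
  \<open>Suc i\<close> commutes with the letters below \<open>i\<close>. This move drives all later
  rewriting: passing a run raises a letter by one.\<close>

lemma down_pass_letter:
  assumes "1 \<le> b" "b \<le> i" "i < a"
  shows "i # down a b \<approx> down a b @ [Suc i]"
proof -
  have d: "down a b = down a (Suc (Suc i)) @ [Suc i, i] @ down (i - 1) b"
  proof -
    have "down a b = down a (Suc (Suc i)) @ down (Suc i) b"
      by (rule down_split) (use assms in auto)
    also have "down (Suc i) b = Suc i # down i b"
      by (rule down_Cons) (use assms in auto)
    also have "down i b = i # down (i - 1) b"
      using down_Cons[of b "i - 1"] assms by auto
    finally show ?thesis
      by simp
  qed
  have "i # down a b \<approx> (down a (Suc (Suc i)) @ [i]) @ [Suc i, i] @ down (i - 1) b"
    unfolding d append_Cons[symmetric]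
    by (rule hecke_eq_appendL, rule hecke_eq_letter_commute) (auto simp: far_def)
  also have "\<dots> \<approx> down a (Suc (Suc i)) @ [Suc i, i, Suc i] @ down (i - 1) b"
    using hecke_eq.rel[OF hecke_rel.braid, of "down a (Suc (Suc i))" i "down (i - 1) b"] by simp
  also have "\<dots> \<approx> (down a (Suc (Suc i)) @ [Suc i, i]) @ (down (i - 1) b @ [Suc i])"
  proof -
    have "far [Suc i] (down (i - 1) b)"
      using assms by (auto simp: far_def)
    from hecke_eq_appendR[OF hecke_eq_letter_commute[OF this], of "down a (Suc (Suc i)) @ [Suc i, i]"]
    show ?thesis
      by simp
  qed
  finally show ?thesis
    by (simp add: d)
qed

lemma down_pass:
  assumes "1 \<le> b" "set u \<subseteq> {b..<a}"
  shows "u @ down a b \<approx> down a b @ map Suc u"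
  using assms(2)
proof (induction u)
  case (Cons i u)
  have "i # u @ down a b \<approx> i # down a b @ map Suc u"
    using Cons by (auto intro!: hecke_eq_Cons)
  also have "i # down a b @ map Suc u \<approx> (down a b @ [Suc i]) @ map Suc u"
    using hecke_eq_appendL[OF down_pass_letter[of b i a], of "map Suc u"] assms Cons.prems by auto
  finally show ?case
    by simp
qed simp

text \<open>Coset decomposition for the parabolic submonoid on \<open>{lo..<hi}\<close>, with the
  runs \<open>down hi j\<close> as representatives; \<open>j = Suc hi\<close> is the empty run. A
  new last letter starts the run, extends it, is absorbed by it, or passes it into \<open>b\<close>,
  unchanged or lowered by one. No case lengthens the word beyond that letter.\<close>

lemma hecke_coset_form:
  assumes "set w \<subseteq> {lo..hi}" "1 \<le> lo" "lo \<le> Suc hi"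
  shows "\<exists>b j. lo \<le> j \<and> j \<le> Suc hi \<and> set b \<subseteq> {lo..<hi} \<and> w \<approx> b @ down hi j \<and>
    length (b @ down hi j) \<le> length w"
  using assms(1)
proof (induction w rule: rev_induct)
  case Nil
  show ?case
    by (rule exI[of _ "[]"], rule exI[of _ "Suc hi"]) (use assms in auto)
next
  case (snoc i w)
  then obtain b j where *: "lo \<le> j" "j \<le> Suc hi" "set b \<subseteq> {lo..<hi}" "w \<approx> b @ down hi j"
      "length (b @ down hi j) \<le> length w"
    by auto
  have i: "lo \<le> i" "i \<le> hi"
    using snoc.prems by auto
  have w: "w @ [i] \<approx> b @ (down hi j @ [i])"
    using hecke_eq_appendL[OF *(4), of "[i]"] by simp
  have goal: ?case if "b @ (down hi j @ [i]) \<approx> b' @ down hi j'" "lo \<le> j'" "j' \<le> Suc hi"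
    "set b' \<subseteq> {lo..<hi}" "length (b' @ down hi j') \<le> Suc (length (b @ down hi j))" for b' j'
    using that w *(5) by (intro exI[of _ b'] exI[of _ j']) (auto intro: hecke_eq.trans)
  consider "j = Suc hi" "i = hi" | "j = Suc hi" "i < hi" | "j \<le> hi" "i = j"
    | "j \<le> hi" "Suc i = j" | "j \<le> hi" "Suc i < j" | "j \<le> hi" "j < i"
    using i *(2) by linarith
  then show ?case
  proof cases
    case 1
    then show ?thesis
      by (intro goal[of b hi]) (use * i in \<open>auto simp: down_def\<close>)
  next
    case 2
    then show ?thesis
      by (intro goal[of "b @ [i]" j]) (use * i in auto)
  next
    case 3
    then show ?thesis
      by (intro goal[of b j] hecke_eq_appendR) (use * i down_absorb_back[of j hi] in auto)
  next
    case 4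
    then show ?thesis
      by (intro goal[of b i]) (use * i down_snoc[of i hi] in auto)
  next
    case 5
    have "i # down hi j \<approx> down hi j @ [i]"
      by (rule hecke_eq_letter_commute) (use 5 in \<open>auto simp: far_def\<close>)
    then have "b @ (down hi j @ [i]) \<approx> b @ (i # down hi j)"
      by (intro hecke_eq_appendR) (rule hecke_eq.sym)
    then show ?thesis
      by (intro goal[of "b @ [i]" j]) (use * i 5 in auto)
  next
    case 6
    have "(i - 1) # down hi j \<approx> down hi j @ [Suc (i - 1)]"
      by (rule down_pass_letter) (use 6 * i assms in auto)
    then have "b @ (down hi j @ [i]) \<approx> b @ ((i - 1) # down hi j)"
      using 6 by (intro hecke_eq_appendR) (auto intro: hecke_eq.sym)
    then show ?thesis
      by (intro goal[of "b @ [i - 1]" j]) (use * i 6 in auto)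
  qed
qed

text \<open>A nonempty run \<open>down hi j\<close> contains \<open>hi\<close> only as its first
  letter, so the top letter can always be reduced to at most one occurrence.\<close>

lemma hecke_double_coset_form:
  assumes "set w \<subseteq> {lo..hi}" "1 \<le> lo" "lo \<le> Suc hi"
  obtains b where "set b \<subseteq> {lo..<hi}" "w \<approx> b" "length b \<le> length w"
  | b c where "lo \<le> hi" "set b \<subseteq> {lo..<hi}" "set c \<subseteq> {lo..<hi}" "w \<approx> b @ [hi] @ c"
    "length (b @ [hi] @ c) \<le> length w"
proof -
  obtain b j where *: "lo \<le> j" "j \<le> Suc hi" "set b \<subseteq> {lo..<hi}" "w \<approx> b @ down hi j"
      "length (b @ down hi j) \<le> length w"
    using hecke_coset_form[OF assms] by blast
  show thesis
  proof (cases "j = Suc hi")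
    case True
    then show thesis
      using * by (intro that(1)[of b]) auto
  next
    case False
    then have "down hi j = hi # down (hi - 1) j"
      using down_Cons[of j "hi - 1"] * assms by (cases hi) auto
    then show thesis
      using * False assms by (intro that(2)[of b "down (hi - 1) j"]) auto
  qed
qed

section \<open>Shifted words and splitting off one part of the composition\<close>

definition shift :: "nat \<Rightarrow> nat list \<Rightarrow> nat list"
  where "shift k = map (\<lambda>i. i + k)"

lemma shift_simps [simp]:
  "shift k [] = []" "shift k (i # w) = (i + k) # shift k w" "shift k (v @ w) = shift k v @ shift k w"
  "length (shift k w) = length w" "set (shift k w) = (\<lambda>i. i + k) ` set w"
  "shift k (down a b) = down (a + k) (b + k)" "shift k (shift l w) = shift (l + k) w"
  by (simp_all add: shift_def map_add_down add.assoc)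

lemma shift_unshift:
  assumes "\<forall>i\<in>set w. k < i"
  obtains d where "w = shift k d" "\<forall>i\<in>set d. 1 \<le> i" "length d = length w"
proof (rule that)
  show "w = shift k (map (\<lambda>i. i - k) w)"
    using assms by (induction w) (auto simp: shift_def)
qed (use assms in auto)

lemma hecke_eq_shift: "v \<approx> w \<Longrightarrow> shift k v \<approx> shift k w"
proof (induction rule: hecke_eq.induct)
  case (rel l r u v)
  then have "hecke_rel (shift k l) (shift k r)"
  proof (induction rule: hecke_rel.induct)
    case (braid i)
    show ?case
      using hecke_rel.braid[of "i + k"] by simp
  qed (auto intro: hecke_rel.intros)
  from hecke_eq.rel[OF this, of "shift k u" "shift k v"] show ?case
    by simp
qed (auto intro: hecke_eq.sym hecke_eq.trans)

text \<open>Letters of \<open>shift a v\<close> lie below \<open>n - a\<close> and commute with the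
  prefix, and the shift intertwines the two reflections: n - (i + a) = (n - 2a - i) + a.\<close>

lemma twisted_conj_lift_even:
  assumes "1 \<le> a" "2 * a \<le> n" "twisted_conj (n - 2 * a) v w"
  shows "twisted_conj n (down (n - 1) (n - a + 1) @ shift a v) (down (n - 1) (n - a + 1) @ shift a w)"
  using assms(3)
proof (induction rule: twisted_conj.induct)
  case (rotate i w)
  let ?P = "down (n - 1) (n - a + 1)"
  have "?P @ shift a (i # w) \<approx> ((i + a) # ?P) @ shift a w"
  proof -
    have "far [i + a] ?P"
      using rotate by (auto simp: far_def)
    from hecke_eq_appendL[OF hecke_eq.sym[OF hecke_eq_letter_commute[OF this]], of "shift a w"]
    show ?thesis
      by simp
  qed
  also have "twisted_conj n (((i + a) # ?P) @ shift a w) ((?P @ shift a w) @ [n - (i + a)])"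
    unfolding append_Cons by (rule twisted_conj.rotate) (use rotate in auto)
  also have "n - (i + a) = n - 2 * a - i + a"
    using rotate by simp
  finally show ?case
    by simp
qed (auto intro: twisted_conj.sym twisted_conj.trans twisted_conj.hecke hecke_eq_appendR hecke_eq_shift)

text \<open>Here the letters overlap the prefix. A letter i + a + 1 behind the run emerges in front
  of it as i + a, and its reflection n - (i + a) = (n - (2a + 1) - i) + (a + 1) has the right shift
  again.\<close>

lemma twisted_conj_lift_odd:
  assumes "2 * a + 1 \<le> n" "twisted_conj (n - (2 * a + 1)) v w"
  shows "twisted_conj n (down (n - 1) (a + 1) @ shift (a + 1) v) (down (n - 1) (a + 1) @ shift (a + 1) w)"
  using assms(2)
proof (induction rule: twisted_conj.induct)
  case (rotate i w)
  let ?P = "down (n - 1) (a + 1)"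
  have "?P @ shift (a + 1) (i # w) \<approx> ((i + a) # ?P) @ shift (a + 1) w"
    using hecke_eq_appendL[OF hecke_eq.sym[OF down_pass_letter[of "a + 1" "i + a" "n - 1"]],
        of "shift (a + 1) w"] rotate by auto
  also have "twisted_conj n (((i + a) # ?P) @ shift (a + 1) w) ((?P @ shift (a + 1) w) @ [n - (i + a)])"
    unfolding append_Cons by (rule twisted_conj.rotate) (use rotate in auto)
  also have "n - (i + a) = n - (2 * a + 1) - i + (a + 1)"
    using rotate by simp
  finally show ?case
    by simp
qed (auto intro: twisted_conj.sym twisted_conj.trans twisted_conj.hecke hecke_eq_appendR hecke_eq_shift)

text \<open>
  The end nodes of the Dynkin diagram are peeled off in pairs \<open>{t, n - t}\<close>, exchanged by the
  rotation, leaving at most one letter of each pair until a part of the composition is complete.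
\<close>

lemma twisted_conj_peel:
  assumes "2 * t + 1 \<le> n" "set b \<subseteq> {t + 1..<n - t}"
  shows "(\<exists>a d. 1 \<le> a \<and> 2 * a \<le> n \<and> set d \<subseteq> {1..<n - 2 * a} \<and>
      twisted_conj n (down (n - 1) (n - t) @ b) (down (n - 1) (n - a + 1) @ shift a d) \<and>
      length (down (n - 1) (n - a + 1) @ shift a d) \<le> t + length b) \<or>
    (\<exists>a d. 2 * a + 1 \<le> n \<and> set d \<subseteq> {1..<n - (2 * a + 1)} \<and>
      twisted_conj n (down (n - 1) (n - t) @ b) (down (n - 1) (a + 1) @ shift (a + 1) d) \<and>
      length (down (n - 1) (a + 1) @ shift (a + 1) d) \<le> t + length b)"
    (is "?even t b \<or> ?odd t b")
  using assms
proof (induction "n - 2 * t" arbitrary: t b rule: less_induct)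
  case less
  let ?P = "down (n - 1) (n - t)" and ?m = "n - t - 1"
  have rot: "twisted_conj n (?P @ u @ v) (?P @ v @ map (\<lambda>i. n - i) u)" if "set u \<subseteq> {t + 1..<?m}" for u v
  proof -
    have "far ?P u"
      using that less.prems by (force simp: far_def)
    from hecke_eq_appendL[OF hecke_eq_commute[OF this], of v]
    have "?P @ u @ v \<approx> u @ ?P @ v"
      by simp
    also have "twisted_conj n (u @ ?P @ v) ((?P @ v) @ map (\<lambda>i. n - i) u)"
      by (rule twisted_conj_rotate) (use that less.prems in force)
    finally show ?thesis
      by simp
  qed
  obtain b1 j where b1: "t + 1 \<le> j" "j \<le> Suc ?m" "set b1 \<subseteq> {t + 1..<?m}" "b \<approx> b1 @ down ?m j"
      "length (b1 @ down ?m j) \<le> length b"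
    using hecke_coset_form[of b "t + 1" ?m] less.prems by fastforce
  \<comment> \<open>Carrying \<open>b1\<close> around the word reflects its letters from
    \<open>{t + 1..<?m}\<close> into \<open>{t + 2..?m}\<close>, so \<open>b2\<close> no longer
    contains \<open>t + 1\<close>.\<close>
  define b2 where "b2 = map (\<lambda>i. n - i) b1"
  have "t + 2 \<le> n - x \<and> n - x \<le> ?m" if "x \<in> set b1" for x
    using subsetD[OF b1(3) that] by auto
  then have b2: "set b2 \<subseteq> {t + 2..?m}" "length b2 = length b1"
    by (auto simp: b2_def)
  have tb: "twisted_conj n (?P @ b) (?P @ down ?m j @ b2)"
    using twisted_conj.trans[OF twisted_conj.hecke[OF hecke_eq_appendR[OF b1(4)]] rot[OF b1(3)]]
    by (simp add: b2_def)
  show ?case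
  proof (cases "j = t + 1")
    \<comment> \<open>The run reaches \<open>t + 1\<close> and continues the prefix: an odd part
      \<open>2 * t + 1\<close> is complete.\<close>
    case True
    obtain d where d: "b2 = shift (t + 1) d" "\<forall>i\<in>set d. 1 \<le> i" "length d = length b2"
      by (rule shift_unshift[of b2 "t + 1"]) (use b2 in auto)
    have "?P @ down ?m j = down (n - 1) (t + 1)"
    proof (cases "n = 2 * t + 1")
      case False
      then have "t + 1 \<le> ?m" "?m \<le> n - 1" "Suc ?m = n - t"
        using less.prems by auto
      then show ?thesis
        using down_split[of "t + 1" ?m "n - 1"] True by simp
    qed (use True in simp)
    then have "twisted_conj n (?P @ b) (down (n - 1) (t + 1) @ shift (t + 1) d)"
      using tb d by (metis append.assoc)
    moreover have "set d \<subseteq> {1..<n - (2 * t + 1)}"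
      using d(1,2) b2(1) less.prems by force
    moreover have "length (down (n - 1) (t + 1) @ shift (t + 1) d) \<le> t + length b"
      using b1 d b2 True less.prems by auto
    ultimately have "?odd t b"
      using less.prems by blast
    then show ?thesis ..
  next
    case False
    let ?b = "down ?m j @ b2"
    have set: "set ?b \<subseteq> {t + 2..?m}"
      using False b1 b2 by auto
    have len: "length ?b \<le> length b"
      using b1 b2 by simp
    from set show ?thesis
    proof (rule hecke_double_coset_form)
      show "t + 2 \<le> Suc ?m"
        using False b1 by linarith
      \<comment> \<open>Both letters \<open>t + 1\<close> and \<open>?m\<close> have disappeared: an
        even part \<open>2 * (t + 1)\<close> is complete, with \<open>?P\<close> as its whole
        block.\<close>
      fix c
      assume c: "set c \<subseteq> {t + 2..<?m}" "?b \<approx> c" "length c \<le> length ?b"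
      obtain d where d: "c = shift (t + 1) d" "\<forall>i\<in>set d. 1 \<le> i" "length d = length c"
        by (rule shift_unshift[of c "t + 1"]) (use c in auto)
      have "n - (t + 1) + 1 = n - t"
        using less.prems by simp
      moreover have "twisted_conj n (?P @ b) (?P @ shift (t + 1) d)"
        using twisted_conj_hecke_right[OF tb hecke_eq_appendR[OF c(2)]] d by simp
      moreover have "set d \<subseteq> {1..<n - 2 * (t + 1)}"
        using d(1,2) c(1) less.prems by force
      moreover have "2 * (t + 1) \<le> n"
        using \<open>t + 2 \<le> Suc ?m\<close> less.prems(1) by auto
      moreover have "length (?P @ shift (t + 1) d) \<le> t + length b"
        using d(3) c(3) len less.prems by auto
      ultimately have "?even t b"
        by (intro exI[of _ "t + 1"] exI[of _ d]) simp
      then show ?thesis ..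
    next
      \<comment> \<open>The letter \<open>?m\<close> remains exactly once. Rotating \<open>c\<close>
        to the back lets \<open>?m\<close> join the prefix, and the reflected \<open>c\<close>
        avoids both end nodes, so the peeling continues with \<open>t + 1\<close>.\<close>
      fix c d
      assume c: "t + 2 \<le> ?m" "set c \<subseteq> {t + 2..<?m}" "set d \<subseteq> {t + 2..<?m}" "?b \<approx> c @ [?m] @ d"
        "length (c @ [?m] @ d) \<le> length ?b"
      have c': "set c \<subseteq> {t + 1..<?m}"
        using c(2) by (rule subset_trans) auto
      define e where "e = d @ map (\<lambda>i. n - i) c"
      have set_e: "set e \<subseteq> {t + 1 + 1..<n - (t + 1)}"
      proof -
        have "t + 2 \<le> n - x \<and> n - x < n - (t + 1)" if "x \<in> set c" for x
          using subsetD[OF c(2) that] c(1) by auto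
        then show ?thesis
          using c(3) by (auto simp: e_def)
      qed
      have "Suc ?m = n - t" "?m = n - (t + 1)"
        using c(1) by auto
      then have "?P @ [?m] = down (n - 1) (n - (t + 1))"
        using down_snoc[of ?m "n - 1"] by simp
      moreover have "twisted_conj n (?P @ b) (?P @ [?m] @ e)"
        using twisted_conj.trans[OF twisted_conj_hecke_right[OF tb hecke_eq_appendR[OF c(4)]]
            rot[OF c', of "[?m] @ d"]]
        by (simp add: e_def)
      ultimately have *: "twisted_conj n (?P @ b) (down (n - 1) (n - (t + 1)) @ e)"
        by (metis append.assoc)
      have "?even (t + 1) e \<or> ?odd (t + 1) e"
        by (rule less.hyps) (use c(1) set_e in auto)
      moreover have "t + 1 + length e \<le> t + length b"
        using c(5) len by (simp add: e_def)
      ultimately show ?thesis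
        using twisted_conj.trans[OF *] le_trans by meson
    qed auto
  qed
qed

section \<open>Canonical words and the shortening of all others\<close>

fun canonical_word :: "nat list \<Rightarrow> nat list"
where
  "canonical_word [] = []"
| "canonical_word (p # ps) = (let n = sum_list (p # ps) in
    if even p then down (n - 1) (n - p div 2 + 1) @ shift (p div 2) (canonical_word ps)
    else down (n - 1) (p div 2 + 1) @ shift (p div 2 + 1) (canonical_word ps))"

lemma set_canonical_word: "0 \<notin> set ps \<Longrightarrow> set (canonical_word ps) \<subseteq> {1..<sum_list ps}"
proof (induction ps)
  case (Cons p ps)
  show ?case
  proof (cases "even p")
    case True
    then obtain a where "p = 2 * a"
      by blast
    with Cons show ?thesis
      by fastforce
  next
    case False
    then obtain a where "p = 2 * a + 1"
      by (blast elim: oddE)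
    with Cons show ?thesis
      by fastforce
  qed
qed simp

text \<open>
  A letter \<open>i\<close> behind the first block travels through both blocks and around the word twice
  and comes back as \<open>i + 2\<close>, until it extends or is absorbed.
\<close>

lemma twisted_conj_chase:
  assumes "j \<le> c" "1 \<le> j" "2 * c \<le> n + 1" "c < \<kappa>" "\<forall>x\<in>set d. c < x \<and> x < n - c + 1" "\<tau> \<le> n - 1"
    and "even (Suc \<tau> - i)" "\<kappa> \<le> i" "i \<le> Suc \<tau>" "n - c + 1 \<le> i" "n + 1 - j \<le> i" "i \<le> n - 1"
  shows "\<tau> < n - 1 \<and> twisted_conj n (down (n - 1) j @ [i] @ down \<tau> \<kappa> @ d)
      (down (n - 1) j @ down (Suc \<tau>) \<kappa> @ d) \<or>
    twisted_conj n (down (n - 1) j @ [i] @ down \<tau> \<kappa> @ d) (down (n - 1) j @ down \<tau> \<kappa> @ d)"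
  using assms(7-)
proof (induction "Suc \<tau> - i" arbitrary: i rule: less_induct)
  case less
  let ?Q = "down (n - 1) j" and ?E = "down \<tau> \<kappa>"
  have jn: "j \<le> n - 1"
    using assms by linarith
  consider "i = Suc \<tau>" | "i = \<tau>" | "i < \<tau>"
    using less.prems by linarith
  then show ?case
  proof cases
    case 1
    then have "down (Suc \<tau>) \<kappa> = i # ?E"
      using down_Cons[of \<kappa> \<tau>] less.prems by simp
    then show ?thesis
      using 1 less.prems by simp
  next
    \<comment> \<open>Excluded by parity: \<open>Suc \<tau> - i\<close> would be 1.\<close>
    case 2
    then show ?thesis
      using less.prems by simp
  next
    case 3
    let ?k = "n - Suc i"
    have "?Q @ [i] @ ?E @ d \<approx> ?Q @ (?E @ [Suc i]) @ d"
      using hecke_eq_context[OF down_pass_letter[of \<kappa> i \<tau>], of ?Q d] 3 less.prems assms by simp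
    also have "\<dots> \<approx> (?Q @ ?E @ d) @ [Suc i]"
    proof -
      have "far [Suc i] d"
        using assms(5) less.prems by (fastforce simp: far_def)
      from hecke_eq_appendR[OF hecke_eq_letter_commute[OF this], of "?Q @ ?E"] show ?thesis
        by simp
    qed
    also have "twisted_conj n \<dots> (map (\<lambda>i. n - i) [Suc i] @ ?Q @ ?E @ d)"
      by (rule twisted_conj_rotate') (use 3 assms in auto)
    also have "\<dots> \<approx> (?Q @ ?E @ d) @ [?k]"
    proof -
      have "far [?k] (?Q @ ?E @ d)"
        using assms less.prems 3 by (fastforce simp: far_def)
      from hecke_eq_letter_commute[OF this] show ?thesis
        by simp
    qed
    also have "twisted_conj n \<dots> (map (\<lambda>i. n - i) [?k] @ ?Q @ ?E @ d)"
      by (rule twisted_conj_rotate') (use 3 assms in auto)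
    also have "map (\<lambda>i. n - i) [?k] = [Suc i]"
      using 3 assms by simp
    finally have *: "twisted_conj n (?Q @ [i] @ ?E @ d) (Suc i # ?Q @ ?E @ d)"
      by simp
    show ?thesis
    proof (cases "Suc i = n - 1")
      case True
      have "Suc i # ?Q @ ?E @ d \<approx> ?Q @ ?E @ d"
        using hecke_eq_appendL[OF down_absorb_front[OF jn], of "?E @ d"] True by simp
      then show ?thesis
        using twisted_conj_hecke_right[OF *] by blast
    next
      case False
      have "Suc i # ?Q @ ?E @ d \<approx> ?Q @ [Suc (Suc i)] @ ?E @ d"
        using hecke_eq_appendL[OF down_pass_letter[of j "Suc i" "n - 1"], of "?E @ d"]
          False 3 assms less.prems by auto
      then have **: "twisted_conj n (?Q @ [i] @ ?E @ d) (?Q @ [Suc (Suc i)] @ ?E @ d)"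
        using twisted_conj_hecke_right[OF *] by blast
      have "even (Suc \<tau> - Suc (Suc i))"
        using less.prems(1) 3 by (auto simp: Suc_diff_Suc)
      with less.hyps[of "Suc (Suc i)"] 3 less.prems assms False
      have "\<tau> < n - 1 \<and> twisted_conj n (?Q @ [Suc (Suc i)] @ ?E @ d) (?Q @ down (Suc \<tau>) \<kappa> @ d) \<or>
        twisted_conj n (?Q @ [Suc (Suc i)] @ ?E @ d) (?Q @ ?E @ d)"
        by auto
      then show ?thesis
        using twisted_conj.trans[OF **] by blast
    qed
  qed
qed

text \<open>One step takes the lowest letter of the first run to the back and rotates it to the
  front. It then passes the first run and chases the top of the second run, which it extends unless
  it is absorbed. Extension preserves the length and absorption reduces it. Since the top of the
  second run starts at \<open>n - 1 - a\<close>, at most \<open>a\<close> steps can extend it, so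
  \<open>m = Suc a\<close> forces a shorter word.\<close>

lemma twisted_conj_exchange:
  assumes "1 \<le> b" "2 * a + 2 * b + 1 \<le> n" "a + b + 1 < \<kappa>" "\<kappa> \<le> n - (a + b) + 1"
    and d: "\<forall>x\<in>set d. a + b + 1 < x \<and> x < n - (a + b)"
    and "m \<le> b" "m \<le> Suc a"
  shows "(\<exists>w. twisted_conj n (down (n - 1) (a + 1) @ down (n - 1 - a) \<kappa> @ d) w \<and>
      length w < n - 1 - a + length (down (n - 1 - a) \<kappa> @ d)) \<or>
    m \<le> a \<and> twisted_conj n (down (n - 1) (a + 1) @ down (n - 1 - a) \<kappa> @ d)
      (down (n - 1) (a + 1 + m) @ down (n - 1 - a + m) \<kappa> @ d)"
    (is "?short \<or> _")
  using assms(6,7)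
proof (induction m)
  case (Suc m)
  let ?j = "a + 1 + m" and ?\<tau> = "n - 1 - a + m"
  let ?Q = "down (n - 1) (Suc ?j)" and ?E = "down ?\<tau> \<kappa>"
  let ?w = "down (n - 1) (a + 1) @ down (n - 1 - a) \<kappa> @ d"
  show ?case
  proof (cases ?short)
    case False
    with Suc have start: "twisted_conj n ?w (down (n - 1) ?j @ ?E @ d)"
      by auto
    have len: "length (?Q @ ?E @ d) < n - 1 - a + length (down (n - 1 - a) \<kappa> @ d)"
      using assms Suc.prems by auto
    have "far [?j] (?E @ d)"
      using assms Suc.prems by (fastforce simp: far_def)
    from hecke_eq_appendR[OF hecke_eq_letter_commute[OF this], of ?Q]
    have "down (n - 1) ?j @ ?E @ d \<approx> (?Q @ ?E @ d) @ [?j]"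
      using down_snoc[of ?j "n - 1"] assms Suc.prems by simp
    from twisted_conj_hecke_right[OF start this]
    have "twisted_conj n ?w ((?Q @ ?E @ d) @ [?j])" .
    also have "twisted_conj n \<dots> (map (\<lambda>i. n - i) [?j] @ ?Q @ ?E @ d)"
      by (rule twisted_conj_rotate') (use assms Suc.prems in auto)
    finally have *: "twisted_conj n ?w ((n - ?j) # ?Q @ ?E @ d)"
      by simp
    have jn: "Suc ?j \<le> n - 1"
      using assms Suc.prems by linarith
    show ?thesis
    proof (cases "a = 0 \<and> m = 0")
      \<comment> \<open>Here \<open>n - ?j\<close> is \<open>n - 1\<close>, which is already the top
        letter of \<open>?Q\<close>.\<close>
      case True
      then have "(n - ?j) # ?Q @ ?E @ d \<approx> ?Q @ ?E @ d"
        using hecke_eq_appendL[OF down_absorb_front[OF jn], of "?E @ d"] by simp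
      then show ?thesis
        using twisted_conj_hecke_right[OF *] len by blast
    next
      case False
      have "(n - ?j) # ?Q @ ?E @ d \<approx> (?Q @ [Suc (n - ?j)]) @ ?E @ d"
        using hecke_eq_appendL[OF down_pass_letter[of "Suc ?j" "n - ?j" "n - 1"], of "?E @ d"]
          False assms Suc.prems by auto
      with * have **: "twisted_conj n ?w (?Q @ [Suc (n - ?j)] @ ?E @ d)"
        using twisted_conj_hecke_right by fastforce
      have "Suc ?\<tau> - Suc (n - ?j) = 2 * m"
        using assms Suc.prems by auto
      then have ev: "even (Suc ?\<tau> - Suc (n - ?j))"
        by simp
      have "?\<tau> < n - 1 \<and> twisted_conj n (?Q @ [Suc (n - ?j)] @ ?E @ d) (?Q @ down (Suc ?\<tau>) \<kappa> @ d) \<or>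
        twisted_conj n (?Q @ [Suc (n - ?j)] @ ?E @ d) (?Q @ ?E @ d)"
        by (rule twisted_conj_chase[of "Suc ?j" "a + b + 1"])
          (use ev d assms(1-4) Suc.prems False in auto)
      then show ?thesis
      proof
        assume *: "?\<tau> < n - 1 \<and> twisted_conj n (?Q @ [Suc (n - ?j)] @ ?E @ d) (?Q @ down (Suc ?\<tau>) \<kappa> @ d)"
        then have "Suc m \<le> a"
          by linarith
        moreover have "twisted_conj n ?w (down (n - 1) (a + 1 + Suc m) @ down (n - 1 - a + Suc m) \<kappa> @ d)"
          using twisted_conj.trans[OF ** conjunct2[OF *]] by simp
        ultimately show ?thesis
          by blast
      next
        assume "twisted_conj n (?Q @ [Suc (n - ?j)] @ ?E @ d) (?Q @ ?E @ d)"
        then show ?thesis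
          using twisted_conj.trans[OF **] len by blast
      qed
    qed
  qed blast
qed simp

lemma map_Suc_down: "map Suc (down a b) = down (Suc a) (Suc b)"
  using map_add_down[of 1 a b] by simp

text \<open>The second run travels around the word twice; its reflection commutes with everything,
  so it returns unchanged in front of the first run. Passing that run raises it by one. Once its top
  is \<open>n - 1\<close>, this letter is absorbed instead and the word gets shorter.\<close>

lemma twisted_conj_raise:
  assumes "1 \<le> c" "2 * c \<le> n + 1" "c \<le> \<kappa>" "\<kappa> \<le> \<tau>" "\<tau> \<le> n - 1" "n - c + 1 < \<kappa>"
    and d: "\<forall>x\<in>set d. c < x \<and> x < n - c + 1"
  shows "\<exists>w. twisted_conj n (down (n - 1) c @ down \<tau> \<kappa> @ d) w \<and>
    length w < length (down (n - 1) c @ down \<tau> \<kappa> @ d)"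
  using assms(3-6)
proof (induction "n - 1 - \<tau>" arbitrary: \<tau> \<kappa> rule: less_induct)
  case less
  let ?Q = "down (n - 1) c" and ?E = "down \<tau> \<kappa>"
  have E: "set ?E \<subseteq> {1..<n}"
    using less.prems assms by auto
  have "far ?E d"
    using d less.prems by (fastforce simp: far_def)
  from hecke_eq_appendR[OF hecke_eq_commute[OF this], of ?Q]
  have "?Q @ ?E @ d \<approx> (?Q @ d) @ ?E"
    by simp
  also have "twisted_conj n \<dots> (map (\<lambda>i. n - i) ?E @ ?Q @ d)"
    by (rule twisted_conj_rotate'[OF E])
  also have "\<dots> \<approx> (?Q @ d) @ map (\<lambda>i. n - i) ?E"
  proof (rule hecke_eq_commute)
    show "far (map (\<lambda>i. n - i) ?E) (?Q @ d)"
      using d less.prems assms by (fastforce simp: far_def)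
  qed
  also have "twisted_conj n \<dots> (map (\<lambda>i. n - i) (map (\<lambda>i. n - i) ?E) @ ?Q @ d)"
    by (rule twisted_conj_rotate') (use less.prems assms in auto)
  also have "map (\<lambda>i. n - i) (map (\<lambda>i. n - i) ?E) = ?E"
    unfolding map_map by (rule map_idI) (use E in auto)
  finally have *: "twisted_conj n (?Q @ ?E @ d) (?E @ ?Q @ d)" .
  show ?case
  proof (cases "\<tau> = n - 1")
    case True
    let ?F = "down (\<tau> - 1) \<kappa>"
    have EF: "?E = \<tau> # ?F"
      using down_Cons[of \<kappa> "\<tau> - 1"] less.prems assms by auto
    have "?F @ ?Q \<approx> ?Q @ map Suc ?F"
      by (rule down_pass) (use less.prems assms True in auto)
    from hecke_eq_Cons[OF hecke_eq_appendL[OF this, of d], of \<tau>]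
    have "?E @ ?Q @ d \<approx> \<tau> # ?Q @ map Suc ?F @ d"
      by (simp add: EF)
    also have "\<dots> \<approx> ?Q @ map Suc ?F @ d"
      using hecke_eq_appendL[OF down_absorb_front[of c \<tau>], of "map Suc ?F @ d"] True less.prems by simp
    finally have "twisted_conj n (?Q @ ?E @ d) (?Q @ map Suc ?F @ d)"
      by (rule twisted_conj_hecke_right[OF *])
    then show ?thesis
      by (intro exI[of _ "?Q @ map Suc ?F @ d"]) (simp add: EF)
  next
    case False
    have "?E @ ?Q \<approx> ?Q @ map Suc ?E"
      by (rule down_pass) (use less.prems assms False in auto)
    from hecke_eq_appendL[OF this, of d]
    have "twisted_conj n (?Q @ ?E @ d) (?Q @ down (Suc \<tau>) (Suc \<kappa>) @ d)"
      using twisted_conj_hecke_right[OF *] by (simp add: map_Suc_down)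
    moreover have "n - 1 - Suc \<tau> < n - 1 - \<tau>"
      using less.prems False by linarith
    then obtain w where "twisted_conj n (?Q @ down (Suc \<tau>) (Suc \<kappa>) @ d) w"
        "length w < length (?Q @ down (Suc \<tau>) (Suc \<kappa>) @ d)"
      using less.hyps[of "Suc \<tau>" "Suc \<kappa>"] less.prems False by auto
    ultimately show ?thesis
      by (intro exI[of _ w] conjI) (erule (1) twisted_conj.trans, simp)
  qed
qed

text \<open>If \<open>a < b\<close>, then \<open>Suc a\<close> exchanges are allowed and shorten the
  word. If \<open>b \<le> a\<close>, then after \<open>b\<close> exchanges the first run ends at
  \<open>a + b + 1\<close>, just far enough from the reflection of the second run for
  \<open>twisted_conj_raise\<close> to apply.\<close>

lemma twisted_conj_shorten_even:
  assumes "1 \<le> b" "2 * a + 2 * b + 1 \<le> n"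
    and d: "\<forall>x\<in>set d. a + b + 1 < x \<and> x < n - (a + b)"
  shows "\<exists>w. twisted_conj n (down (n - 1) (a + 1) @ down (n - 1 - a) (n - (a + b) + 1) @ d) w \<and>
    length w < length (down (n - 1) (a + 1) @ down (n - 1 - a) (n - (a + b) + 1) @ d)"
proof -
  let ?\<kappa> = "n - (a + b) + 1"
  let ?w = "down (n - 1) (a + 1) @ down (n - 1 - a) ?\<kappa> @ d"
  let ?v = "down (n - 1) (a + b + 1) @ down (n - 1 - a + b) ?\<kappa> @ d"
  have \<kappa>: "a + b + 1 < ?\<kappa>"
    using assms by linarith
  consider w where "twisted_conj n ?w w" "length w < length ?w" | "b \<le> a" "twisted_conj n ?w ?v"
  proof (cases "b \<le> a")
    case True
    then show thesis
      using twisted_conj_exchange[OF assms(1,2) \<kappa> _ d, of b] that by auto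
  next
    case False
    then show thesis
      using twisted_conj_exchange[OF assms(1,2) \<kappa> _ d, of "Suc a"] assms that by auto
  qed
  then show ?thesis
  proof cases
    case 2
    have "\<exists>w. twisted_conj n ?v w \<and> length w < length ?v"
      by (rule twisted_conj_raise) (use assms 2 in auto)
    moreover have "length ?v = length ?w"
      using assms 2 by auto
    ultimately show ?thesis
      using twisted_conj.trans[OF 2(2)] by metis
  qed blast
qed

lemma twisted_conj_shorten_odd:
  assumes "a < b" "2 * a + 2 * b + 2 \<le> n"
    and d: "\<forall>x\<in>set d. a + b + 1 < x \<and> x < n - (a + b)"
  shows "\<exists>w. twisted_conj n (down (n - 1) (a + 1) @ down (n - 1 - a) (a + b + 2) @ d) w \<and>
    length w < length (down (n - 1) (a + 1) @ down (n - 1 - a) (a + b + 2) @ d)"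
  using twisted_conj_exchange[of b a n "a + b + 2" d "Suc a"] assms by auto

text \<open>The hypothesis describes the two ways in which an odd part may violate
  \<open>canonical\<close>: its successor is even or larger.\<close>

lemma canonical_word_shorten:
  assumes "odd p" "even q \<or> p < q" "0 < q" "0 \<notin> set ps"
  shows "\<exists>w. twisted_conj (sum_list (p # q # ps)) (canonical_word (p # q # ps)) w \<and>
    length w < length (canonical_word (p # q # ps))"
proof -
  obtain a where a: "p = 2 * a + 1"
    using assms(1) by (blast elim: oddE)
  define n where "n = sum_list (p # q # ps)"
  have ps: "set (canonical_word ps) \<subseteq> {1..<sum_list ps}"
    by (rule set_canonical_word[OF assms(4)])
  show ?thesis
  proof (cases "even q")
    case True
    then obtain b where b: "q = 2 * b"
      by blast
    define d where "d = shift (a + b + 1) (canonical_word ps)"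
    have "canonical_word (q # ps) = down (q + sum_list ps - 1) (q + sum_list ps - b + 1) @ shift b (canonical_word ps)"
      using b by (simp add: Let_def)
    moreover have "q + sum_list ps - 1 + (a + 1) = n - 1 - a"
      "q + sum_list ps - b + 1 + (a + 1) = n - (a + b) + 1" "b + (a + 1) = a + b + 1"
      using a b assms(3) by (simp_all add: n_def)
    moreover have "canonical_word (p # q # ps) = down (n - 1) (a + 1) @ shift (a + 1) (canonical_word (q # ps))"
      using a by (simp add: n_def Let_def)
    ultimately have "canonical_word (p # q # ps) = down (n - 1) (a + 1) @ down (n - 1 - a) (n - (a + b) + 1) @ d"
      unfolding d_def by (simp only: shift_simps)
    moreover have "\<forall>x\<in>set d. a + b + 1 < x \<and> x < n - (a + b)"
      using ps a b by (force simp: d_def n_def)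
    ultimately show ?thesis
      using twisted_conj_shorten_even[of b a n d] a b assms(3) by (auto simp: n_def)
  next
    case False
    then obtain b where b: "q = 2 * b + 1"
      by (blast elim: oddE)
    define d where "d = shift (a + b + 2) (canonical_word ps)"
    have "canonical_word (q # ps) = down (q + sum_list ps - 1) (b + 1) @ shift (b + 1) (canonical_word ps)"
      using b by (simp add: Let_def)
    moreover have "q + sum_list ps - 1 + (a + 1) = n - 1 - a" "b + 1 + (a + 1) = a + b + 2"
      using a b assms(3) by (simp_all add: n_def)
    moreover have "canonical_word (p # q # ps) = down (n - 1) (a + 1) @ shift (a + 1) (canonical_word (q # ps))"
      using a by (simp add: n_def Let_def)
    ultimately have "canonical_word (p # q # ps) = down (n - 1) (a + 1) @ down (n - 1 - a) (a + b + 2) @ d"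
      unfolding d_def by (simp only: shift_simps)
    moreover have "\<forall>x\<in>set d. a + b + 1 < x \<and> x < n - (a + b)"
      using ps a b by (force simp: d_def n_def)
    ultimately show ?thesis
      using twisted_conj_shorten_odd[of a b n d] a b assms(2,3) False by (auto simp: n_def)
  qed
qed

lemma twisted_conj_set:
  "twisted_conj n v w \<Longrightarrow> set v \<subseteq> {1..<n} \<longleftrightarrow> set w \<subseteq> {1..<n}"
  by (induction rule: twisted_conj.induct) (auto dest: hecke_eq_set)

text \<open>The outer induction on \<open>n\<close> treats the word left after splitting off a part,
  the inner one on the length restarts after a shortening. The length bound in the conclusion
  ensures that reassembling a canonical inner word does not undo the descent.\<close>

theorem twisted_conj_canonical_word:
  assumes "set w \<subseteq> {1..<n}"
  shows "\<exists>ps. canonical ps \<and> sum_list ps = n \<and> twisted_conj n w (canonical_word ps) \<and>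
    length (canonical_word ps) \<le> length w"
  using assms
proof (induction n arbitrary: w rule: less_induct)
  case outer: (less n)
  from outer.prems show ?case
  proof (induction "length w" arbitrary: w rule: less_induct)
    case inner: less
    show ?case
    proof (cases "n = 0")
      case True
      with inner.prems show ?thesis
        by (intro exI[of _ "[]"]) auto
    next
      case False
      with twisted_conj_peel[of 0 n w] inner.prems
      consider (even) a d where "1 \<le> a" "2 * a \<le> n" "set d \<subseteq> {1..<n - 2 * a}"
          "twisted_conj n w (down (n - 1) (n - a + 1) @ shift a d)"
          "length (down (n - 1) (n - a + 1) @ shift a d) \<le> length w"
        | (odd) a d where "2 * a + 1 \<le> n" "set d \<subseteq> {1..<n - (2 * a + 1)}"
          "twisted_conj n w (down (n - 1) (a + 1) @ shift (a + 1) d)"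
          "length (down (n - 1) (a + 1) @ shift (a + 1) d) \<le> length w"
        by (fastforce simp del: One_nat_def)
      then show ?thesis
      proof cases
        case even
        obtain ps where ps: "canonical ps" "sum_list ps = n - 2 * a"
            "twisted_conj (n - 2 * a) d (canonical_word ps)" "length (canonical_word ps) \<le> length d"
          using outer.IH[of "n - 2 * a" d] even by auto
        have nw: "canonical_word (2 * a # ps) = down (n - 1) (n - a + 1) @ shift a (canonical_word ps)"
          using ps(2) even(2) by (simp add: Let_def)
        show ?thesis
          using twisted_conj.trans[OF even(4) twisted_conj_lift_even[OF even(1,2) ps(3)]] ps even
          by (intro exI[of _ "2 * a # ps"]) (auto simp: nw simp del: canonical_word.simps)
      next
        case odd
        let ?p = "2 * a + 1"
        obtain ps where ps: "canonical ps" "sum_list ps = n - ?p"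
            "twisted_conj (n - ?p) d (canonical_word ps)" "length (canonical_word ps) \<le> length d"
          using outer.IH[of "n - ?p" d] odd by auto
        have nw: "canonical_word (?p # ps) = down (n - 1) (a + 1) @ shift (a + 1) (canonical_word ps)"
          using ps(2) odd(1) by (simp add: Let_def)
        have sum: "sum_list (?p # ps) = n"
          using ps(2) odd(1) by simp
        have tw: "twisted_conj n w (canonical_word (?p # ps))"
          unfolding nw by (rule twisted_conj.trans[OF odd(3) twisted_conj_lift_odd[OF odd(1) ps(3)]])
        have len: "length (canonical_word (?p # ps)) \<le> length w"
          unfolding nw using odd ps by simp
        show ?thesis
        proof (cases "canonical (?p # ps)")
          case True
          then show ?thesis
            using tw sum len by blast
        next
          case False
          \<comment> \<open>Since \<open>ps\<close> is canonical, an odd first entry bounds all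
            others, so a failure at \<open>?p\<close> already shows at the first entry.\<close>
          then obtain q qs where q: "ps = q # qs" "even q \<or> ?p < q"
            using ps(1) by (cases ps) fastforce+
          have "\<exists>v. twisted_conj (sum_list (?p # q # qs)) (canonical_word (?p # q # qs)) v \<and>
              length v < length (canonical_word (?p # q # qs))"
            using q ps(1) canonical_zero by (intro canonical_word_shorten) auto
          then obtain v where v: "twisted_conj n (canonical_word (?p # ps)) v"
              "length v < length (canonical_word (?p # ps))"
            unfolding q(1)[symmetric] sum by blast
          have wv: "twisted_conj n w v"
            by (rule twisted_conj.trans[OF tw v(1)])
          then obtain ps' where "canonical ps'" "sum_list ps' = n" "twisted_conj n v (canonical_word ps')"
              "length (canonical_word ps') \<le> length v"
            using inner.hyps[of v] v(2) len twisted_conj_set[OF wv] inner.prems by auto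
          then show ?thesis
            using twisted_conj.trans[OF wv] v(2) len by (intro exI[of _ ps']) auto
        qed
      qed
    qed
  qed
qed

section \<open>Cyclic sums\<close>

definition cyclic_sum :: "('a \<Rightarrow> 'a \<Rightarrow> nat) \<Rightarrow> 'a list \<Rightarrow> nat"
  where "cyclic_sum f xs = (\<Sum>(x, y) \<leftarrow> zip xs (rotate1 xs). f x y)"

fun path_sum :: "('a \<Rightarrow> 'a \<Rightarrow> nat) \<Rightarrow> 'a list \<Rightarrow> nat"
where
  "path_sum f (x # y # zs) = f x y + path_sum f (y # zs)"
| "path_sum f _ = 0"

lemma cyclic_sum_nth: "cyclic_sum f xs = (\<Sum>t<length xs. f (xs ! t) (xs ! (Suc t mod length xs)))"
  by (simp add: cyclic_sum_def sum_list_sum_nth atLeast0LessThan nth_rotate1)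

lemma bij_betw_add_mod:
  assumes "0 < m"
  shows "bij_betw (\<lambda>c. (t + c) mod m) {..<m} {..<m :: nat}"
proof -
  have le: "c = d" if "c \<le> d" "d < m" "(t + c) mod m = (t + d) mod m" for c d
  proof -
    have "m dvd (t + d) - (t + c)"
      using that by (subst mod_eq_dvd_iff_nat[symmetric]) auto
    then have "m dvd d - c"
      by simp
    then show ?thesis
      using that by (auto dest: dvd_imp_le)
  qed
  have "inj_on (\<lambda>c. (t + c) mod m) {..<m}"
  proof (rule inj_onI)
    fix c d
    assume "c \<in> {..<m}" "d \<in> {..<m}" "(t + c) mod m = (t + d) mod m"
    then show "c = d"
      using le[of c d] le[of d c] by (cases c d rule: le_cases) auto
  qed
  moreover have "(\<lambda>c. (t + c) mod m) ` {..<m} \<subseteq> {..<m}"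
    using assms by auto
  ultimately show ?thesis
    by (simp add: bij_betw_def endo_inj_surj)
qed

lemma cyclic_sum_Nil [simp]: "cyclic_sum f [] = 0"
  by (simp add: cyclic_sum_def)

lemma path_sum_append: "path_sum f (xs @ y # zs) = path_sum f (xs @ [y]) + path_sum f (y # zs)"
proof (induction xs)
  case (Cons x xs)
  then show ?case
    by (cases xs) auto
qed simp

lemma cyclic_sum_Cons: "cyclic_sum f (x # xs) = path_sum f (x # xs @ [x])"
proof -
  have "(\<Sum>(x, y) \<leftarrow> zip (x # xs) (xs @ [z]). f x y) = path_sum f (x # xs @ [z])" for z
    by (induction xs arbitrary: x) auto
  then show ?thesis
    by (simp add: cyclic_sum_def)
qed

lemma cyclic_sum_split: "xs \<noteq> [] \<Longrightarrow> cyclic_sum f xs = path_sum f xs + f (last xs) (hd xs)"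
proof (cases xs)
  case (Cons x ys)
  have "path_sum f (zs @ [x]) = path_sum f zs + f (last zs) x" if "zs \<noteq> []" for zs
    using that by (induction f zs rule: path_sum.induct) auto
  from this[of xs] show ?thesis
    using Cons by (simp add: cyclic_sum_Cons)
qed simp

lemma cyclic_sum_append: "cyclic_sum f (xs @ ys) = cyclic_sum f (ys @ xs)"
proof (cases "xs = [] \<or> ys = []")
  case False
  then obtain x xs' y ys' where "xs = x # xs'" "ys = y # ys'"
    by (meson list.exhaust)
  then show ?thesis
    using path_sum_append[of f "x # xs'" y "ys' @ [x]"] path_sum_append[of f "y # ys'" x "xs' @ [y]"]
    by (simp add: cyclic_sum_Cons)
qed auto

lemma cyclic_sum_add: "cyclic_sum (\<lambda>x y. f x y + g x y) xs = cyclic_sum f xs + cyclic_sum g xs"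
  by (simp add: cyclic_sum_nth sum.distrib)

lemma cyclic_sum_mono:
  "(\<And>x y. x \<in> set xs \<Longrightarrow> y \<in> set xs \<Longrightarrow> f x y \<le> g x y) \<Longrightarrow> cyclic_sum f xs \<le> cyclic_sum g xs"
  unfolding cyclic_sum_nth by (intro sum_mono) (auto simp: mod_less_divisor[OF length_pos_if_in_set[OF nth_mem]])

lemma cyclic_sum_cong:
  "(\<And>x y. x \<in> set xs \<Longrightarrow> y \<in> set xs \<Longrightarrow> f x y = g x y) \<Longrightarrow> cyclic_sum f xs = cyclic_sum g xs"
  by (intro antisym cyclic_sum_mono) auto

lemma cyclic_sum_fst: "cyclic_sum (\<lambda>x _. f x) xs = (\<Sum>x\<leftarrow>xs. f x)"
  by (simp add: cyclic_sum_nth sum_list_sum_nth atLeast0LessThan)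

lemma cyclic_sum_snd: "cyclic_sum (\<lambda>_ x. f x) xs = (\<Sum>x\<leftarrow>xs. f x)"
  using sum.reindex_bij_betw[OF bij_betw_add_mod[of "length xs" 1], of "\<lambda>t. f (xs ! t)"]
  by (cases "xs = []") (auto simp: cyclic_sum_nth sum_list_sum_nth atLeast0LessThan)

lemma cyclic_sum_const: "cyclic_sum (\<lambda>_ _. c) xs = length xs * c"
  by (simp add: cyclic_sum_nth)

lemma cyclic_sum_swap:
  "cyclic_sum (\<lambda>x y. cyclic_sum (\<lambda>i j. f x y i j) is) xs =
   cyclic_sum (\<lambda>i j. cyclic_sum (\<lambda>x y. f x y i j) xs) is"
  unfolding cyclic_sum_nth by (rule sum.swap)

text \<open>With \<open>(\<le>)\<close> for \<open>A\<close>, this is the contribution of a cycle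
  \<open>xs\<close> of a permutation to the cyclic sum of its rank matrix along \<open>is\<close>.
  Writing it over the product of two cyclic sequences makes it symmetric in them.\<close>

definition crossings :: "('a \<Rightarrow> 'b \<Rightarrow> bool) \<Rightarrow> 'a list \<Rightarrow> 'b list \<Rightarrow> nat"
  where "crossings A xs is = cyclic_sum (\<lambda>x y. cyclic_sum (\<lambda>i j. of_bool (A x i \<and> \<not> A y j)) is) xs"

lemma crossings_swap: "crossings A xs is = crossings (\<lambda>i x. A x i) is xs"
  unfolding crossings_def by (rule cyclic_sum_swap)

text \<open>Descents and ascents of a cyclic sequence are equinumerous.\<close>

lemma crossings_le: "2 * crossings A xs is \<le> length xs * length is"
proof -
  let ?c = "\<lambda>f. cyclic_sum (\<lambda>x y. cyclic_sum (\<lambda>i j. f x y i j :: nat) is) xs"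
  have "?c (\<lambda>x y i j. of_bool (A x i \<and> \<not> A y j) + of_bool (A y j)) =
      ?c (\<lambda>x y i j. of_bool (\<not> A x i \<and> A y j) + of_bool (A x i))"
    by (intro arg_cong[of _ _ "\<lambda>f. cyclic_sum f xs"] ext arg_cong[of _ _ "\<lambda>f. cyclic_sum f is"]) auto
  moreover have "?c (\<lambda>x y i j. of_bool (A y j)) = ?c (\<lambda>x y i j. of_bool (A x i))"
    by (simp add: cyclic_sum_fst cyclic_sum_snd)
  ultimately have "?c (\<lambda>x y i j. of_bool (\<not> A x i \<and> A y j)) = crossings A xs is"
    by (simp add: cyclic_sum_add crossings_def)
  then have "2 * crossings A xs is =
      ?c (\<lambda>x y i j. of_bool (A x i \<and> \<not> A y j) + of_bool (\<not> A x i \<and> A y j))"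
    by (simp add: cyclic_sum_add crossings_def)
  also have "\<dots> \<le> ?c (\<lambda>x y i j. 1)"
    by (intro cyclic_sum_mono) auto
  finally show ?thesis
    by (simp add: cyclic_sum_const)
qed

text \<open>The case of a single threshold in \<open>crossings_le\<close>, where an odd length rules
  out equality.\<close>

lemma odd_cycle_descents:
  assumes "odd (length bs)"
  shows "2 * cyclic_sum (\<lambda>b c. of_bool (b \<and> \<not> c)) bs + 1 \<le> length bs"
proof -
  have "2 * crossings (\<lambda>b (_ :: unit). b) bs [()] \<le> length bs * length [()]"
    by (rule crossings_le)
  then have "2 * cyclic_sum (\<lambda>b c. of_bool (b \<and> \<not> c)) bs \<le> length bs"
    by (simp add: crossings_def cyclic_sum_Cons)
  moreover have "2 * cyclic_sum (\<lambda>b c. of_bool (b \<and> \<not> c)) bs \<noteq> length bs"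
    using assms by (metis dvd_triv_left)
  ultimately show ?thesis
    by linarith
qed

text \<open>The torus of pairs splits into \<open>length xs\<close> diagonals, on each of which both
  sequences advance together. Each diagonal carries a cyclic Boolean sequence of odd length and
  loses at least one by \<open>odd_cycle_descents\<close>.\<close>

lemma crossings_diagonal:
  assumes "length xs = length is" "odd (length xs)"
  shows "2 * crossings A xs is + length xs \<le> length xs * length xs"
proof -
  let ?m = "length xs"
  have m: "0 < ?m"
    using assms(2) by (cases xs) auto
  define B where "B c = map (\<lambda>t. A (xs ! t) (is ! ((t + c) mod ?m))) [0..<?m]" for c
  have B: "cyclic_sum (\<lambda>b c. of_bool (b \<and> \<not> c)) (B c) =
    (\<Sum>t<?m. of_bool (A (xs ! t) (is ! ((t + c) mod ?m)) \<and>
        \<not> A (xs ! (Suc t mod ?m)) (is ! (Suc (t + c) mod ?m))))" for c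
    unfolding cyclic_sum_nth using m
    by (intro sum.cong) (auto simp: B_def mod_simps)
  have "crossings A xs is = (\<Sum>t<?m. \<Sum>j<?m. of_bool (A (xs ! t) (is ! j) \<and>
        \<not> A (xs ! (Suc t mod ?m)) (is ! (Suc j mod ?m))))"
    unfolding crossings_def cyclic_sum_nth assms(1)[symmetric] ..
  also have "\<dots> = (\<Sum>t<?m. \<Sum>c<?m. of_bool (A (xs ! t) (is ! ((t + c) mod ?m)) \<and>
        \<not> A (xs ! (Suc t mod ?m)) (is ! (Suc (t + c) mod ?m))))"
  proof (rule sum.cong[OF HOL.refl])
    fix t
    show "(\<Sum>j<?m. of_bool (A (xs ! t) (is ! j) \<and> \<not> A (xs ! (Suc t mod ?m)) (is ! (Suc j mod ?m)))) =
      (\<Sum>c<?m. of_bool (A (xs ! t) (is ! ((t + c) mod ?m)) \<and>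
        \<not> A (xs ! (Suc t mod ?m)) (is ! (Suc (t + c) mod ?m))) :: nat)"
      using sum.reindex_bij_betw[OF bij_betw_add_mod[OF m, of t],
          of "\<lambda>j. of_bool (A (xs ! t) (is ! j) \<and> \<not> A (xs ! (Suc t mod ?m)) (is ! (Suc j mod ?m)))"]
      unfolding mod_Suc_eq by (rule HOL.sym)
  qed
  also have "\<dots> = (\<Sum>c<?m. cyclic_sum (\<lambda>b c. of_bool (b \<and> \<not> c)) (B c))"
    unfolding B by (rule sum.swap)
  finally have "2 * crossings A xs is + ?m = (\<Sum>c<?m. 2 * cyclic_sum (\<lambda>b c. of_bool (b \<and> \<not> c)) (B c) + 1)"
    by (simp only: sum.distrib sum_distrib_left[symmetric]) simp
  also have "\<dots> \<le> (\<Sum>c<?m. ?m)"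
  proof (rule sum_mono)
    fix c
    show "2 * cyclic_sum (\<lambda>b c. of_bool (b \<and> \<not> c)) (B c) + 1 \<le> ?m"
      using odd_cycle_descents[of "B c"] assms(2) by (simp add: B_def)
  qed
  finally show ?thesis
    by simp
qed

text \<open>A Ferrers relation: the sets of all \<open>i\<close> with \<open>A x i\<close> form a
  chain under inclusion. The condition is symmetric in the two arguments of
  \<open>A\<close>.\<close>

definition nested :: "('a \<Rightarrow> 'b \<Rightarrow> bool) \<Rightarrow> bool"
  where "nested A \<longleftrightarrow> (\<forall>x y i j. A x i \<and> A y j \<longrightarrow> A x j \<or> A y i)"

text \<open>The two removed entries account for exactly the deficit-free maximum, half of the 2 *
  \<open>length is\<close> pairs, provided that the chain of sets is suitably ordered around the
  cut.\<close>

lemma crossings_remove_two: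
  assumes "xs \<noteq> []"
    and "(\<forall>i\<in>set is. A y i \<longrightarrow> A (hd xs) i) \<and> (\<forall>i\<in>set is. A (last xs) i \<longrightarrow> A z i) \<or>
      (\<forall>i\<in>set is. A (hd xs) i \<longrightarrow> A y i) \<and> (\<forall>i\<in>set is. A z i \<longrightarrow> A (last xs) i)"
  shows "crossings A (y # z # xs) is \<le> crossings A xs is + length is"
proof -
  let ?g = "\<lambda>x y. cyclic_sum (\<lambda>i j. of_bool (A x i \<and> \<not> A y j)) is"
  let ?x = "last xs" and ?w = "hd xs"
  \<comment> \<open>The summands \<open>A z j\<close> and \<open>A z i\<close> have the same cyclic
    sum; with them the estimate holds for each pair \<open>i\<close>, \<open>j\<close>
    separately.\<close>
  have "cyclic_sum (\<lambda>i j. ((of_bool (A ?x i \<and> \<not> A y j) + of_bool (A y i \<and> \<not> A z j)) +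
        of_bool (A z i \<and> \<not> A ?w j)) + of_bool (A z j)) is \<le>
      cyclic_sum (\<lambda>i j. (of_bool (A ?x i \<and> \<not> A ?w j) + 1) + of_bool (A z i)) is"
    by (rule cyclic_sum_mono) (use assms(2) in auto)
  then have "?g ?x y + ?g y z + ?g z ?w \<le> ?g ?x ?w + length is"
    unfolding cyclic_sum_add cyclic_sum_const by (simp add: cyclic_sum_fst cyclic_sum_snd)
  moreover have "crossings A (y # z # xs) is = ?g y z + ?g z ?w + path_sum ?g xs + ?g ?x y"
    using assms(1) by (cases xs) (auto simp: crossings_def cyclic_sum_split)
  moreover have "crossings A xs is = path_sum ?g xs + ?g ?x ?w"
    using assms(1) by (simp add: crossings_def cyclic_sum_split)
  ultimately show ?thesis
    by linarith
qed

lemma nested_length_filter: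
  assumes "nested A" "length (filter (A x) is) \<le> length (filter (A y) is)"
  shows "\<forall>i\<in>set is. A x i \<longrightarrow> A y i"
proof (rule ccontr)
  assume "\<not> ?thesis"
  then obtain i where i: "i \<in> set is" "A x i" "\<not> A y i"
    by blast
  then have "A y j \<longrightarrow> A x j" for j
    using assms(1) by (auto simp: nested_def)
  with i have "length (filter (A y) is) < length (filter (A x) is)"
  proof (induction "is")
    case (Cons k ks)
    have "length (filter (A y) ks) \<le> length (filter (A x) ks)"
      using Cons.prems(4) by (induction ks) auto
    with Cons show ?case
      by auto
  qed simp
  with assms(2) show False
    by simp
qed

text \<open>Both lengths are odd, so removing entries in pairs ends at the diagonal case. Take
  \<open>x\<close> with the smallest set and let \<open>z\<close> follow it. If the entry before
  \<open>x\<close> has a set inside that of \<open>z\<close>, then \<open>x\<close> and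
  \<open>z\<close> can be removed, otherwise \<open>x\<close> and the entry before it. Minimality of
  \<open>x\<close> supplies the other inclusion.\<close>

lemma crossings_odd_aux:
  assumes "nested A" "odd (length is)" "odd (length xs)" "length is \<le> length xs"
  shows "2 * crossings A xs is + length is \<le> length xs * length is"
  using assms(3,4)
proof (induction "length xs" arbitrary: xs rule: less_induct)
  case less
  show ?case
  proof (cases "length is = length xs")
    case True
    then show ?thesis
      using crossings_diagonal[of xs "is" A] less.prems by simp
  next
    case False
    with less.prems assms(2) have len: "length is + 2 \<le> length xs" "3 \<le> length xs"
      by presburger+
    define \<rho> where "\<rho> x = length (filter (A x) is)" for x
    note sub = nested_length_filter[OF assms(1), of _ "is", folded \<rho>_def]
    have "\<exists>x. x \<in> set xs"
      using len by (cases xs) auto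
    then obtain x where x: "x \<in> set xs" "\<forall>y. y \<in> set xs \<longrightarrow> \<rho> x \<le> \<rho> y"
      using ex_has_least_nat[of "\<lambda>x. x \<in> set xs" _ \<rho>] by blast
    then obtain us vs where xs: "xs = us @ x # vs"
      by (meson split_list)
    have rot: "crossings A xs is = crossings A (x # vs @ us) is"
      using cyclic_sum_append[of _ us "x # vs"] by (simp add: xs crossings_def)
    obtain z ws where zw: "vs @ us = z # ws"
      using len xs by (cases "vs @ us") auto
    then have "ws \<noteq> []" "length xs = Suc (Suc (length ws))"
      using len xs by (auto dest!: arg_cong[of _ _ length])
    have mem: "y \<in> set xs \<longleftrightarrow> y = x \<or> y = z \<or> y \<in> set ws" for y
      using xs arg_cong[OF zw, of set] by auto
    have "\<exists>ws'. crossings A xs is \<le> crossings A ws' is + length is \<and> length xs = length ws' + 2"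
    proof (cases "\<rho> (last ws) \<le> \<rho> z")
      case True
      have "crossings A (x # z # ws) is \<le> crossings A ws is + length is"
      proof (rule crossings_remove_two)
        have "\<rho> x \<le> \<rho> (hd ws)"
          using x(2) mem \<open>ws \<noteq> []\<close> by simp
        then show "(\<forall>i\<in>set is. A x i \<longrightarrow> A (hd ws) i) \<and> (\<forall>i\<in>set is. A (last ws) i \<longrightarrow> A z i) \<or>
          (\<forall>i\<in>set is. A (hd ws) i \<longrightarrow> A x i) \<and> (\<forall>i\<in>set is. A z i \<longrightarrow> A (last ws) i)"
          using sub True by blast
      qed fact
      then show ?thesis
        using \<open>length xs = _\<close> by (intro exI[of _ ws]) (simp add: rot zw)
    next
      case False
      define y where "y = last ws"
      obtain ts where ts: "ws = ts @ [y]"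
        using \<open>ws \<noteq> []\<close> by (auto simp: y_def intro: append_butlast_last_id[symmetric])
      have "crossings A xs is = crossings A (y # x # z # ts) is"
        unfolding rot zw ts using cyclic_sum_append[of _ "x # z # ts" "[y]"]
        by (simp add: crossings_def)
      also have "\<dots> \<le> crossings A (z # ts) is + length is"
      proof (rule crossings_remove_two)
        have "last (z # ts) \<in> set (z # ts)"
          by (rule last_in_set) simp
        then have "last (z # ts) \<in> set xs"
          unfolding mem[of "last (z # ts)"] ts by force
        then have "\<rho> x \<le> \<rho> (last (z # ts))"
          using x(2) by blast
        moreover have "\<rho> z \<le> \<rho> y"
          using False by (simp add: y_def)
        ultimately show "(\<forall>i\<in>set is. A y i \<longrightarrow> A (hd (z # ts)) i) \<and> (\<forall>i\<in>set is. A (last (z # ts)) i \<longrightarrow> A x i) \<or>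
          (\<forall>i\<in>set is. A (hd (z # ts)) i \<longrightarrow> A y i) \<and> (\<forall>i\<in>set is. A x i \<longrightarrow> A (last (z # ts)) i)"
          using sub by (metis list.sel(1))
      qed simp
      finally show ?thesis
        using \<open>length xs = _\<close> by (intro exI[of _ "z # ts"]) (simp add: ts)
    qed
    then obtain ws' where ws': "crossings A xs is \<le> crossings A ws' is + length is"
        "length xs = length ws' + 2"
      by blast
    have "2 * crossings A ws' is + length is \<le> length ws' * length is"
      by (rule less.hyps) (use ws'(2) less.prems len in auto)
    then show ?thesis
      using ws' by (simp add: algebra_simps)
  qed
qed

theorem crossings_odd:
  assumes "nested A" "odd (length is)" "odd (length xs)"
  shows "2 * crossings A xs is + min (length xs) (length is) \<le> length xs * length is"
proof (cases "length is \<le> length xs")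
  case True
  then show ?thesis
    using crossings_odd_aux[OF assms] by simp
next
  case False
  have "nested (\<lambda>i x. A x i)"
    using assms(1) by (auto simp: nested_def)
  from crossings_odd_aux[OF this assms(3,2)] show ?thesis
    using False by (simp add: crossings_swap[of A] mult.commute)
qed

section \<open>Sorting equivalence of permutations\<close>

definition sort_right :: "nat \<Rightarrow> (nat \<Rightarrow> nat) \<Rightarrow> nat \<Rightarrow> nat"
  where "sort_right i y = (if y (Suc i) < y i then y \<circ> transpose i (Suc i) else y)"

definition sort_left :: "nat \<Rightarrow> (nat \<Rightarrow> nat) \<Rightarrow> nat \<Rightarrow> nat"
  where "sort_left i y = (if inv y (Suc i) < inv y i then transpose i (Suc i) \<circ> y else y)"

inductive sort_equiv :: "nat \<Rightarrow> (nat \<Rightarrow> nat) \<Rightarrow> (nat \<Rightarrow> nat) \<Rightarrow> bool"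
  for n :: nat
where
  sort: "y permutes {1..n} \<Longrightarrow> i \<in> {1..<n} \<Longrightarrow> sort_equiv n (sort_left i y) (sort_right i y)"
| refl: "y permutes {1..n} \<Longrightarrow> sort_equiv n y y"
| sym: "sort_equiv n x y \<Longrightarrow> sort_equiv n y x"
| trans: "sort_equiv n x y \<Longrightarrow> sort_equiv n y z \<Longrightarrow> sort_equiv n x z"

lemma transpose_permutes: "i \<in> {1..<n} \<Longrightarrow> transpose i (Suc i) permutes {1..n}"
  by (rule permutes_swap_id) auto

lemma sort_right_permutes: "y permutes {1..n} \<Longrightarrow> i \<in> {1..<n} \<Longrightarrow> sort_right i y permutes {1..n}"
  by (simp add: sort_right_def permutes_compose transpose_permutes del: One_nat_def atLeastLessThan_iff)

lemma sort_left_permutes: "y permutes {1..n} \<Longrightarrow> i \<in> {1..<n} \<Longrightarrow> sort_left i y permutes {1..n}"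
  by (simp add: sort_left_def permutes_compose transpose_permutes del: One_nat_def atLeastLessThan_iff)

lemma sort_equiv_permutes: "sort_equiv n x y \<Longrightarrow> x permutes {1..n} \<and> y permutes {1..n}"
  by (induction rule: sort_equiv.induct) (auto simp only: sort_right_permutes sort_left_permutes)

lemma sort_equiv_invariant:
  assumes "sort_equiv n x y"
    and "\<And>y i. y permutes {1..n} \<Longrightarrow> i \<in> {1..<n} \<Longrightarrow> f (sort_left i y) = f (sort_right i y)"
  shows "f x = f y"
  using assms(1) by (induction rule: sort_equiv.induct) (auto simp: assms(2))

lemma inv_transpose_comp:
  assumes "y permutes S"
  shows "inv (transpose i j \<circ> y) = inv y \<circ> transpose i j"
  using assms by (simp add: o_inv_distrib permutes_bij)

lemma inv_comp_transpose:
  assumes "y permutes S"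
  shows "inv (y \<circ> transpose i j) = transpose i j \<circ> inv y"
  using assms by (simp add: o_inv_distrib permutes_bij)

lemma transpose_adjacent_less:
  "a < b \<Longrightarrow> \<not> (a = i \<and> b = Suc i) \<Longrightarrow> transpose i (Suc i) a < transpose i (Suc i) b"
  by (auto simp: transpose_def)

text \<open>Up to inversion, every generator reduces to multiplying on one side a \<open>z\<close>
  that ascends at \<open>i\<close> on both sides. The excluded \<open>z\<close> fixes
  \<open>i\<close> and \<open>Suc i\<close>, so that left and right multiplication coincide.\<close>

lemma sort_equiv_invariant':
  assumes xy: "sort_equiv n x y"
    and inv: "\<And>z. z permutes {1..n} \<Longrightarrow> f (inv z) = f z"
    and swap: "\<And>z i. z permutes {1..n} \<Longrightarrow> i \<in> {1..<n} \<Longrightarrow> z i < z (Suc i) \<Longrightarrow> inv z i < inv z (Suc i) \<Longrightarrow>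
      \<not> (z i = i \<and> z (Suc i) = Suc i) \<Longrightarrow> f (transpose i (Suc i) \<circ> z) = f z"
  shows "f x = f y"
  using xy
proof (rule sort_equiv_invariant)
  fix y :: "nat \<Rightarrow> nat" and i
  assume y: "y permutes {1..n}" and i: "i \<in> {1..<n}"
  let ?t = "transpose i (Suc i)"
  note perm = permutes_compose[OF transpose_permutes[OF i]] permutes_compose[OF _ transpose_permutes[OF i]]
  have invy: "inv y permutes {1..n}"
    by (rule permutes_inv[OF y])
  have eq: "inv y a = b \<longleftrightarrow> y b = a" for a b
    using permutes_inv_eq[OF y] .
  have both: "f (?t \<circ> z) = f z \<and> f (z \<circ> ?t) = f z"
    if z: "z permutes {1..n}" "z i < z (Suc i)" "inv z i < inv z (Suc i)" "\<not> (z i = i \<and> z (Suc i) = Suc i)" for z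
  proof
    show "f (?t \<circ> z) = f z"
      by (rule swap) (use that i in auto)
    have "\<not> (inv z i = i \<and> inv z (Suc i) = Suc i)"
      using z(4) permutes_inv_eq[OF z(1)] by auto
    then have "f (?t \<circ> inv z) = f (inv z)"
      using swap[of "inv z" i] z permutes_inv[OF z(1)] i permutes_inv_inv[OF z(1)] by simp
    moreover have "?t \<circ> inv z = inv (z \<circ> ?t)"
      using inv_comp_transpose[OF z(1)] by simp
    ultimately show "f (z \<circ> ?t) = f z"
      using inv z(1) perm by simp
  qed
  consider "inv y i \<le> inv y (Suc i)" "y i \<le> y (Suc i)" | "inv y (Suc i) < inv y i" "y i \<le> y (Suc i)"
    | "inv y i \<le> inv y (Suc i)" "y (Suc i) < y i" | "inv y (Suc i) < inv y i" "y (Suc i) < y i"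
    by linarith
  then show "f (sort_left i y) = f (sort_right i y)"
  proof cases
    case 1
    then show ?thesis
      by (simp add: sort_left_def sort_right_def)
  next
    case 2
    let ?z = "?t \<circ> y"
    have "y i \<noteq> y (Suc i)"
      using permutes_inj[OF y] by (metis injD n_not_Suc_n)
    with 2 have lt: "y i < y (Suc i)"
      by simp
    have "\<not> (y i = i \<and> y (Suc i) = Suc i)"
      using 2(1) eq by (metis Suc_n_not_le_n less_or_eq_imp_le)
    then have "?z i < ?z (Suc i)"
      using transpose_adjacent_less[OF lt, of i] by simp
    moreover have "inv ?z i < inv ?z (Suc i)"
      using 2(1) by (simp add: inv_transpose_comp[OF y])
    moreover have "\<not> (?z i = i \<and> ?z (Suc i) = Suc i)"
      using lt by (auto simp: transpose_def split: if_splits)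
    ultimately have "f (?t \<circ> ?z) = f ?z"
      using both[of ?z] perm(2)[OF y] by blast
    then show ?thesis
      using 2 by (simp add: sort_left_def sort_right_def comp_assoc[symmetric])
  next
    case 3
    let ?z = "y \<circ> ?t"
    have "inv y i \<noteq> inv y (Suc i)"
      using permutes_inj[OF invy] by (metis injD n_not_Suc_n)
    with 3 have lt: "inv y i < inv y (Suc i)"
      by simp
    have "\<not> (inv y i = i \<and> inv y (Suc i) = Suc i)"
      using 3(2) unfolding eq by auto
    then have "inv ?z i < inv ?z (Suc i)"
      using transpose_adjacent_less[OF lt, of i] by (simp add: inv_comp_transpose[OF y])
    moreover have "?z i < ?z (Suc i)"
      using 3(2) by simp
    moreover have "\<not> (?z i = i \<and> ?z (Suc i) = Suc i)"
      using lt eq[of i "Suc i"] eq[of "Suc i" i] by auto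
    ultimately have "f (?z \<circ> ?t) = f ?z"
      using both[of ?z] perm(1)[OF y] by blast
    then show ?thesis
      using 3 by (simp add: sort_left_def sort_right_def comp_assoc)
  next
    case 4
    \<comment> \<open>Both sorted forms are obtained from \<open>?z\<close> by one multiplication,
      hence \<open>f\<close> agrees on them through \<open>f ?z\<close>. If \<open>y\<close>
      exchanges \<open>i\<close> and \<open>Suc i\<close>, they are equal outright.\<close>
    let ?z = "?t \<circ> y \<circ> ?t"
    have z: "?z permutes {1..n}" "?t \<circ> ?z = y \<circ> ?t" "?z \<circ> ?t = ?t \<circ> y"
      using perm y by (auto simp: fun_eq_iff)
    show ?thesis
    proof (cases "y (Suc i) = i \<and> y i = Suc i")
      case True
      have "?t \<circ> y = y \<circ> ?t"
      proof
        fix x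
        have "y x = i \<longleftrightarrow> x = Suc i" "y x = Suc i \<longleftrightarrow> x = i"
          using True permutes_inj[OF y] by (metis injD)+
        then show "(?t \<circ> y) x = (y \<circ> ?t) x"
          using True by (auto simp: transpose_def)
      qed
      then show ?thesis
        using 4 by (simp add: sort_left_def sort_right_def)
    next
      case False
      then have "?z i < ?z (Suc i)"
        using transpose_adjacent_less[OF 4(2), of i] by simp
      moreover have "\<not> (inv y (Suc i) = i \<and> inv y i = Suc i)"
        using False eq by auto
      then have "inv ?z i < inv ?z (Suc i)"
        using transpose_adjacent_less[OF 4(1), of i]
        by (simp add: inv_transpose_comp[OF y] inv_comp_transpose[OF perm(2)[OF y]])
      moreover have "\<not> (?z i = i \<and> ?z (Suc i) = Suc i)"
        using 4(2) by (auto simp: transpose_def split: if_splits)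
      ultimately have "f (?t \<circ> ?z) = f ?z \<and> f (?z \<circ> ?t) = f ?z"
        using both[OF z(1)] by blast
      then have "f (?t \<circ> y) = f (y \<circ> ?t)"
        unfolding z(2,3) by simp
      then show ?thesis
        using 4 by (simp add: sort_left_def sort_right_def)
    qed
  qed
qed

section \<open>Rank matrices and their max-plus traces\<close>

definition rank :: "nat \<Rightarrow> (nat \<Rightarrow> nat) \<Rightarrow> nat \<Rightarrow> nat \<Rightarrow> nat"
  where "rank n y p q = card {x \<in> {1..n}. x \<le> p \<and> q < y x}"

text \<open>
  In the max-plus semiring, permutations act by their rank matrices and Demazure products become
  matrix products, so the maximum over all \<open>is\<close> of a given length is the trace of a matrix power.
  This explains its invariance.
\<close>

definition attains :: "nat \<Rightarrow> (nat \<Rightarrow> nat) \<Rightarrow> nat \<Rightarrow> nat \<Rightarrow> bool"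
  where "attains n y k v \<longleftrightarrow> (\<exists>is. length is = k \<and> v \<le> cyclic_sum (rank n y) is)"

lemma rank_Suc_row:
  assumes "p < n"
  shows "rank n y (Suc p) q = rank n y p q + of_bool (q < y (Suc p))"
proof -
  have "{x \<in> {1..n}. x \<le> Suc p \<and> q < y x} =
    (if q < y (Suc p) then insert (Suc p) {x \<in> {1..n}. x \<le> p \<and> q < y x} else {x \<in> {1..n}. x \<le> p \<and> q < y x})"
    using assms by (auto simp: le_Suc_eq)
  then show ?thesis
    by (simp add: rank_def)
qed

lemma rank_antimono: "q \<le> q' \<Longrightarrow> rank n y p q' \<le> rank n y p q"
  unfolding rank_def by (rule card_mono) auto

lemma rank_Suc_col:
  assumes "inj y"
  shows "rank n y p q \<le> rank n y p (Suc q) + 1"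
proof -
  have "rank n y p q \<le> card ({x \<in> {1..n}. x \<le> p \<and> Suc q < y x} \<union> {x. y x = Suc q})"
    unfolding rank_def
  proof (rule card_mono)
    show "finite ({x \<in> {1..n}. x \<le> p \<and> Suc q < y x} \<union> {x. y x = Suc q})"
      using finite_vimageI[OF _ assms, of "{Suc q}"] by (auto simp: vimage_def)
  qed auto
  also have "\<dots> \<le> rank n y p (Suc q) + card {x. y x = Suc q}"
    unfolding rank_def by (rule card_Un_le)
  also have "card {x. y x = Suc q} \<le> 1"
    using card_vimage_inj_on_le[OF assms, of "{Suc q}"] by (simp add: vimage_def)
  finally show ?thesis
    by simp
qed

text \<open>An index \<open>i\<close> can be moved to a neighbour without loss. If
  \<open>y i \<le> q\<close>, row \<open>i\<close> equals row \<open>i - 1\<close> at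
  \<open>q\<close>, and column \<open>i - 1\<close> is no smaller than column \<open>i\<close>.
  Otherwise \<open>q < y i < y (Suc i)\<close>, so row \<open>Suc i\<close> gains one, which covers
  the loss of at most one in column \<open>Suc i\<close>.\<close>

lemma cyclic_sum_rank_avoid:
  assumes "inj y" "i \<in> {1..<n}" "y i < y (Suc i)"
  shows "\<exists>js. length js = length is \<and> i \<notin> set js \<and> cyclic_sum (rank n y) is \<le> cyclic_sum (rank n y) js"
proof (induction "count_list is i" arbitrary: "is" rule: less_induct)
  case less
  show ?case
  proof (cases "i \<in> set is")
    case True
    then obtain us vs where "is": "is = us @ i # vs"
      by (meson split_list)
    define js where "js = vs @ us"
    have rot: "cyclic_sum (rank n y) is = cyclic_sum (rank n y) (i # js)"
      using cyclic_sum_append[of _ us "i # vs"] by (simp add: "is" js_def)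
    have row: "rank n y i q = rank n y (i - 1) q \<or> rank n y (Suc i) q = rank n y i q + 1" for q
      using rank_Suc_row[of "i - 1" n y q] rank_Suc_row[of i n y q] assms by (auto simp: of_bool_def)
    have col: "rank n y p i \<le> rank n y p (i - 1)" "rank n y p i \<le> rank n y p (Suc i) + 1" for p
      using rank_antimono rank_Suc_col[OF assms(1)] by auto
    have "\<exists>i'. i' \<noteq> i \<and> cyclic_sum (rank n y) (i # js) \<le> cyclic_sum (rank n y) (i' # js)"
    proof (cases "js = []")
      case True
      have "rank n y i i \<le> rank n y (i - 1) (i - 1) \<or> rank n y i i \<le> rank n y (Suc i) (Suc i)"
        using row[of i] col[of "i - 1"] col[of "Suc i"] by linarith
      then show ?thesis
        using True assms(2) by (auto simp: cyclic_sum_split intro: exI[of _ "i - 1"] exI[of _ "Suc i"])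
    next
      case False
      have "cyclic_sum (rank n y) (i # js) \<le> cyclic_sum (rank n y) ((i - 1) # js) \<or>
        cyclic_sum (rank n y) (i # js) \<le> cyclic_sum (rank n y) (Suc i # js)"
        using row[of "hd js"] col[of "last js"] False by (cases js) (auto simp: cyclic_sum_split)
      moreover have "i - 1 \<noteq> i" "Suc i \<noteq> i"
        using assms(2) by auto
      ultimately show ?thesis
        by blast
    qed
    then obtain i' where i': "i' \<noteq> i" "cyclic_sum (rank n y) (i # js) \<le> cyclic_sum (rank n y) (i' # js)"
      by blast
    have "count_list (i' # js) i < count_list is i"
      using i'(1) by (simp add: "is" js_def)
    from less.hyps[OF this] obtain ks where "length ks = length (i' # js)" "i \<notin> set ks"
        "cyclic_sum (rank n y) (i' # js) \<le> cyclic_sum (rank n y) ks"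
      by blast
    then show ?thesis
      using i'(2) rot by (intro exI[of _ ks]) (auto simp: "is" js_def)
  qed auto
qed

text \<open>The transposition on the left changes only column \<open>i\<close> of the rank matrix
  and can only increase it. As \<open>transpose i (Suc i) \<circ> z\<close> still ascends at
  \<open>i\<close>, its best cyclic sums can avoid the index \<open>i\<close>, where both matrices
  agree.\<close>

lemma attains_swap:
  assumes z: "z permutes {1..n}" and i: "i \<in> {1..<n}" and less: "z i < z (Suc i)" "inv z i < inv z (Suc i)"
    and nfix: "\<not> (z i = i \<and> z (Suc i) = Suc i)"
  shows "attains n (transpose i (Suc i) \<circ> z) k v \<longleftrightarrow> attains n z k v"
proof
  let ?t = "transpose i (Suc i)"
  have z': "(?t \<circ> z) i < (?t \<circ> z) (Suc i)" "inj (?t \<circ> z)"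
    using transpose_adjacent_less[OF less(1) nfix] permutes_inj[OF z] by (auto intro: inj_compose)
  have eq: "rank n (?t \<circ> z) p q = rank n z p q" if "q \<noteq> i" for p q
  proof -
    have "q < ?t w \<longleftrightarrow> q < w" for w
      using that by (auto simp: transpose_def)
    then show ?thesis
      by (simp add: rank_def)
  qed
  show "attains n z k v" if att: "attains n (?t \<circ> z) k v"
  proof -
    obtain "is" where "length is = k" "v \<le> cyclic_sum (rank n (?t \<circ> z)) is"
      using att by (auto simp: attains_def)
    moreover obtain js where "length js = length is" "i \<notin> set js"
        "cyclic_sum (rank n (?t \<circ> z)) is \<le> cyclic_sum (rank n (?t \<circ> z)) js"
      using cyclic_sum_rank_avoid[OF z'(2) i z'(1)] by blast
    moreover from \<open>i \<notin> set js\<close> have "cyclic_sum (rank n (?t \<circ> z)) js = cyclic_sum (rank n z) js"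
      by (intro cyclic_sum_cong eq) auto
    ultimately show ?thesis
      unfolding attains_def by (intro exI[of _ js]) linarith
  qed
  have le: "rank n z p q \<le> rank n (?t \<circ> z) p q" for p q
  proof (cases "q = i")
    case True
    have inv_eq: "inv z a = b \<longleftrightarrow> z b = a" for a b
      using permutes_inv_eq[OF z] .
    \<comment> \<open>In the product the value \<open>Suc i\<close> sits at the position
      \<open>inv z i\<close>, which comes before its old position.\<close>
    let ?f = "\<lambda>x. if x = inv z (Suc i) then inv z i else x"
    show ?thesis
      unfolding rank_def
    proof (rule card_inj_on_le[of ?f])
      show "inj_on ?f {x \<in> {1..n}. x \<le> p \<and> q < z x}"
      proof (rule inj_onI)
        fix x x'
        assume x: "x \<in> {x \<in> {1..n}. x \<le> p \<and> q < z x}" "x' \<in> {x \<in> {1..n}. x \<le> p \<and> q < z x}" "?f x = ?f x'"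
        have "z (inv z i) = i"
          using inv_eq[of i] by blast
        then have "x \<noteq> inv z i" "x' \<noteq> inv z i"
          using x True by auto
        then show "x = x'"
          using x(3) by (simp split: if_splits)
      qed
      have "inv z i \<in> {1..n}"
        using permutes_in_image[OF permutes_inv[OF z]] i by auto
      moreover have "z (inv z i) = i"
        using inv_eq[of i] by blast
      moreover have "x = inv z (Suc i)" if "z x = Suc i" for x
        using inv_eq[of "Suc i" x] that by simp
      ultimately show "?f ` {x \<in> {1..n}. x \<le> p \<and> q < z x} \<subseteq> {x \<in> {1..n}. x \<le> p \<and> q < (?t \<circ> z) x}"
        using True less(2) by (auto simp: transpose_def)
    qed simp
  qed (simp add: eq)
  show "attains n (?t \<circ> z) k v" if "attains n z k v"
  proof -
    obtain "is" where "length is = k" "v \<le> cyclic_sum (rank n z) is"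
      using \<open>attains n z k v\<close> by (auto simp: attains_def)
    moreover have "cyclic_sum (rank n z) is \<le> cyclic_sum (rank n (?t \<circ> z)) is"
      by (rule cyclic_sum_mono) (rule le)
    ultimately show ?thesis
      unfolding attains_def using le_trans by blast
  qed
qed

lemma cyclic_sum_rev: "cyclic_sum f (rev xs) = cyclic_sum (\<lambda>x y. f y x) xs"
proof (cases xs)
  case (Cons x ys)
  have path: "path_sum f (rev zs) = path_sum (\<lambda>x y. f y x) zs" for zs
  proof (induction zs rule: induct_list012)
    case (3 a b zs)
    then show ?case
      using path_sum_append[of f "rev zs" b "[a]"] by simp
  qed auto
  then show ?thesis
    using Cons by (simp add: cyclic_sum_split hd_rev last_rev del: rev.simps)
qed simp

text \<open>Both sides count the same after adding the \<open>x \<le> q\<close> with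
  \<open>y x \<le> p\<close> to each rank. The \<open>min\<close> terms depend on one index only and
  cancel in a cyclic sum, so inversion amounts to reversing the index sequence.\<close>

lemma rank_inv:
  assumes "y permutes {1..n}"
  shows "rank n (inv y) p q + min q n = rank n y q p + min p n"
proof -
  let ?S = "{1..n}"
  have bij: "bij_betw y {x \<in> ?S. P x (y x)} {x \<in> ?S. P (inv y x) x}" for P
    unfolding bij_betw_def
  proof
    show "inj_on y {x \<in> ?S. P x (y x)}"
      using permutes_inj[OF assms] by (rule inj_on_subset) simp
    have "x \<in> y ` {x \<in> ?S. P x (y x)}" if "x \<in> ?S" "P (inv y x) x" for x
      using that permutes_in_image[OF permutes_inv[OF assms]] permutes_inverses[OF assms]
      by (intro image_eqI[of _ _ "inv y x"]) auto
    then show "y ` {x \<in> ?S. P x (y x)} = {x \<in> ?S. P (inv y x) x}"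
      using permutes_in_image[OF assms] permutes_inverses[OF assms] by auto
  qed
  have "rank n (inv y) p q = card {x \<in> ?S. q < x \<and> y x \<le> p}"
    using bij_betw_same_card[OF bij[of "\<lambda>x w. q < x \<and> w \<le> p"]] by (simp add: rank_def conj_commute)
  moreover have "min p n = card {x \<in> ?S. y x \<le> p}"
  proof -
    have "{x \<in> ?S. x \<le> p} = {1..min p n}"
      by auto
    then show ?thesis
      using bij_betw_same_card[OF bij[of "\<lambda>x w. w \<le> p"]] by simp
  qed
  moreover have "min q n = card {x \<in> ?S. x \<le> q}"
  proof -
    have "{x \<in> ?S. x \<le> q} = {1..min q n}"
      by auto
    then show ?thesis
      by simp
  qed
  moreover have "card {x \<in> ?S. y x \<le> p} = card {x \<in> ?S. q < x \<and> y x \<le> p} + card {x \<in> ?S. x \<le> q \<and> y x \<le> p}"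
    by (subst card_Un_disjoint[symmetric]) (auto intro!: arg_cong[of _ _ card])
  moreover have "card {x \<in> ?S. x \<le> q} = card {x \<in> ?S. x \<le> q \<and> p < y x} + card {x \<in> ?S. x \<le> q \<and> y x \<le> p}"
    by (subst card_Un_disjoint[symmetric]) (auto intro!: arg_cong[of _ _ card])
  ultimately show ?thesis
    by (simp add: rank_def)
qed

lemma attains_inv:
  assumes "y permutes {1..n}"
  shows "attains n (inv y) k v \<longleftrightarrow> attains n y k v"
proof -
  have "cyclic_sum (rank n (inv y)) is = cyclic_sum (rank n y) (rev is)" for "is"
  proof -
    have "cyclic_sum (\<lambda>p q. rank n (inv y) p q + min q n) is = cyclic_sum (\<lambda>p q. rank n y q p + min p n) is"
      by (intro cyclic_sum_cong rank_inv assms)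
    then show ?thesis
      by (simp add: cyclic_sum_add cyclic_sum_fst cyclic_sum_snd cyclic_sum_rev)
  qed
  then show ?thesis
    unfolding attains_def by (metis length_rev rev_rev_ident)
qed

theorem sort_equiv_attains:
  "sort_equiv n x y \<Longrightarrow> attains n x k v \<longleftrightarrow> attains n y k v"
  by (erule sort_equiv_invariant'[of _ _ _ "\<lambda>y. attains n y k v"]) (auto simp: attains_inv attains_swap)

section \<open>Initial segments exchanged with final ones\<close>

definition exchanges_ends :: "nat \<Rightarrow> (nat \<Rightarrow> nat) \<Rightarrow> nat \<Rightarrow> bool"
  where "exchanges_ends n y a \<longleftrightarrow> 1 \<le> a \<and> 2 * a \<le> n \<and>
    y ` {1..a} = {n - a + 1..n} \<and> y ` {n - a + 1..n} = {1..a}"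

lemma exchanges_ends_inv:
  assumes "y permutes {1..n}"
  shows "exchanges_ends n (inv y) a \<longleftrightarrow> exchanges_ends n y a"
proof -
  have "inv y ` S = T \<longleftrightarrow> y ` T = S" for S T
    using permutes_bij[OF assms] by (metis bij_is_inj bij_is_surj image_f_inv_f image_inv_f_f)
  then show ?thesis
    by (auto simp: exchanges_ends_def)
qed

text \<open>Unless \<open>i\<close> is one of the cuts \<open>a\<close> and \<open>n - a\<close>,
  the transposition preserves both end segments. At a cut, exchanging the ends would force a
  descent, whereas both permutations ascend there on a suitable side; so neither has the
  property.\<close>

lemma exchanges_ends_swap:
  assumes z: "z permutes {1..n}" and i: "i \<in> {1..<n}" and less: "z i < z (Suc i)" "inv z i < inv z (Suc i)"
    and nfix: "\<not> (z i = i \<and> z (Suc i) = Suc i)"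
  shows "exchanges_ends n (transpose i (Suc i) \<circ> z) a \<longleftrightarrow> exchanges_ends n z a"
proof (cases "1 \<le> a \<and> 2 * a \<le> n")
  case a: True
  let ?t = "transpose i (Suc i)" and ?L = "{1..a}" and ?H = "{n - a + 1..n}"
  let ?y = "?t \<circ> z"
  have y: "?y i < ?y (Suc i)" "?y permutes {1..n}"
    using transpose_adjacent_less[OF less(1) nfix] permutes_compose[OF z transpose_permutes[OF i]] by auto
  have mem: "w x \<in> B \<longleftrightarrow> x \<in> A" if "w permutes {1..n}" "w ` A = B" for w x and A B :: "nat set"
    using that(2) permutes_inj[OF that(1)] by (metis image_iff injD)
  have pos: "1 \<le> w x \<and> w x \<le> n" if "w permutes {1..n}" "x \<in> {1..n}" for w x
    using permutes_in_image[OF that(1)] that(2) by auto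
  show ?thesis
  proof (cases "i = a \<or> i = n - a")
    case True
    have "\<not> exchanges_ends n ?y a"
    proof
      assume "exchanges_ends n ?y a"
      then have "?y ` ?L = ?H" "?y ` ?H = ?L"
        by (auto simp: exchanges_ends_def)
      note m = mem[OF y(2) this(1)] mem[OF y(2) this(2)]
      show False
        using True
      proof
        assume "i = a"
        then show False
          using m(1)[of i] m(1)[of "Suc i"] y(1) pos[OF y(2), of "Suc i"] a i by auto
      next
        assume "i = n - a"
        then show False
          using m(2)[of i] m(2)[of "Suc i"] y(1) pos[OF y(2), of i] a i by auto
      qed
    qed
    moreover have "\<not> exchanges_ends n z a"
    proof
      assume "exchanges_ends n z a"
      then have "exchanges_ends n (inv z) a"
        using exchanges_ends_inv[OF z] by simp
      then have "inv z ` ?L = ?H" "inv z ` ?H = ?L"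
        by (auto simp: exchanges_ends_def)
      note iz = permutes_inv[OF z]
      note m = mem[OF iz \<open>inv z ` ?L = ?H\<close>] mem[OF iz \<open>inv z ` ?H = ?L\<close>]
      show False
        using True
      proof
        assume "i = a"
        then show False
          using m(1)[of i] m(1)[of "Suc i"] less(2) pos[OF iz, of "Suc i"] a i by auto
      next
        assume "i = n - a"
        then show False
          using m(2)[of i] m(2)[of "Suc i"] less(2) pos[OF iz, of i] a i by auto
      qed
    qed
    ultimately show ?thesis
      by simp
  next
    case False
    have "i \<in> ?L \<longleftrightarrow> Suc i \<in> ?L" "i \<in> ?H \<longleftrightarrow> Suc i \<in> ?H"
      using False i by auto
    then have "?t ` ?L = ?L" "?t ` ?H = ?H"
      by (simp_all only: transpose_image_eq)
    then have "?t ` A = ?L \<longleftrightarrow> A = ?L" "?t ` A = ?H \<longleftrightarrow> A = ?H" for A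
      by (metis inj_image_eq_iff inj_transpose)+
    then show ?thesis
      by (simp only: exchanges_ends_def image_comp[symmetric])
  qed
qed (auto simp: exchanges_ends_def)

theorem sort_equiv_exchanges_ends:
  "sort_equiv n x y \<Longrightarrow> exchanges_ends n x a \<longleftrightarrow> exchanges_ends n y a"
  by (erule sort_equiv_invariant'[of _ _ _ "\<lambda>y. exchanges_ends n y a"])
    (auto simp: exchanges_ends_inv exchanges_ends_swap)

section \<open>Nested cycles\<close>

lemma permutation_of_cycles:
  assumes "distinct (concat cs)"
  shows "\<exists>y. y permutes set (concat cs) \<and> (\<forall>c\<in>set cs. map y c = rotate1 c)"
  using assms
proof (induction cs)
  case Nil
  show ?case
    by (intro exI[of _ id]) (simp add: fun_eq_iff)
next
  case (Cons c cs)
  then obtain y where y: "y permutes set (concat cs)" "\<forall>c\<in>set cs. map y c = rotate1 c"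
    by auto
  let ?z = "cycle_of_list c \<circ> y"
  have disj: "set c \<inter> set (concat cs) = {}" "distinct c"
    using Cons.prems by auto
  have "?z permutes set (concat (c # cs))"
    by (rule permutes_compose; rule permutes_subset[OF cycle_permutes] permutes_subset[OF y(1)]) auto
  moreover have "map ?z c = rotate1 c"
  proof -
    have "y x = x" if "x \<in> set c" for x
      using permutes_not_in[OF y(1)] disj that by blast
    then have "map ?z c = map (cycle_of_list c) c"
      by simp
    also have "\<dots> = rotate1 c"
      using cyclic_rotation[OF disj(2), of 1] by simp
    finally show ?thesis .
  qed
  moreover have "map ?z c' = rotate1 c'" if "c' \<in> set cs" for c'
  proof -
    have "map ?z c' = map (cycle_of_list c) (rotate1 c')"
      using y(2) that by (metis map_map)
    also have "\<dots> = rotate1 c'"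
      using disj(1) that by (intro map_idI id_outside_supp) auto
    finally show ?thesis .
  qed
  ultimately have "?z permutes set (concat (c # cs)) \<and> (\<forall>c'\<in>set (c # cs). map ?z c' = rotate1 c')"
    unfolding set_simps by blast
  then show ?case
    by blast
qed

text \<open>A rank entry is the sum over all \<open>x\<close> of the indicator of
  \<open>x \<le> i\<close> and \<open>j < y x\<close>. Interchanging the sums groups it by the
  cycles of \<open>y\<close>, along which \<open>y x\<close> is the successor of
  \<open>x\<close>.\<close>

lemma cyclic_sum_rank:
  assumes "distinct (concat cs)" "set (concat cs) = {1..n}" "\<forall>c\<in>set cs. map y c = rotate1 c"
  shows "cyclic_sum (rank n y) is = (\<Sum>c\<leftarrow>cs. crossings (\<le>) c is)"
proof -
  let ?f = "\<lambda>x w. cyclic_sum (\<lambda>i j. of_bool (x \<le> i \<and> \<not> w \<le> j)) is"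
  have "rank n y i j = (\<Sum>x\<in>{1..n}. of_bool (x \<le> i \<and> \<not> y x \<le> j))" for i j
    by (simp add: rank_def not_le Int_def conj_ac)
  then have "cyclic_sum (rank n y) is = (\<Sum>x\<in>{1..n}. ?f x (y x))"
    unfolding cyclic_sum_nth by (simp only: sum.swap[of _ "{..<length is}"])
  also have "\<dots> = (\<Sum>x\<leftarrow>concat cs. ?f x (y x))"
    unfolding assms(2)[symmetric] sum_list_distinct_conv_sum_set[OF assms(1)] ..
  also have "\<dots> = (\<Sum>c\<leftarrow>cs. \<Sum>x\<leftarrow>c. ?f x (y x))"
    by (induction cs) auto
  also have "\<dots> = (\<Sum>c\<leftarrow>cs. crossings (\<le>) c is)"
  proof (rule arg_cong[of _ _ sum_list], rule map_cong[OF HOL.refl])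
    fix c
    assume "c \<in> set cs"
    then have "crossings (\<le>) c is = (\<Sum>(x, w)\<leftarrow>zip c (map y c). ?f x w)"
      using assms(3) by (simp add: crossings_def cyclic_sum_def)
    also have "\<dots> = (\<Sum>x\<leftarrow>c. ?f x (y x))"
      by (simp add: zip_map2 zip_same_conv_map comp_def)
    finally show "(\<Sum>x\<leftarrow>c. ?f x (y x)) = crossings (\<le>) c is"
      by simp
  qed
  finally show ?thesis .
qed

text \<open>The cycle alternates between the lowest \<open>Suc p div 2\<close> and the highest
  \<open>p div 2\<close> points of the window. It thus crosses a threshold in the remaining gap
  downwards or upwards as often as its length permits, and leaves the gap free for the next
  cycle.\<close>

fun zigzag :: "nat \<Rightarrow> nat \<Rightarrow> nat \<Rightarrow> nat list"
where
  "zigzag lo hi 0 = []"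
| "zigzag lo hi (Suc 0) = [Suc lo]"
| "zigzag lo hi (Suc (Suc p)) = Suc lo # hi # zigzag (Suc lo) (hi - 1) p"

fun zigzag_cycles :: "nat \<Rightarrow> nat \<Rightarrow> nat list \<Rightarrow> nat list list"
where
  "zigzag_cycles lo hi [] = []"
| "zigzag_cycles lo hi (p # ps) = zigzag lo hi p # zigzag_cycles (lo + Suc p div 2) (hi - p div 2) ps"

lemma length_zigzag [simp]: "length (zigzag lo hi p) = p"
  by (induction lo hi p rule: zigzag.induct) auto

lemma set_zigzag:
  "lo + p \<le> hi \<Longrightarrow> set (zigzag lo hi p) = {lo + 1..lo + Suc p div 2} \<union> {hi - p div 2 + 1..hi}"
proof (induction lo hi p rule: zigzag.induct)
  case (3 lo hi p)
  then have "set (zigzag lo hi (Suc (Suc p))) =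
      {Suc lo, hi} \<union> ({Suc lo + 1..Suc lo + Suc p div 2} \<union> {hi - 1 - p div 2 + 1..hi - 1})"
    by auto
  also have "\<dots> = {lo + 1..lo + Suc (Suc (Suc p)) div 2} \<union> {hi - Suc (Suc p) div 2 + 1..hi}"
    using 3 by auto
  finally show ?case .
qed auto

lemma distinct_zigzag: "lo + p \<le> hi \<Longrightarrow> distinct (zigzag lo hi p)"
proof (induction lo hi p rule: zigzag.induct)
  case (3 lo hi p)
  then show ?case
    by (auto simp: set_zigzag)
qed auto

lemma nth_zigzag:
  "2 * t < p \<Longrightarrow> zigzag lo hi p ! (2 * t) = lo + t + 1"
  "2 * t + 1 < p \<Longrightarrow> zigzag lo hi p ! (2 * t + 1) = hi - t"
proof (induction lo hi p arbitrary: t rule: zigzag.induct)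
  case (3 lo hi p)
  {
    case 1
    then show ?case
      using 3(1)[of "t - 1"] by (cases t) auto
  next
    case 2
    then show ?case
      using 3(2)[of "t - 1"] by (cases t) auto
  }
qed auto

lemma half_sum: "Suc p div 2 + p div 2 = p"
  by (cases "even p") (auto elim!: evenE oddE)

lemma zigzag_cycles_partition:
  "lo + sum_list ps = hi \<Longrightarrow> distinct (concat (zigzag_cycles lo hi ps)) \<and>
    set (concat (zigzag_cycles lo hi ps)) = {lo + 1..hi}"
proof (induction lo hi ps rule: zigzag_cycles.induct)
  case (2 lo hi p ps)
  let ?lo = "lo + Suc p div 2" and ?hi = "hi - p div 2"
  have "?lo + sum_list ps = ?hi"
    using 2(2) half_sum[of p] by simp
  note IH = 2(1)[OF this]
  have "lo + p \<le> hi"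
    using 2(2) by simp
  note zz = set_zigzag[OF this] distinct_zigzag[OF this]
  have "?lo \<le> ?hi" "lo \<le> ?lo" "?hi \<le> hi"
    using \<open>?lo + sum_list ps = ?hi\<close> by linarith+
  then have "{lo + 1..?lo} \<union> {?hi + 1..hi} \<union> {?lo + 1..?hi} = {lo + 1..hi}"
    "({lo + 1..?lo} \<union> {?hi + 1..hi}) \<inter> {?lo + 1..?hi} = {}"
    by auto
  then show ?case
    using IH zz by simp
qed auto

lemma zigzag_cycles_append:
  "zigzag_cycles lo hi (ps @ qs) = zigzag_cycles lo hi ps @
    zigzag_cycles (lo + (\<Sum>p\<leftarrow>ps. Suc p div 2)) (hi - (\<Sum>p\<leftarrow>ps. p div 2)) qs"
  by (induction ps arbitrary: lo hi) (auto simp: add.assoc)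

section \<open>Values of the two invariants on nested cycles\<close>

definition realizes :: "nat \<Rightarrow> (nat \<Rightarrow> nat) \<Rightarrow> nat list \<Rightarrow> bool"
  where "realizes n y ps \<longleftrightarrow> sum_list ps = n \<and> y permutes {1..n} \<and>
    (\<forall>c\<in>set (zigzag_cycles 0 n ps). map y c = rotate1 c)"

lemma realizes_exists:
  assumes "sum_list ps = n"
  shows "\<exists>y. realizes n y ps"
  using permutation_of_cycles[of "zigzag_cycles 0 n ps"] zigzag_cycles_partition[of 0 ps n] assms
  by (auto simp: realizes_def)

lemma realizes_cyclic_sum:
  "realizes n y ps \<Longrightarrow> cyclic_sum (rank n y) is = (\<Sum>c\<leftarrow>zigzag_cycles 0 n ps. crossings (\<le>) c is)"
  using zigzag_cycles_partition[of 0 ps n] by (intro cyclic_sum_rank) (auto simp: realizes_def)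

lemma nested_le: "nested ((\<le>) :: nat \<Rightarrow> nat \<Rightarrow> bool)"
  by (auto simp: nested_def)

lemma sum_crossings_le:
  assumes "odd (length is)"
  shows "2 * (\<Sum>c\<leftarrow>zigzag_cycles lo hi ps. crossings (\<le>) c is) + (\<Sum>p\<leftarrow>filter odd ps. min p (length is)) \<le>
    sum_list ps * length is"
proof (induction lo hi ps rule: zigzag_cycles.induct)
  case (2 lo hi p ps)
  have "2 * crossings (\<le>) (zigzag lo hi p) is + (if odd p then min p (length is) else 0) \<le> p * length is"
    using crossings_odd[OF nested_le assms, of "zigzag lo hi p"] crossings_le[of "(\<le>)" "zigzag lo hi p" "is"]
    by auto
  with 2 show ?case
    by (auto simp: algebra_simps)
qed auto

text \<open>Long cycles see all thresholds at the center, short cycles see them at the two ends.\<close>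

lemma crossings_outer:
  assumes "lo + Suc p div 2 \<le> L" "L \<le> H" "H + p div 2 \<le> hi" "set is \<subseteq> {L, H}"
  shows "length is * (p div 2) \<le> crossings (\<le>) (zigzag lo hi p) is"
proof -
  have L: "x \<le> L \<or> H < x" if "x \<in> set (zigzag lo hi p)" for x
    using that set_zigzag[of lo p hi] half_sum[of p] assms by auto
  have "path_sum (\<lambda>x y. of_bool (x \<le> L \<and> \<not> y \<le> L)) (zigzag lo hi p) \<ge> p div 2"
    using assms(1-3)
  proof (induction lo hi p rule: zigzag.induct)
    case (3 lo hi p)
    have "path_sum f (a # b # zs) \<ge> f a b + path_sum f zs" for f and a b :: nat and zs
      by (cases zs) auto
    from this[of "\<lambda>x y. of_bool (x \<le> L \<and> \<not> y \<le> L)" "Suc lo" hi "zigzag (Suc lo) (hi - 1) p"]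
    have "of_bool (Suc lo \<le> L \<and> \<not> hi \<le> L) +
        path_sum (\<lambda>x y. of_bool (x \<le> L \<and> \<not> y \<le> L)) (zigzag (Suc lo) (hi - 1) p) \<le>
      path_sum (\<lambda>x y. of_bool (x \<le> L \<and> \<not> y \<le> L)) (zigzag lo hi (Suc (Suc p)))"
      by simp
    moreover have "p div 2 \<le> path_sum (\<lambda>x y. of_bool (x \<le> L \<and> \<not> y \<le> L)) (zigzag (Suc lo) (hi - 1) p)"
      by (rule 3(1)) (use 3(2-) in auto)
    moreover have "Suc lo \<le> L \<and> \<not> hi \<le> L"
      using 3(2-) by auto
    ultimately show ?case
      by simp
  qed auto
  then have *: "p div 2 \<le> cyclic_sum (\<lambda>x y. of_bool (x \<le> L \<and> \<not> y \<le> L)) (zigzag lo hi p)"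
    by (cases "zigzag lo hi p = []") (auto simp: cyclic_sum_split)
  have "crossings (\<le>) (zigzag lo hi p) is =
    cyclic_sum (\<lambda>x y. cyclic_sum (\<lambda>_ _. of_bool (x \<le> L \<and> \<not> y \<le> L)) is) (zigzag lo hi p)"
    unfolding crossings_def
  proof (intro cyclic_sum_cong)
    fix x y i j
    assume "x \<in> set (zigzag lo hi p)" "y \<in> set (zigzag lo hi p)" "i \<in> set is" "j \<in> set is"
    then have "x \<le> i \<longleftrightarrow> x \<le> L" "y \<le> j \<longleftrightarrow> y \<le> L"
      using L[of x] L[of y] assms(2,4) by auto
    then show "of_bool (x \<le> i \<and> \<not> y \<le> j) = (of_bool (x \<le> L \<and> \<not> y \<le> L) :: nat)"
      by simp
  qed
  also have "\<dots> = length is * cyclic_sum (\<lambda>x y. of_bool (x \<le> L \<and> \<not> y \<le> L)) (zigzag lo hi p)"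
    unfolding cyclic_sum_const by (simp add: cyclic_sum_nth sum_distrib_left)
  finally show ?thesis
    using * by simp
qed

text \<open>The test sequence that attains the maximal trace. For points in
  \<open>{L + 1..H}\<close>, each of the \<open>l\<close> steps from \<open>H\<close> to
  \<open>L\<close> counts every cyclically adjacent pair. Longer cycles that straddle this interval
  do not distinguish \<open>L\<close> from \<open>H\<close>.\<close>

definition alternating :: "nat \<Rightarrow> nat \<Rightarrow> nat \<Rightarrow> nat list"
  where "alternating L H l = concat (replicate l [L, H]) @ [L]"

lemma length_alternating [simp]: "length (alternating L H l) = 2 * l + 1"
  by (induction l) (auto simp: alternating_def)

lemma set_alternating: "set (alternating L H l) \<subseteq> {L, H}"
  by (auto simp: alternating_def)

lemma crossings_inner:
  assumes "set xs \<subseteq> {L + 1..H}"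
  shows "length xs * l \<le> crossings (\<le>) xs (alternating L H l)"
proof -
  have "l \<le> cyclic_sum (\<lambda>i j. of_bool (x \<le> i \<and> \<not> y \<le> j)) (alternating L H l)"
    if "x \<in> {L + 1..H}" "y \<in> {L + 1..H}" for x y
  proof -
    have "l \<le> path_sum (\<lambda>i j. of_bool (x \<le> i \<and> \<not> y \<le> j)) (alternating L H l)"
    proof (induction l)
      case (Suc l)
      have "alternating L H (Suc l) = [L, H] @ alternating L H l"
        by (simp add: alternating_def)
      moreover obtain zs where "alternating L H l = L # zs"
        by (cases l) (auto simp: alternating_def)
      ultimately show ?case
        using Suc that by auto
    qed simp
    then show ?thesis
      by (subst cyclic_sum_split) (auto simp: alternating_def)
  qed
  then have "cyclic_sum (\<lambda>_ _. l) xs \<le> crossings (\<le>) xs (alternating L H l)"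
    unfolding crossings_def by (rule cyclic_sum_mono) (use assms in blast)+
  then show ?thesis
    by (simp add: cyclic_sum_const)
qed

text \<open>The cycles of odd length at most \<open>k\<close> have to be innermost, so that one
  interval between \<open>L\<close> and \<open>H\<close> contains them and lies in the gap of all
  others. This is where the decreasing order of the odd parts enters.\<close>

lemma canonical_split:
  assumes "canonical ps"
  shows "\<exists>qs rs. ps = qs @ rs \<and> (\<forall>p\<in>set qs. even p \<or> k < p) \<and> (\<forall>p\<in>set rs. odd p \<and> p \<le> k)"
  using assms
proof (induction ps)
  case (Cons p ps)
  then obtain qs rs where *: "ps = qs @ rs" "\<forall>p\<in>set qs. even p \<or> k < p" "\<forall>p\<in>set rs. odd p \<and> p \<le> k"
    by auto
  show ?case
  proof (cases "even p \<or> k < p")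
    case True
    then show ?thesis
      using * by (intro exI[of _ "p # qs"] exI[of _ rs]) auto
  next
    case False
    then have "\<forall>q\<in>set (p # ps). odd q \<and> q \<le> k"
      using Cons.prems by fastforce
    then show ?thesis
      by (intro exI[of _ "[]"] exI[of _ "p # ps"]) simp
  qed
qed auto

lemma sum_crossings_outer:
  assumes "lo + (\<Sum>p\<leftarrow>ps. Suc p div 2) \<le> L" "L \<le> H" "H + (\<Sum>p\<leftarrow>ps. p div 2) \<le> hi" "set is \<subseteq> {L, H}"
    "\<forall>p\<in>set ps. even p \<or> length is < p"
  shows "sum_list ps * length is \<le> 2 * (\<Sum>c\<leftarrow>zigzag_cycles lo hi ps. crossings (\<le>) c is) +
    (\<Sum>p\<leftarrow>filter odd ps. min p (length is))"
  using assms
proof (induction lo hi ps rule: zigzag_cycles.induct)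
  case (2 lo hi p ps)
  have "length is * (p div 2) \<le> crossings (\<le>) (zigzag lo hi p) is"
    by (rule crossings_outer[of _ _ L H]) (use 2(2-) in auto)
  moreover have "p * length is = 2 * (length is * (p div 2)) + (if odd p then length is else 0)"
    by (cases "even p") (auto elim!: evenE oddE simp: algebra_simps)
  ultimately have "p * length is \<le> 2 * crossings (\<le>) (zigzag lo hi p) is + (if odd p then min p (length is) else 0)"
    using 2(6) by auto
  moreover have "sum_list ps * length is \<le>
    2 * (\<Sum>c\<leftarrow>zigzag_cycles (lo + Suc p div 2) (hi - p div 2) ps. crossings (\<le>) c is) +
    (\<Sum>p\<leftarrow>filter odd ps. min p (length is))"
    by (rule 2(1)) (use 2(2-) in auto)
  ultimately show ?case
    by (cases "even p") (simp_all add: algebra_simps)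
qed auto

lemma sum_crossings_inner:
  assumes "L + sum_list ps = H" "\<forall>p\<in>set ps. odd p \<and> p \<le> 2 * l + 1"
  shows "sum_list ps * (2 * l + 1) \<le> 2 * (\<Sum>c\<leftarrow>zigzag_cycles L H ps. crossings (\<le>) c (alternating L H l)) +
    (\<Sum>p\<leftarrow>filter odd ps. min p (2 * l + 1))"
proof -
  have len: "map length (zigzag_cycles a b ps) = ps" for a b
    by (induction ps arbitrary: a b) auto
  have le: "sum_list (map length cs) * l \<le> (\<Sum>c\<leftarrow>cs. crossings (\<le>) c (alternating L H l))"
    if "\<forall>c\<in>set cs. set c \<subseteq> {L + 1..H}" for cs
    using that
  proof (induction cs)
    case (Cons c cs)
    then have "length c * l \<le> crossings (\<le>) c (alternating L H l)"
      by (intro crossings_inner) simp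
    with Cons show ?case
      by (simp add: algebra_simps)
  qed simp
  have "\<forall>c\<in>set (zigzag_cycles L H ps). set c \<subseteq> {L + 1..H}"
    using zigzag_cycles_partition[OF assms(1)] by auto
  from le[OF this] have "sum_list ps * l \<le> (\<Sum>c\<leftarrow>zigzag_cycles L H ps. crossings (\<le>) c (alternating L H l))"
    unfolding len .
  moreover have "filter odd ps = ps"
    using assms(2) by (intro filter_True) blast
  moreover have "map (\<lambda>p. min p (2 * l + 1)) ps = ps"
    using assms(2) by (intro map_idI) simp
  ultimately show ?thesis
    by (simp add: add_mult_distrib2)
qed

text \<open>The maximum is half of n k minus the defects: each cycle obeys its own bound, and one
  alternating sequence attains all the bounds simultaneously.\<close>

lemma realizes_attains:
  assumes y: "realizes n y ps" "canonical ps" and k: "odd k"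
  shows "attains n y k v \<longleftrightarrow> 2 * v + (\<Sum>p\<leftarrow>filter odd ps. min p k) \<le> n * k"
proof
  assume "attains n y k v"
  then obtain "is" where "length is = k" "v \<le> cyclic_sum (rank n y) is"
    by (auto simp: attains_def)
  then show "2 * v + (\<Sum>p\<leftarrow>filter odd ps. min p k) \<le> n * k"
    using sum_crossings_le[of "is" 0 n ps] k y(1) by (auto simp: realizes_cyclic_sum realizes_def)
next
  assume v: "2 * v + (\<Sum>p\<leftarrow>filter odd ps. min p k) \<le> n * k"
  obtain l where l: "k = 2 * l + 1"
    using k by (blast elim: oddE)
  obtain qs rs where qr: "ps = qs @ rs" "\<forall>p\<in>set qs. even p \<or> k < p" "\<forall>p\<in>set rs. odd p \<and> p \<le> k"
    using canonical_split[OF y(2)] by blast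
  \<comment> \<open>The cycles of \<open>rs\<close> occupy exactly
    \<open>{L + 1..H}\<close>.\<close>
  define L where "L = (\<Sum>p\<leftarrow>qs. Suc p div 2)"
  define H where "H = n - (\<Sum>p\<leftarrow>qs. p div 2)"
  have "(\<Sum>p\<leftarrow>qs. Suc p div 2) + (\<Sum>p\<leftarrow>qs. p div 2) = sum_list qs"
    unfolding sum_list_addf[symmetric] half_sum by simp
  moreover have "sum_list qs + sum_list rs = n"
    using y(1) qr(1) by (simp add: realizes_def)
  ultimately have LH: "L + sum_list rs = H" "H + (\<Sum>p\<leftarrow>qs. p div 2) = n"
    by (auto simp: L_def H_def)
  define "is" where "is = alternating L H l"
  have "length is = k"
    by (simp add: is_def l)
  have "sum_list qs * k \<le> 2 * (\<Sum>c\<leftarrow>zigzag_cycles 0 n qs. crossings (\<le>) c is) +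
      (\<Sum>p\<leftarrow>filter odd qs. min p k)"
    using sum_crossings_outer[of 0 qs L H n "is"] LH qr(2) set_alternating[of L H l]
    by (simp add: \<open>length is = k\<close> L_def[symmetric]) (simp add: is_def)
  moreover have "sum_list rs * k \<le> 2 * (\<Sum>c\<leftarrow>zigzag_cycles L H rs. crossings (\<le>) c is) +
      (\<Sum>p\<leftarrow>filter odd rs. min p k)"
    using sum_crossings_inner[OF LH(1), of l] qr(3) by (simp add: is_def l)
  moreover have "cyclic_sum (rank n y) is = (\<Sum>c\<leftarrow>zigzag_cycles 0 n qs. crossings (\<le>) c is) +
      (\<Sum>c\<leftarrow>zigzag_cycles L H rs. crossings (\<le>) c is)"
    unfolding realizes_cyclic_sum[OF y(1)] by (simp add: qr(1) zigzag_cycles_append L_def H_def)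
  ultimately have "n * k \<le> 2 * cyclic_sum (rank n y) is + (\<Sum>p\<leftarrow>filter odd ps. min p k)"
    using \<open>sum_list qs + sum_list rs = n\<close> by (auto simp: qr(1) algebra_simps)
  then have "v \<le> cyclic_sum (rank n y) is"
    using v by linarith
  then show "attains n y k v"
    using \<open>length is = k\<close> by (auto simp: attains_def)
qed

lemma rotate1_zigzag:
  assumes "map y (zigzag lo hi p) = rotate1 (zigzag lo hi p)"
  shows "2 * t + 1 < p \<Longrightarrow> y (lo + t + 1) = hi - t"
    and "2 * t + 2 < p \<Longrightarrow> y (hi - t) = lo + t + 2"
    and "2 * t + 2 = p \<Longrightarrow> y (hi - t) = lo + 1"
    and "2 * t + 1 = p \<Longrightarrow> y (lo + t + 1) = lo + 1"
proof -
  have next_nth: "y (zigzag lo hi p ! i) = zigzag lo hi p ! (Suc i mod p)" if "i < p" for i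
    using arg_cong[OF assms, of "\<lambda>xs. xs ! i"] that by (simp add: nth_rotate1)
  show "2 * t + 1 < p \<Longrightarrow> y (lo + t + 1) = hi - t"
    using next_nth[of "2 * t"] nth_zigzag[of t p lo hi] by simp
  show "2 * t + 2 < p \<Longrightarrow> y (hi - t) = lo + t + 2"
    using next_nth[of "2 * t + 1"] nth_zigzag(2)[of t p lo hi] nth_zigzag(1)[of "t + 1" p lo hi] by simp
  show "2 * t + 2 = p \<Longrightarrow> y (hi - t) = lo + 1"
    using next_nth[of "2 * t + 1"] nth_zigzag(2)[of t p lo hi] nth_zigzag(1)[of 0 p lo hi] by auto
  show "2 * t + 1 = p \<Longrightarrow> y (lo + t + 1) = lo + 1"
    using next_nth[of "2 * t"] nth_zigzag(1)[of t p lo hi] nth_zigzag(1)[of 0 p lo hi] by auto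
qed

text \<open>The nonempty prefix sums of the halves: the sizes of the initial segments filled by the
  outermost even cycles.\<close>

fun half_sums :: "nat list \<Rightarrow> nat set"
where
  "half_sums [] = {}"
| "half_sums (e # es) = insert (e div 2) ((+) (e div 2) ` half_sums es)"

lemma half_sums_pos: "\<forall>e\<in>set es. even e \<and> 0 < e \<Longrightarrow> a \<in> half_sums es \<Longrightarrow> 0 < a"
  by (induction es arbitrary: a) (auto elim!: evenE)

text \<open>The least prefix sum is the half of the first entry; removing it and subtracting it from
  the others leaves the set for the tail.\<close>

lemma half_sums_inject:
  assumes "\<forall>e\<in>set es. even e \<and> 0 < e" "\<forall>e\<in>set fs. even e \<and> 0 < e" "half_sums es = half_sums fs"
  shows "es = fs"
  using assms
proof (induction es arbitrary: fs)
  case Nil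
  then show ?case
    by (cases fs) auto
next
  case (Cons e es)
  then obtain f fs' where fs: "fs = f # fs'"
    by (cases fs) auto
  have le: "b div 2 \<le> a div 2" if "half_sums (a # as) = half_sums (b # bs)" for a b as bs
    using arg_cong[OF that, of "\<lambda>S. a div 2 \<in> S"] by auto
  have "e div 2 = f div 2"
    using le[of e es f fs'] le[of f fs' e es] Cons.prems(3) fs by simp
  moreover have "even e" "even f"
    using Cons.prems fs by auto
  ultimately have ef: "e = f"
    by (auto elim!: evenE)
  have "e div 2 \<notin> (+) (e div 2) ` half_sums es" "e div 2 \<notin> (+) (e div 2) ` half_sums fs'"
    using half_sums_pos[of es] half_sums_pos[of fs'] Cons.prems fs by fastforce+
  then have "(+) (e div 2) ` half_sums es = (+) (e div 2) ` half_sums fs'"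
    using Cons.prems(3) by (simp add: fs ef insert_ident)
  then have "half_sums es = half_sums fs'"
    by (simp add: inj_image_eq_iff)
  then have "es = fs'"
    using Cons.IH[of fs'] Cons.prems(1,2) by (simp add: fs)
  then show ?case
    by (simp add: fs ef)
qed

text \<open>An even cycle takes equally many points from both ends, so the window
  \<open>{lo + 1..n - lo}\<close> stays symmetric and the low points go to their
  reflections.\<close>

lemma zigzag_cycles_half_sums:
  assumes "\<forall>c\<in>set (zigzag_cycles lo (n - lo) (es @ os)). map y c = rotate1 c"
    and "\<forall>e\<in>set es. even e \<and> 0 < e" "2 * lo + sum_list (es @ os) = n" "a \<in> half_sums es"
  shows "(\<forall>x\<in>{lo + 1..lo + a}. y x = n + 1 - x) \<and> (\<forall>x\<in>{n - lo - a + 1..n - lo}. y x \<in> {lo + 1..lo + a})"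
  using assms
proof (induction es arbitrary: lo a)
  case (Cons e es)
  obtain h where h: "e = 2 * h" "0 < h"
    using Cons.prems(2) by (auto elim!: evenE)
  have "map y (zigzag lo (n - lo) e) = rotate1 (zigzag lo (n - lo) e)"
    using Cons.prems(1) by simp
  note zz = rotate1_zigzag[OF this, unfolded h(1)]
  have n: "lo + e \<le> n - lo" "2 * (lo + h) + sum_list (es @ os) = n"
    using Cons.prems(3) h by auto
  have low: "y x = n + 1 - x" if "x \<in> {lo + 1..lo + h}" for x
    using zz(1)[of "x - lo - 1"] that n h by auto
  have high: "y x \<in> {lo + 1..lo + h}" if "x \<in> {n - lo - h + 1..n - lo}" for x
    using zz(2)[of "n - lo - x"] zz(3)[of "n - lo - x"] that n h by (cases "n - lo - x + 1 = h") auto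
  show ?case
  proof (cases "a = h")
    case True
    then show ?thesis
      using low high by blast
  next
    case False
    then obtain b where b: "a = h + b" "b \<in> half_sums es"
      using Cons.prems(4) h by auto
    have "(\<forall>x\<in>{lo + h + 1..lo + h + b}. y x = n + 1 - x) \<and>
        (\<forall>x\<in>{n - (lo + h) - b + 1..n - (lo + h)}. y x \<in> {lo + h + 1..lo + h + b})"
      by (rule Cons.IH) (use Cons.prems h b n in auto)
    moreover have "{lo + 1..lo + a} = {lo + 1..lo + h} \<union> {lo + h + 1..lo + h + b}"
      "{n - lo - a + 1..n - lo} = {n - lo - h + 1..n - lo} \<union> {n - (lo + h) - b + 1..n - (lo + h)}"
      using b n h by auto
    ultimately show ?thesis
      using low high by auto
  qed
qed simp

text \<open>A cut strictly inside an even cycle, or within the high half of the first odd cycle,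
  fails because \<open>n - a + 1\<close> goes to \<open>a + 1\<close>. Beyond that, the odd cycle
  closes by sending its middle point \<open>lo + h + 1\<close> to \<open>lo + 1\<close>, from the
  initial segment into itself.\<close>

lemma exchanges_ends_half_sums:
  assumes "\<forall>c\<in>set (zigzag_cycles lo (n - lo) (es @ os)). map y c = rotate1 c"
    and "\<forall>e\<in>set es. even e \<and> 0 < e" "\<forall>p\<in>set os. odd p" "2 * lo + sum_list (es @ os) = n"
    and "exchanges_ends n y a" "lo < a"
  shows "a - lo \<in> half_sums es"
  using assms
proof (induction es arbitrary: lo)
  case Nil
  have a: "2 * a \<le> n" "y ` {1..a} = {n - a + 1..n}" "y ` {n - a + 1..n} = {1..a}"
    using Nil.prems by (auto simp: exchanges_ends_def)
  then obtain p ps where os: "os = p # ps"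
    using Nil.prems by (cases os) auto
  obtain h where h: "p = 2 * h + 1"
    using Nil.prems(3) os by (auto elim!: oddE)
  have "map y (zigzag lo (n - lo) p) = rotate1 (zigzag lo (n - lo) p)"
    using Nil.prems(1) os by simp
  note zz = rotate1_zigzag[OF this, unfolded h]
  have "lo + p \<le> n - lo"
    using Nil.prems(4) os by simp
  have False
  proof (cases "a - lo \<le> h")
    case True
    have "y (n - lo - (a - lo - 1)) = a + 1"
      using zz(2)[of "a - lo - 1"] True Nil.prems(6) by auto
    moreover have "n - lo - (a - lo - 1) \<in> {n - a + 1..n}"
      using Nil.prems(6) a(1) by auto
    ultimately have "a + 1 \<in> {1..a}"
      using a(3) by (metis imageI)
    then show False
      by simp
  next
    case False
    then have "lo + h + 1 \<in> {1..a}"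
      by simp
    moreover have "y (lo + h + 1) = lo + 1"
      using zz(4)[of h] by simp
    ultimately have "lo + 1 \<in> {n - a + 1..n}"
      using a(2) by (metis imageI)
    then show False
      using Nil.prems(6) a(1) by auto
  qed
  then show ?case ..
next
  case (Cons e es)
  have a: "2 * a \<le> n" "y ` {n - a + 1..n} = {1..a}"
    using Cons.prems by (auto simp: exchanges_ends_def)
  obtain h where h: "e = 2 * h" "0 < h"
    using Cons.prems(2) by (auto elim!: evenE)
  have "map y (zigzag lo (n - lo) e) = rotate1 (zigzag lo (n - lo) e)"
    using Cons.prems(1) by simp
  note zz = rotate1_zigzag[OF this, unfolded h(1)]
  have n: "lo + e \<le> n - lo" "2 * (lo + h) + sum_list (es @ os) = n"
    using Cons.prems(4) h by auto
  consider "a - lo < h" | "a - lo = h" | "lo + h < a"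
    by linarith
  then show ?case
  proof cases
    case 1
    have "y (n - lo - (a - lo - 1)) = a + 1"
      using zz(2)[of "a - lo - 1"] 1 Cons.prems(6) by auto
    moreover have "n - lo - (a - lo - 1) \<in> {n - a + 1..n}"
      using Cons.prems(6) a(1) by auto
    ultimately have "a + 1 \<in> {1..a}"
      using a(2) by (metis imageI)
    then show ?thesis
      by simp
  next
    case 2
    then show ?thesis
      by (simp add: h)
  next
    case 3
    have "a - (lo + h) \<in> half_sums es"
      by (rule Cons.IH) (use Cons.prems h n 3 in auto)
    moreover have "a - lo = h + (a - (lo + h))"
      using 3 by simp
    ultimately show ?thesis
      by (simp add: h)
  qed
qed

lemma canonical_evens_odds:
  assumes "canonical ps"
  shows "ps = filter even ps @ filter odd ps"
  using assms
proof (induction ps)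
  case (Cons p ps)
  show ?case
  proof (cases "even p")
    case False
    then have "\<forall>q\<in>set (p # ps). odd q"
      using Cons.prems by auto
    then have "filter odd (p # ps) = p # ps" "filter even (p # ps) = []"
      by (auto simp: filter_empty_conv intro!: filter_True)
    then show ?thesis
      by simp
  qed (use Cons in auto)
qed simp

lemma realizes_exchanges_ends:
  assumes "realizes n y ps" "canonical ps"
  shows "exchanges_ends n y a \<longleftrightarrow> a \<in> half_sums (filter even ps)"
proof -
  let ?es = "filter even ps" and ?os = "filter odd ps"
  have ps: "ps = ?es @ ?os"
    by (rule canonical_evens_odds[OF assms(2)])
  have *: "\<forall>c\<in>set (zigzag_cycles 0 (n - 0) (?es @ ?os)). map y c = rotate1 c"
    "\<forall>e\<in>set ?es. even e \<and> 0 < e" "\<forall>p\<in>set ?os. odd p" "2 * 0 + sum_list (?es @ ?os) = n"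
    using assms(1) canonical_zero[OF assms(2)] unfolding ps[symmetric] by (auto simp: realizes_def intro: gr0I)
  have y: "y permutes {1..n}"
    using assms(1) by (simp add: realizes_def)
  show ?thesis
  proof
    assume "exchanges_ends n y a"
    then show "a \<in> half_sums ?es"
      using exchanges_ends_half_sums[OF * \<open>exchanges_ends n y a\<close>] by (simp add: exchanges_ends_def)
  next
    assume a: "a \<in> half_sums ?es"
    have "2 * a \<le> sum_list es" if "a \<in> half_sums es" "\<forall>e\<in>set es. even e \<and> 0 < e" for a es
      using that by (induction es arbitrary: a) fastforce+
    from this[OF a *(2)] *(4) have an: "2 * a \<le> n"
      by simp
    have z: "\<forall>x\<in>{1..a}. y x = n + 1 - x" "\<forall>x\<in>{n - a + 1..n}. y x \<in> {1..a}"
      using zigzag_cycles_half_sums[OF *(1,2,4) a] by auto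
    have card: "card (y ` S) = card S" for S
      by (rule card_image, rule inj_on_subset[OF permutes_inj[OF y]]) simp
    have "y ` {n - a + 1..n} = {1..a}"
    proof (rule card_subset_eq)
      show "y ` {n - a + 1..n} \<subseteq> {1..a}"
        using z(2) by blast
      show "card (y ` {n - a + 1..n}) = card {1..a}"
        using an by (simp only: card) simp
    qed simp
    moreover have "y ` {1..a} = {n - a + 1..n}"
    proof (rule card_subset_eq)
      show "y ` {1..a} \<subseteq> {n - a + 1..n}"
        using z(1) an by auto
      show "card (y ` {1..a}) = card {n - a + 1..n}"
        using an by (simp only: card) simp
    qed simp
    moreover have "0 < a"
      by (rule half_sums_pos[OF *(2) a])
    ultimately show "exchanges_ends n y a"
      using an by (simp add: exchanges_ends_def)
  qed
qed

text \<open>A second difference: raising \<open>k\<close> by 2 adds 2 for each part of at least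
  \<open>k + 2\<close>, as no odd part equals \<open>k + 1\<close>. Differences of these tail counts
  are the multiplicities.\<close>

lemma mset_eq_if_sum_min_eq:
  fixes ps qs :: "nat list"
  assumes "\<forall>p\<in>set ps. odd p" "\<forall>q\<in>set qs. odd q"
    and sums: "\<And>k. odd k \<Longrightarrow> (\<Sum>p\<leftarrow>ps. min p k) = (\<Sum>q\<leftarrow>qs. min q k)"
  shows "mset ps = mset qs"
proof -
  let ?ge = "\<lambda>k xs. length (filter (\<lambda>p. k \<le> p) xs)"
  have step: "(\<Sum>p\<leftarrow>xs. min p (k + 2)) = (\<Sum>p\<leftarrow>xs. min p k) + 2 * ?ge (k + 2) xs"
    if "odd k" "\<forall>p\<in>set xs. odd p" for k :: nat and xs
    using that(2)
  proof (induction xs)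
    case (Cons x xs)
    moreover have "odd x" "even (k + 1)"
      using Cons.prems that(1) by simp_all
    then have "x \<noteq> k + 1"
      by blast
    ultimately show ?case
      by (auto simp: min_def)
  qed simp
  have one: "(\<Sum>p\<leftarrow>xs. min p 1) = ?ge 1 xs" if "\<forall>p\<in>set xs. odd p" for xs :: "nat list"
    using that
  proof (induction xs)
    case (Cons x xs)
    moreover from Cons.prems have "1 \<le> x"
      using odd_pos[of x] by simp
    ultimately show ?case
      by simp
  qed simp
  have ge: "?ge k ps = ?ge k qs" if "odd k" for k
  proof (cases "k = 1")
    case True
    then show ?thesis
      using one[OF assms(1)] one[OF assms(2)] sums[of 1] by simp
  next
    case False
    then have "k = (k - 2) + 2" "odd (k - 2)"
      using that by presburger+
    then obtain j where j: "k = j + 2" "odd j"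
      by blast
    then show ?thesis
      using step[OF j(2) assms(1)] step[OF j(2) assms(2)] sums[OF j(2)] sums[of k] that by simp
  qed
  have count: "count_list xs p + ?ge (p + 2) xs = ?ge p xs" if "odd p" "\<forall>q\<in>set xs. odd q" for p :: nat and xs
    using that(2)
  proof (induction xs)
    case (Cons x xs)
    then have IH: "count_list xs p + ?ge (p + 2) xs = ?ge p xs"
      by simp
    have "odd x" "even (p + 1)"
      using Cons.prems that(1) by simp_all
    then have "x \<noteq> p + 1"
      by blast
    then consider "x = p" | "x < p" | "p + 2 \<le> x"
      by linarith
    then show ?case
      using IH by cases simp_all
  qed simp
  have "count_list ps p = count_list qs p" for p
  proof (cases "odd p")
    case True
    then show ?thesis
      using count[OF True assms(1)] count[OF True assms(2)] ge[of p] ge[of "p + 2"] by simp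
  next
    case False
    then have "p \<notin> set ps" "p \<notin> set qs"
      using assms by auto
    then show ?thesis
      by simp
  qed
  then show ?thesis
    by (simp add: multiset_eq_iff count_mset)
qed

theorem realizes_sort_equiv_inject:
  assumes x: "realizes n x ps" "canonical ps" and y: "realizes n y qs" "canonical qs" and xy: "sort_equiv n x y"
  shows "filter even ps = filter even qs" "mset (filter odd ps) = mset (filter odd qs)"
proof -
  have "half_sums (filter even ps) = half_sums (filter even qs)"
    using realizes_exchanges_ends[OF x] realizes_exchanges_ends[OF y] sort_equiv_exchanges_ends[OF xy] by blast
  moreover have "\<forall>e\<in>set (filter even xs). even e \<and> 0 < e" if "0 \<notin> set xs" for xs :: "nat list"
  proof
    fix e
    assume "e \<in> set (filter even xs)"
    then show "even e \<and> 0 < e"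
      using that by (metis filter_set gr0I mem_Collect_eq set_filter)
  qed
  ultimately show "filter even ps = filter even qs"
    using half_sums_inject canonical_zero[OF x(2)] canonical_zero[OF y(2)] by blast
  have le: "(\<Sum>p\<leftarrow>filter odd ps'. min p k) \<le> (\<Sum>p\<leftarrow>filter odd ps. min p k)"
    if "realizes n x ps" "canonical ps" "realizes n y ps'" "canonical ps'" "sort_equiv n x y" "odd k" for x y ps ps' k
  proof -
    let ?S = "\<Sum>p\<leftarrow>filter odd ps. min p k"
    \<comment> \<open>Parity is needed here: only if the difference is even does the integral bound
      on \<open>v\<close> determine the sum of minima.\<close>
    have "(\<Sum>p\<leftarrow>filter odd xs. min p k) \<le> sum_list xs * k \<and>
        even (sum_list xs * k - (\<Sum>p\<leftarrow>filter odd xs. min p k))" for xs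
    proof (induction xs)
      case (Cons a xs)
      let ?s = "\<Sum>p\<leftarrow>filter odd xs. min p k"
      obtain d where d: "sum_list xs * k = ?s + 2 * d"
        using Cons by (metis dvdE le_add_diff_inverse)
      have "\<exists>e. a * k = (if odd a then min a k else 0) + 2 * e"
      proof (cases "odd a")
        case True
        have "min a k \<le> a * k"
          using that(6) by (cases k) (auto simp: min_def)
        moreover have "even (a * k - min a k)"
          using True that(6) calculation by (auto simp: min_def)
        ultimately show ?thesis
          using True by (metis dvdE le_add_diff_inverse)
      qed (auto elim!: evenE)
      then obtain e where "a * k = (if odd a then min a k else 0) + 2 * e"
        by blast
      with d have "sum_list (a # xs) * k = (\<Sum>p\<leftarrow>filter odd (a # xs). min p k) + 2 * (d + e)"
        by (simp add: algebra_simps)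
      then show ?case
        by simp
    qed simp
    from this[of ps] that(1) have S: "?S \<le> n * k" "even (n * k - ?S)"
      by (auto simp: realizes_def)
    then have "2 * ((n * k - ?S) div 2) + ?S \<le> n * k"
      by simp
    then have "attains n x k ((n * k - ?S) div 2)"
      using realizes_attains[OF that(1,2,6)] by blast
    then have "2 * ((n * k - ?S) div 2) + (\<Sum>p\<leftarrow>filter odd ps'. min p k) \<le> n * k"
      using sort_equiv_attains[OF that(5)] realizes_attains[OF that(3,4,6)] by blast
    then show ?thesis
      using S by simp
  qed
  show "mset (filter odd ps) = mset (filter odd qs)"
  proof (rule mset_eq_if_sum_min_eq)
    show "(\<Sum>p\<leftarrow>filter odd ps. min p k) = (\<Sum>q\<leftarrow>filter odd qs. min q k)" if "odd k" for k
      using le[OF x y xy that] le[OF y x sort_equiv.sym[OF xy] that] by (rule antisym[rotated])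
  qed auto
qed

section \<open>From words to permutations\<close>

lemma sort_right_fun_upd:
  "sort_right i y = y(i := min (y i) (y (Suc i)), Suc i := max (y i) (y (Suc i)))"
  by (auto simp: sort_right_def fun_eq_iff transpose_def)

lemma hecke_rel_fold_sort_right: "hecke_rel l r \<Longrightarrow> fold sort_right l y = fold sort_right r y"
proof (induction rule: hecke_rel.induct)
  case (idem i)
  show ?case
    by (simp add: sort_right_fun_upd fun_eq_iff)
next
  case (comm i j)
  then show ?case
    by (auto simp: sort_right_fun_upd fun_eq_iff)
next
  case (braid i)
  show ?case
    by (simp add: sort_right_fun_upd fun_eq_iff min_def max_def)
qed

lemma hecke_eq_fold_sort_right: "v \<approx> w \<Longrightarrow> fold sort_right v y = fold sort_right w y"
  by (induction arbitrary: y rule: hecke_eq.induct) (simp_all add: hecke_rel_fold_sort_right)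

lemma transpose_less_iff:
  "{a, b} \<noteq> {i, Suc i} \<Longrightarrow> transpose i (Suc i) a < transpose i (Suc i) b \<longleftrightarrow> a < b"
  by (auto simp: transpose_def doubleton_eq_iff)

text \<open>If \<open>y\<close> maps the positions \<open>j\<close>, \<open>Suc j\<close> to the
  values \<open>i\<close>, \<open>Suc i\<close>, both operations sort the same pair. Otherwise
  neither changes the comparison made by the other.\<close>

lemma sort_left_right_commute:
  assumes y: "y permutes {1..n}" and i: "i \<in> {1..<n}" and j: "j \<in> {1..<n}"
  shows "sort_left i (sort_right j y) = sort_right j (sort_left i y)"
proof -
  let ?s = "transpose i (Suc i)" and ?t = "transpose j (Suc j)"
  have eq: "inv y a = b \<longleftrightarrow> y b = a" for a b
    using permutes_inv_eq[OF y] .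
  have inv_right: "inv (y \<circ> ?t) = ?t \<circ> inv y" and inv_left: "inv (?s \<circ> y) = inv y \<circ> ?s"
    using inv_comp_transpose[OF y] inv_transpose_comp[OF y] by auto
  show ?thesis
  proof (cases "{y j, y (Suc j)} = {i, Suc i}")
    case True
    then consider "y j = i" "y (Suc j) = Suc i" | "y j = Suc i" "y (Suc j) = i"
      by (auto simp: doubleton_eq_iff)
    then show ?thesis
    proof cases
      case 1
      then have "inv y i = j" "inv y (Suc i) = Suc j"
        using eq by auto
      with 1 show ?thesis
        by (simp add: sort_left_def sort_right_def)
    next
      case 2
      then have inv: "inv y i = Suc j" "inv y (Suc i) = j"
        using eq by auto
      have "?s \<circ> y = y \<circ> ?t"
      proof
        fix x
        have "y x = i \<longleftrightarrow> x = Suc j" "y x = Suc i \<longleftrightarrow> x = j"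
          using 2 permutes_inj[OF y] by (metis injD)+
        then show "(?s \<circ> y) x = (y \<circ> ?t) x"
          using 2 by (auto simp: transpose_def)
      qed
      with 2 inv show ?thesis
        by (simp add: sort_left_def sort_right_def inv_right)
    qed
  next
    case False
    then have "{inv y i, inv y (Suc i)} \<noteq> {j, Suc j}"
      using eq by (auto simp: doubleton_eq_iff)
    then have "?t (inv y (Suc i)) < ?t (inv y i) \<longleftrightarrow> inv y (Suc i) < inv y i"
      using transpose_less_iff[of "inv y (Suc i)" "inv y i" j] by (simp add: insert_commute)
    moreover have "?s (y (Suc j)) < ?s (y j) \<longleftrightarrow> y (Suc j) < y j"
      using transpose_less_iff[of "y (Suc j)" "y j" i] False by (simp add: insert_commute)
    ultimately show ?thesis
      by (simp add: sort_left_def sort_right_def inv_right inv_left comp_assoc)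
  qed
qed

section \<open>The longest element and the permutation of a word\<close>

definition reversal :: "nat \<Rightarrow> nat \<Rightarrow> nat"
  where "reversal n x = (if x \<in> {1..n} then n + 1 - x else x)"

lemma reversal_reversal [simp]: "reversal n (reversal n x) = x"
  by (auto simp: reversal_def)

lemma reversal_permutes: "reversal n permutes {1..n}"
  by (rule bij_imp_permutes[OF bij_betwI[of _ _ _ "reversal n"]]) (auto simp: reversal_def)

lemma inv_reversal [simp]: "inv (reversal n) = reversal n"
  by (rule inv_equality) auto

lemma reversal_comp_transpose:
  assumes "i \<in> {1..<n}"
  shows "reversal n \<circ> transpose i (Suc i) = transpose (n - i) (Suc (n - i)) \<circ> reversal n"
  using assms by (auto simp: fun_eq_iff transpose_def reversal_def)

lemma sort_reversal:
  assumes "i \<in> {1..<n}"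
  shows "sort_left (n - i) (reversal n) = sort_right i (reversal n)"
proof -
  have "reversal n (Suc (n - i)) < reversal n (n - i)" "reversal n (Suc i) < reversal n i"
    using assms by (auto simp: reversal_def)
  then show ?thesis
    using reversal_comp_transpose[OF assms] by (simp add: sort_left_def sort_right_def)
qed

text \<open>
  Under \<open>T\<^sub>w \<mapsto> w\<^sub>0 w\<close> the Demazure product becomes bubble sort, started at the longest element.
\<close>

definition word_perm :: "nat \<Rightarrow> nat list \<Rightarrow> nat \<Rightarrow> nat"
  where "word_perm n w = fold sort_right w (reversal n)"

lemma fold_sort_right_permutes:
  "y permutes {1..n} \<Longrightarrow> set w \<subseteq> {1..<n} \<Longrightarrow> fold sort_right w y permutes {1..n}"
proof (induction w arbitrary: y)
  case (Cons i w)
  then show ?case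
    using sort_right_permutes[of y n i] by simp
qed simp

lemma word_perm_permutes: "set w \<subseteq> {1..<n} \<Longrightarrow> word_perm n w permutes {1..n}"
  unfolding word_perm_def by (rule fold_sort_right_permutes[OF reversal_permutes])

lemma word_perm_snoc: "word_perm n (w @ [i]) = sort_right i (word_perm n w)"
  by (simp add: word_perm_def)

text \<open>The first letter acts on the longest element, where sorting on the right at
  \<open>i\<close> is sorting on the left at \<open>n - i\<close>. The left operation then commutes
  past the rest of the word.\<close>

lemma word_perm_Cons:
  assumes "i \<in> {1..<n}" "set w \<subseteq> {1..<n}"
  shows "word_perm n (i # w) = sort_left (n - i) (word_perm n w)"
proof -
  have ni: "n - i \<in> {1..<n}"
    using assms(1) by auto
  have "fold sort_right w (sort_left (n - i) y) = sort_left (n - i) (fold sort_right w y)"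
    if "y permutes {1..n}" for y
    using that assms(2)
  proof (induction w arbitrary: y)
    case (Cons j w)
    then have "j \<in> {1..<n}"
      by simp
    with Cons show ?case
      using sort_left_right_commute[OF Cons.prems(1) ni, of j]
        Cons.IH[OF sort_right_permutes[of y n j]] by simp
  qed simp
  from this[OF reversal_permutes] show ?thesis
    by (simp add: word_perm_def sort_reversal[OF assms(1)])
qed

lemma hecke_eq_word_perm: "v \<approx> w \<Longrightarrow> word_perm n v = word_perm n w"
  unfolding word_perm_def by (rule hecke_eq_fold_sort_right)

lemma twisted_conj_sort_equiv:
  "twisted_conj n v w \<Longrightarrow> set v \<subseteq> {1..<n} \<Longrightarrow> sort_equiv n (word_perm n v) (word_perm n w)"
proof (induction rule: twisted_conj.induct)
  case (hecke v w)
  then show ?case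
    using hecke_eq_word_perm word_perm_permutes sort_equiv.refl by metis
next
  case (rotate i w)
  then have "i \<in> {1..<n}" "n - i \<in> {1..<n}" "set w \<subseteq> {1..<n}"
    by auto
  then show ?case
    using sort_equiv.sort[OF word_perm_permutes, of w n "n - i"]
    by (simp add: word_perm_Cons word_perm_snoc del: atLeastLessThan_iff)
next
  case (sym v w)
  then show ?case
    using twisted_conj_set sort_equiv.sym by blast
next
  case (trans u v w)
  then show ?case
    using twisted_conj_set sort_equiv.trans by blast
qed

lemma decreasing_permutes:
  assumes y: "y permutes {1..n}" and dec: "\<And>i. i \<in> {1..<n} \<Longrightarrow> y (Suc i) < y i"
  shows "y = reversal n"
proof
  fix x
  have range: "1 \<le> y x \<and> y x \<le> n" if "x \<in> {1..n}" for x
    using permutes_in_image[OF y, of x] that by auto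
  have le: "y x + x \<le> n + 1" if "x \<in> {1..n}" for x
    using that
  proof (induction x)
    case (Suc x)
    then show ?case
      using range[of 1] dec[of x] by (cases "x = 0") auto
  qed simp
  have ge: "n + 1 \<le> y (n - d) + (n - d)" if "d < n" for d
    using that
  proof (induction d)
    case 0
    then show ?case
      using range[of n] by simp
  next
    case (Suc d)
    then have "y (Suc (n - Suc d)) < y (n - Suc d)" "Suc (n - Suc d) = n - d"
      using dec[of "n - Suc d"] by auto
    with Suc show ?case
      by simp
  qed
  show "y x = reversal n x"
  proof (cases "x \<in> {1..n}")
    case True
    then show ?thesis
      using le[of x] ge[of "n - x"] by (simp add: reversal_def)
  next
    case False
    then show ?thesis
      using permutes_not_in[OF y False] by (simp only: reversal_def if_False)
  qed
qed

text \<open>Undoing an ascent lowers the sum of all \<open>x * y x\<close>, by the rearrangement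
  inequality, and a permutation without ascents is the reversal, the value of the empty
  word.\<close>

lemma word_perm_surj:
  assumes "y permutes {1..n}"
  shows "\<exists>w. set w \<subseteq> {1..<n} \<and> word_perm n w = y"
  using assms
proof (induction "\<Sum>x\<in>{1..n}. x * y x" arbitrary: y rule: less_induct)
  case less
  show ?case
  proof (cases "\<forall>i\<in>{1..<n}. y (Suc i) < y i")
    case True
    then have "y = reversal n"
      using decreasing_permutes[OF less.prems] by blast
    then show ?thesis
      by (intro exI[of _ "[]"]) (simp add: word_perm_def)
  next
    case False
    then obtain i where i: "i \<in> {1..<n}" "y i \<le> y (Suc i)"
      by force
    have "y i \<noteq> y (Suc i)"
      using permutes_inj[OF less.prems] by (metis injD n_not_Suc_n)
    with i have lt: "y i < y (Suc i)"
      by simp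
    let ?z = "y \<circ> transpose i (Suc i)"
    have z: "?z permutes {1..n}"
      by (rule permutes_compose[OF transpose_permutes[OF i(1)] less.prems])
    have split: "(\<Sum>x\<in>{1..n}. f x) = (\<Sum>x\<in>{1..n} - {i, Suc i}. f x) + (f i + f (Suc i))" for f :: "nat \<Rightarrow> nat"
      using i(1) sum.subset_diff[of "{i, Suc i}" "{1..n}" f] by auto
    have rest: "(\<Sum>x\<in>{1..n} - {i, Suc i}. x * ?z x) = (\<Sum>x\<in>{1..n} - {i, Suc i}. x * y x)"
      by (intro sum.cong) (auto simp: transpose_def)
    have "(\<Sum>x\<in>{1..n}. x * ?z x) < (\<Sum>x\<in>{1..n}. x * y x)"
      unfolding split[of "\<lambda>x. x * ?z x"] split[of "\<lambda>x. x * y x"] rest using lt by simp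
    then obtain w where w: "set w \<subseteq> {1..<n}" "word_perm n w = ?z"
      using less.hyps[OF _ z] by blast
    have "sort_right i ?z = y"
      using lt by (simp add: sort_right_def comp_assoc)
    then have "word_perm n (w @ [i]) = y"
      by (simp add: word_perm_snoc w(2))
    then show ?thesis
      using w(1) i(1) by (intro exI[of _ "w @ [i]"]) auto
  qed
qed

section \<open>Counting classes\<close>

definition cycle_data :: "nat \<Rightarrow> (nat list \<times> nat multiset) set"
  where "cycle_data n = {(es, os). (\<forall>e\<in>set es. even e \<and> 0 < e) \<and> (\<forall>p\<in>#os. odd p) \<and>
    sum_list es + sum_mset os = n}"

definition data_list :: "nat list \<times> nat multiset \<Rightarrow> nat list"
  where "data_list c = fst c @ rev (sorted_list_of_multiset (snd c))"

lemma canonical_odds: "\<forall>p\<in>set ps. odd p \<Longrightarrow> sorted (rev ps) \<Longrightarrow> canonical ps"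
proof (induction ps)
  case (Cons p ps)
  then show ?case
    using odd_pos[of p] by (auto simp: sorted_append)
qed simp

lemma data_list:
  assumes "c \<in> cycle_data n"
  shows "canonical (data_list c)" "sum_list (data_list c) = n"
    "filter even (data_list c) = fst c" "mset (filter odd (data_list c)) = snd c"
proof -
  let ?os = "rev (sorted_list_of_multiset (snd c))"
  have c: "\<forall>e\<in>set (fst c). even e \<and> 0 < e" "\<forall>p\<in>set ?os. odd p" "sum_list (fst c) + sum_mset (snd c) = n"
    using assms by (auto simp: cycle_data_def)
  have os: "mset ?os = snd c"
    by simp
  have "canonical ?os"
    by (rule canonical_odds[OF c(2)]) simp
  then have "canonical (es @ ?os)" if "\<forall>e\<in>set es. even e \<and> 0 < e" for es
    using that by (induction es) auto
  with c(1) show "canonical (data_list c)"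
    by (simp add: data_list_def)
  have "sum_list ?os = sum_mset (snd c)"
    by (metis os sum_mset_sum_list)
  then show "sum_list (data_list c) = n"
    using c(3) by (simp add: data_list_def)
  have "filter even (fst c) = fst c" "filter even ?os = []" "filter odd (fst c) = []" "filter odd ?os = ?os"
    unfolding filter_empty_conv using c by (auto simp only: intro!: filter_True)
  then show "filter even (data_list c) = fst c" "mset (filter odd (data_list c)) = snd c"
    using os by (simp_all only: data_list_def filter_append append_Nil append_Nil2)
qed

lemma data_list_surj:
  assumes "canonical ps" "sum_list ps = n"
  shows "\<exists>c\<in>cycle_data n. data_list c = ps"
proof
  let ?c = "(filter even ps, mset (filter odd ps))"
  have ps: "ps = filter even ps @ filter odd ps"
    by (rule canonical_evens_odds[OF assms(1)])
  have sum: "sum_list (filter even ps) + sum_list (filter odd ps) = n"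
    using assms(2) ps by (metis sum_list_append)
  have pos: "\<forall>e\<in>set (filter even ps). even e \<and> 0 < e"
  proof
    fix e
    assume "e \<in> set (filter even ps)"
    then have "e \<in> set ps" "even e"
      by simp_all
    then show "even e \<and> 0 < e"
      using canonical_zero[OF assms(1)] by (cases "e = 0") simp_all
  qed
  show "?c \<in> cycle_data n"
    unfolding cycle_data_def mem_Collect_eq case_prod_conv sum_mset_sum_list
    by (intro conjI pos sum) simp
  have "sorted (rev (filter odd ps))"
    using assms(1)
  proof (induction ps)
    case (Cons p ps)
    then show ?case
      by (auto simp: sorted_append)
  qed simp
  then have "sorted_list_of_multiset (mset (filter odd ps)) = rev (filter odd ps)"
    unfolding sorted_list_of_multiset_mset by (intro properties_for_sort) auto
  then show "data_list ?c = ps"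
    using ps by (simp add: data_list_def)
qed

definition sort_rel :: "nat \<Rightarrow> ((nat \<Rightarrow> nat) \<times> (nat \<Rightarrow> nat)) set"
  where "sort_rel n = {(x, y). sort_equiv n x y}"

abbreviation perms :: "nat \<Rightarrow> (nat \<Rightarrow> nat) set"
  where "perms n \<equiv> {y. y permutes {1..n}}"

lemma equiv_sort_rel: "equiv (perms n) (sort_rel n)"
proof (rule equivI)
  show "sort_rel n \<subseteq> perms n \<times> perms n"
    using sort_equiv_permutes by (auto simp: sort_rel_def)
qed (auto simp: sort_rel_def refl_on_def sym_def trans_def
    intro: sort_equiv.refl sort_equiv.sym sort_equiv.trans)

text \<open>Two families indexed by the same data are compared only by counting: nested cycles lie
  in distinct classes, canonical words meet every class. The injection also yields finiteness of
  \<open>cycle_data n\<close>.\<close>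

theorem card_sort_classes: "card (perms n // sort_rel n) = card (cycle_data n)"
proof -
  have fin: "finite (perms n // sort_rel n)"
    by (rule finite_quotient)
      (auto simp: finite_permutations sort_rel_def simp del: One_nat_def dest: sort_equiv_permutes)
  define y where "y c = (SOME y. realizes n y (data_list c))" for c
  have y: "realizes n (y c) (data_list c)" if "c \<in> cycle_data n" for c
    unfolding y_def using realizes_exists[OF data_list(2)[OF that]] by (rule someI_ex)
  have perm: "y c \<in> perms n" if "c \<in> cycle_data n" for c
    using y[OF that] by (simp add: realizes_def)
  define g where "g c = sort_rel n `` {y c}" for c
  have "inj_on g (cycle_data n)"
  proof (rule inj_onI)
    fix c d
    assume c: "c \<in> cycle_data n" and d: "d \<in> cycle_data n" and "g c = g d"
    then have "sort_equiv n (y c) (y d)"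
      using eq_equiv_class[OF _ equiv_sort_rel perm[OF d], of "y c"] by (simp add: g_def sort_rel_def)
    from realizes_sort_equiv_inject[OF y[OF c] data_list(1)[OF c] y[OF d] data_list(1)[OF d] this]
    show "c = d"
      using data_list(3,4)[OF c] data_list(3,4)[OF d] by (simp add: prod_eq_iff)
  qed
  moreover have "g ` cycle_data n \<subseteq> perms n // sort_rel n"
    using perm by (auto simp: g_def intro: quotientI)
  ultimately have le: "card (cycle_data n) \<le> card (perms n // sort_rel n)" and fin': "finite (cycle_data n)"
    using fin by (auto intro: card_inj_on_le inj_on_finite)
  define h where "h c = sort_rel n `` {word_perm n (canonical_word (data_list c))}" for c
  have "perms n // sort_rel n \<subseteq> h ` cycle_data n"
  proof
    fix X
    assume "X \<in> perms n // sort_rel n"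
    then obtain x where x: "x permutes {1..n}" "X = sort_rel n `` {x}"
      by (auto elim: quotientE)
    obtain w where w: "set w \<subseteq> {1..<n}" "word_perm n w = x"
      using word_perm_surj[OF x(1)] by blast
    obtain ps where ps: "canonical ps" "sum_list ps = n" "twisted_conj n w (canonical_word ps)"
      using twisted_conj_canonical_word[OF w(1)] by blast
    obtain c where c: "c \<in> cycle_data n" "data_list c = ps"
      using data_list_surj[OF ps(1,2)] by blast
    have "(x, word_perm n (canonical_word ps)) \<in> sort_rel n"
      using twisted_conj_sort_equiv[OF ps(3) w(1)] w(2) by (simp add: sort_rel_def)
    then have "X = h c"
      using equiv_class_eq[OF equiv_sort_rel] x(2) c(2) by (simp add: h_def)
    then show "X \<in> h ` cycle_data n"
      using c(1) by blast
  qed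
  then have "card (perms n // sort_rel n) \<le> card (cycle_data n)"
    by (rule surj_card_le[OF fin'])
  with le show ?thesis
    by simp
qed

text \<open>A partition carries all of the data except the order of the even parts, and that order
  is a permutation of the multiset of even parts.\<close>

lemma cycle_data_Sigma:
  "bij_betw (\<lambda>(l, es). (es, filter_mset odd l))
    (SIGMA l:partitions n. permutations_of_multiset (filter_mset even l)) (cycle_data n)"
proof (rule bij_betwI[where g = "\<lambda>(es, os). (mset es + os, es)"])
  show "(\<lambda>(l, es). (es, filter_mset odd l)) \<in>
      (SIGMA l:partitions n. permutations_of_multiset (filter_mset even l)) \<rightarrow> cycle_data n"
  proof
    fix x
    assume "x \<in> (SIGMA l:partitions n. permutations_of_multiset (filter_mset even l))"
    then obtain l es where x: "x = (l, es)" "l \<in> partitions n" "mset es = filter_mset even l"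
      by (auto simp: permutations_of_multiset_def)
    have "sum_mset l = sum_mset (filter_mset even l) + sum_mset (filter_mset odd l)"
      using multiset_partition[of l even] by (metis sum_mset.union)
    then have "sum_list es + sum_mset (filter_mset odd l) = n"
      using x by (metis (mono_tags, lifting) mem_Collect_eq partitions_def sum_mset_sum_list)
    moreover have "even e \<and> 0 < e" if "e \<in> set es" for e
    proof -
      have "e \<in># filter_mset even l"
        using that x(3) by (metis set_mset_mset)
      then show ?thesis
        using x(2) by (auto simp: partitions_def intro: gr0I)
    qed
    ultimately show "(case x of (l, es) \<Rightarrow> (es, filter_mset odd l)) \<in> cycle_data n"
      by (auto simp: cycle_data_def x(1))
  qed
  have filt: "filter_mset even (mset es + os) = mset es" "filter_mset odd (mset es + os) = os"
    if "(es, os) \<in> cycle_data n" for es os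
  proof -
    have "filter_mset even (mset es) = mset es" "filter_mset even os = {#}"
      "filter_mset odd (mset es) = {#}" "filter_mset odd os = os"
      using that by (auto simp: cycle_data_def filter_mset_eq_conv filter_mset_False)
    then show "filter_mset even (mset es + os) = mset es" "filter_mset odd (mset es + os) = os"
      by simp_all
  qed
  show "(\<lambda>(es, os). (mset es + os, es)) \<in>
      cycle_data n \<rightarrow> (SIGMA l:partitions n. permutations_of_multiset (filter_mset even l))"
  proof
    fix x
    assume x: "x \<in> cycle_data n"
    obtain es os where eo: "x = (es, os)"
      by fastforce
    have "0 \<notin># os"
      using x eo by (auto simp: cycle_data_def)
    then have "mset es + os \<in> partitions n"
      using x eo by (auto simp: cycle_data_def partitions_def sum_mset_sum_list)
    then show "(case x of (es, os) \<Rightarrow> (mset es + os, es)) \<in>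
        (SIGMA l:partitions n. permutations_of_multiset (filter_mset even l))"
      using filt(1)[of es os] x eo by (simp add: permutations_of_multiset_def)
  qed
  show "(case case x of (l, es) \<Rightarrow> (es, filter_mset odd l) of (es, os) \<Rightarrow> (mset es + os, es)) = x"
    if "x \<in> (SIGMA l:partitions n. permutations_of_multiset (filter_mset even l))" for x
    using that by (auto simp: permutations_of_multiset_def multiset_partition[symmetric])
  show "(case case x of (es, os) \<Rightarrow> (mset es + os, es) of (l, es) \<Rightarrow> (es, filter_mset odd l)) = x"
    if "x \<in> cycle_data n" for x
    using that filt(2) by (auto split: prod.splits)
qed

lemma card_even_arrangements:
  assumes "0 \<notin># l"
  shows "(of_nat (card (permutations_of_multiset (filter_mset even l))) :: rat) =
    fact (num_even_parts l) / of_nat (even_mult_fact l)"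
proof -
  let ?A = "filter_mset even l"
  have "(\<Prod>x\<in>set_mset ?A. fact (count ?A x) :: nat) = even_mult_fact l"
    unfolding even_mult_fact_def
  proof (rule prod.reindex_bij_witness[where i = "\<lambda>j. 2 * j" and j = "\<lambda>x. x div 2"])
    fix x
    assume x: "x \<in> set_mset ?A"
    then show "2 * (x div 2) = x"
      by auto
    have "x \<in># l"
      using x by simp
    then have "x \<noteq> 0"
      using assms by metis
    with x show "x div 2 \<in> {j. 1 \<le> j \<and> 2 * j \<in># l}"
      by (auto elim!: evenE)
    show "fact (count l (2 * (x div 2))) = fact (count ?A x)"
      using x by auto
  qed auto
  then have "card (permutations_of_multiset ?A) * even_mult_fact l = fact (num_even_parts l)"
    using card_permutations_of_multiset_aux[of ?A] by (simp add: num_even_parts_def)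
  then have "(of_nat (card (permutations_of_multiset ?A)) :: rat) * of_nat (even_mult_fact l) =
      fact (num_even_parts l)"
    by (metis of_nat_fact of_nat_mult)
  moreover have "even_mult_fact l \<noteq> 0"
    unfolding even_mult_fact_def by (cases "finite {j. 1 \<le> j \<and> 2 * j \<in># l}") auto
  ultimately show ?thesis
    by (simp add: eq_divide_eq)
qed

theorem of_nat_card_sort_classes:
  "(of_nat (card (perms n // sort_rel n)) :: rat) =
    (\<Sum>l\<in>partitions n. fact (num_even_parts l) / of_nat (even_mult_fact l))"
proof -
  have "card (cycle_data n) = card (SIGMA l:partitions n. permutations_of_multiset (filter_mset even l))"
    using bij_betw_same_card[OF cycle_data_Sigma] by simp
  also have "\<dots> = (\<Sum>l\<in>partitions n. card (permutations_of_multiset (filter_mset even l)))"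
    by (rule card_SigmaI) (auto simp: finite_partitions)
  finally show ?thesis
    unfolding card_sort_classes
    by (auto simp: card_even_arrangements partitions_def intro!: sum.cong)
qed

section \<open>The ideal of relations\<close>

text \<open>Products of coset representatives. Each level offers \<open>Suc m\<close> runs, the
  empty one at \<open>j = Suc m\<close> included, so the total is at most n!.\<close>

fun normal_forms :: "nat \<Rightarrow> nat list set"
where
  "normal_forms 0 = {[]}"
| "normal_forms (Suc m) = (\<lambda>(b, j). b @ down m j) ` (normal_forms m \<times> {1..Suc m})"

lemma normal_forms:
  "finite (normal_forms n)" "card (normal_forms n) \<le> fact n" "v \<in> normal_forms n \<Longrightarrow> set v \<subseteq> {1..<n}"
proof (induction n arbitrary: v)
  case (Suc m)
  {
    case 1
    then show ?case
      using Suc by simp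
  next
    case 2
    have "card (normal_forms (Suc m)) \<le> card (normal_forms m \<times> {1..Suc m})"
      unfolding normal_forms.simps by (rule card_image_le) (use Suc(1) in simp)
    also have "\<dots> \<le> fact (Suc m)"
      using mult_le_mono[OF Suc(2) order.refl[of "Suc m"]]
      by (simp add: card_cartesian_product mult.commute)
    finally show ?case .
  next
    case 3
    then show ?case
      using Suc(3) by fastforce
  }
qed auto

lemma hecke_eq_normal_form:
  assumes "set w \<subseteq> {1..<n}"
  shows "\<exists>v\<in>normal_forms n. w \<approx> v"
  using assms
proof (induction n arbitrary: w)
  case (Suc m)
  have "set w \<subseteq> {1..m}"
    using Suc.prems by auto
  then obtain b j where b: "1 \<le> j" "j \<le> Suc m" "set b \<subseteq> {1..<m}" "w \<approx> b @ down m j"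
    using hecke_coset_form[of w 1 m] by auto
  obtain v where v: "v \<in> normal_forms m" "b \<approx> v"
    using Suc.IH[OF b(3)] by blast
  have "w \<approx> v @ down m j"
    using b(4) hecke_eq_appendL[OF v(2)] by (rule hecke_eq.trans)
  then show ?case
    using b(1,2) v(1) by force
qed auto

text \<open>At most n! normal forms map onto n! permutations, so \<open>word_perm\<close> is
  injective on them. This identifies the monoid of words with the permutations.\<close>

theorem word_perm_eq_imp_hecke_eq:
  assumes "set v \<subseteq> {1..<n}" "set w \<subseteq> {1..<n}" "word_perm n v = word_perm n w"
  shows "v \<approx> w"
proof -
  have "word_perm n ` normal_forms n = perms n"
  proof
    show "word_perm n ` normal_forms n \<subseteq> perms n"
      using word_perm_permutes normal_forms(3) by blast
    show "perms n \<subseteq> word_perm n ` normal_forms n"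
    proof
      fix y
      assume "y \<in> perms n"
      then obtain w where w: "set w \<subseteq> {1..<n}" "word_perm n w = y"
        using word_perm_surj by auto
      then obtain v where "v \<in> normal_forms n" "w \<approx> v"
        using hecke_eq_normal_form by blast
      then show "y \<in> word_perm n ` normal_forms n"
        using hecke_eq_word_perm w(2) by blast
    qed
  qed
  then have "card (normal_forms n) \<le> card (word_perm n ` normal_forms n)"
    using normal_forms(2)[of n] card_permutations[of "{1..n}" n] by simp
  then have inj: "inj_on (word_perm n) (normal_forms n)"
    using normal_forms(1) by (intro eq_card_imp_inj_on antisym card_image_le) auto
  obtain v' w' where v': "v' \<in> normal_forms n" "v \<approx> v'" and w': "w' \<in> normal_forms n" "w \<approx> w'"
    using hecke_eq_normal_form assms(1,2) by meson
  have "v' = w'"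
    using inj_onD[OF inj _ v'(1) w'(1)] hecke_eq_word_perm[OF v'(2)] hecke_eq_word_perm[OF w'(2)] assms(3)
    by simp
  then show ?thesis
    using v'(2) w'(2) by (blast intro: hecke_eq.sym hecke_eq.trans)
qed

section \<open>Linear functionals and the basis theorem\<close>

abbreviation word_monomial :: "nat list \<Rightarrow> 'k \<Rightarrow> word \<Rightarrow>\<^sub>0 'k::field"
  where "word_monomial w c \<equiv> Poly_Mapping.single (Word w) c"

text \<open>The linear extension to the free algebra of a function on words.\<close>

definition pairing :: "(nat list \<Rightarrow> 'k) \<Rightarrow> (word \<Rightarrow>\<^sub>0 'k::field) \<Rightarrow> 'k"
  where "pairing g p = (\<Sum>w\<in>Poly_Mapping.keys p. Poly_Mapping.lookup p w * g (letters w))"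

lemma pairing_superset:
  assumes "finite S" "Poly_Mapping.keys p \<subseteq> S"
  shows "pairing g p = (\<Sum>w\<in>S. Poly_Mapping.lookup p w * g (letters w))"
  unfolding pairing_def by (rule sum.mono_neutral_left) (use assms in \<open>auto simp: in_keys_iff\<close>)

lemma pairing_zero [simp]: "pairing g 0 = 0"
  by (simp add: pairing_def)

lemma pairing_add: "pairing g (p + q) = pairing g p + pairing g q"
proof -
  let ?S = "Poly_Mapping.keys p \<union> Poly_Mapping.keys q"
  have "Poly_Mapping.keys (p + q) \<subseteq> ?S"
    by (rule Poly_Mapping.keys_add)
  then show ?thesis
    by (simp add: pairing_superset[of ?S] lookup_add distrib_right sum.distrib)
qed

lemma pairing_single [simp]: "pairing g (Poly_Mapping.single w c) = c * g (letters w)"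
  by (cases "c = 0") (simp_all add: pairing_def)

lemma pairing_diff: "pairing g (p - q) = pairing g p - pairing g q"
  using pairing_add[of g "p - q" q] by simp

lemma pairing_sum: "pairing g (\<Sum>x\<in>A. f x) = (\<Sum>x\<in>A. pairing g (f x))"
  by (induction A rule: infinite_finite_induct) (auto simp: pairing_add)

lemma sum_monomials: "(\<Sum>w\<in>Poly_Mapping.keys p. Poly_Mapping.single w (Poly_Mapping.lookup p w)) = p"
proof (rule poly_mapping_eqI)
  fix v
  show "Poly_Mapping.lookup (\<Sum>w\<in>Poly_Mapping.keys p. Poly_Mapping.single w (Poly_Mapping.lookup p w)) v =
      Poly_Mapping.lookup p v"
    by (simp add: lookup_sum lookup_single when_def in_keys_iff)
qed

lemma pairing_mult_left:
  "pairing g (p * q) = (\<Sum>u\<in>Poly_Mapping.keys p. Poly_Mapping.lookup p u * pairing (\<lambda>v. g (letters u @ v)) q)"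
proof -
  have *: "p * q = (\<Sum>u\<in>Poly_Mapping.keys p. \<Sum>v\<in>Poly_Mapping.keys q.
      Poly_Mapping.single (u + v) (Poly_Mapping.lookup p u * Poly_Mapping.lookup q v))"
    by (subst (1 2) sum_monomials[symmetric]) (simp add: sum_product mult_single)
  have "pairing g (p * q) = (\<Sum>u\<in>Poly_Mapping.keys p. \<Sum>v\<in>Poly_Mapping.keys q.
      Poly_Mapping.lookup p u * Poly_Mapping.lookup q v * g (letters (u + v)))"
    unfolding arg_cong[OF *, of "pairing g"] pairing_sum pairing_single ..
  also have "\<dots> = (\<Sum>u\<in>Poly_Mapping.keys p. Poly_Mapping.lookup p u * pairing (\<lambda>v. g (letters u @ v)) q)"
    unfolding pairing_def sum_distrib_left by (simp add: plus_word_def mult.assoc)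
  finally show ?thesis .
qed

lemma pairing_mult_right:
  "pairing g (p * q) = (\<Sum>v\<in>Poly_Mapping.keys q. Poly_Mapping.lookup q v * pairing (\<lambda>u. g (u @ letters v)) p)"
proof -
  have "pairing g (p * q) = (\<Sum>u\<in>Poly_Mapping.keys p. \<Sum>v\<in>Poly_Mapping.keys q.
      Poly_Mapping.lookup q v * (Poly_Mapping.lookup p u * g (letters u @ letters v)))"
    unfolding pairing_mult_left unfolding pairing_def by (simp add: sum_distrib_left mult_ac)
  also have "\<dots> = (\<Sum>v\<in>Poly_Mapping.keys q. Poly_Mapping.lookup q v * pairing (\<lambda>u. g (u @ letters v)) p)"
    unfolding pairing_def sum_distrib_left by (rule sum.swap)
  finally show ?thesis .
qed

lemma free_algebra_simps [simp]:
  "mult (free_algebra K n) = (*)" "add (free_algebra K n) = (+)"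
  "one (free_algebra K n) = 1" "zero (free_algebra K n) = 0"
  by (simp_all add: free_algebra_def)

lemma in_free_algebra:
  "p \<in> carrier (free_algebra K n) \<longleftrightarrow> (\<forall>w\<in>Poly_Mapping.keys p. set (letters w) \<subseteq> {1..<n})"
  by (simp add: free_algebra_def)

lemma word_monomial_in_free_algebra: "set w \<subseteq> {1..<n} \<Longrightarrow> word_monomial w c \<in> carrier (free_algebra K n)"
  by (simp add: in_free_algebra)

lemma sum_in_free_algebra:
  "(\<And>x. x \<in> A \<Longrightarrow> f x \<in> carrier (free_algebra K n)) \<Longrightarrow> (\<Sum>x\<in>A. f x) \<in> carrier (free_algebra K n)"
proof (induction A rule: infinite_finite_induct)
  case (insert x A)
  interpret ring "free_algebra K n"
    by (rule ring_free_algebra)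
  show ?case
    using insert a_closed[of "f x" "\<Sum>x\<in>A. f x"] by simp
qed (auto simp: in_free_algebra)

lemma hecke_ideal_add:
  "p \<in> hecke_ideal K n \<Longrightarrow> q \<in> hecke_ideal K n \<Longrightarrow> p + q \<in> hecke_ideal K n"
  using additive_subgroup.a_closed[OF ideal.axioms(1)[OF ideal_hecke_ideal], of p K n q] by simp

lemma hecke_ideal_mult:
  assumes "p \<in> hecke_ideal K n" "q \<in> carrier (free_algebra K n)"
  shows "q * p \<in> hecke_ideal K n" "p * q \<in> hecke_ideal K n"
  using ideal.I_l_closed[OF ideal_hecke_ideal assms] ideal.I_r_closed[OF ideal_hecke_ideal assms]
  by simp_all

lemma hecke_ideal_zero: "0 \<in> hecke_ideal K n"
  using additive_subgroup.zero_closed[OF ideal.axioms(1)[OF ideal_hecke_ideal], of K n] by simp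

lemma hecke_ideal_uminus:
  assumes "p \<in> hecke_ideal K n"
  shows "- p \<in> hecke_ideal K n"
proof -
  have "scalar (- 1) * p = - p"
    by (simp add: scalar_def single_uminus)
  then show ?thesis
    using hecke_ideal_mult(1)[OF assms scalar_in_free_algebra[of "- 1" K n]] by simp
qed

lemma hecke_ideal_sum:
  "(\<And>x. x \<in> A \<Longrightarrow> f x \<in> hecke_ideal K n) \<Longrightarrow> (\<Sum>x\<in>A. f x) \<in> hecke_ideal K n"
  by (induction A rule: infinite_finite_induct) (auto simp: hecke_ideal_zero hecke_ideal_add)

lemma minus_free_algebra:
  assumes "p \<in> carrier (free_algebra K n)" "q \<in> carrier (free_algebra K n)"
  shows "p \<ominus>\<^bsub>free_algebra K n\<^esub> q = p - q"
proof -
  interpret ring "free_algebra K n"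
    by (rule ring_free_algebra)
  have "\<ominus>\<^bsub>free_algebra K n\<^esub> q = - q"
    by (rule minus_equality) (use assms in \<open>auto simp: in_free_algebra\<close>)
  then show ?thesis
    by (simp add: a_minus_def)
qed

lemma hecke_ideal_subset: "hecke_ideal K n \<subseteq> carrier (free_algebra K n)"
  using additive_subgroup.a_subset[OF ideal.axioms(1)[OF ideal_hecke_ideal]] .

text \<open>Functions constant on Hecke classes are closed under translation by words on either
  side, so the elements killed by all of them form a two-sided ideal. The argument treats all such
  functions simultaneously, and this ideal contains the relators.\<close>

lemma pairing_hecke_ideal:
  assumes p: "p \<in> hecke_ideal (K :: 'k::field itself) n" and g: "\<And>v w. v \<approx> w \<Longrightarrow> g v = g w"
  shows "pairing g p = 0"
proof -
  interpret ring "free_algebra K n"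
    by (rule ring_free_algebra)
  define G where "G = {g :: nat list \<Rightarrow> 'k. \<forall>v w. v \<approx> w \<longrightarrow> g v = g w}"
  define J where "J = {p \<in> carrier (free_algebra K n). \<forall>g\<in>G. pairing g p = 0}"
  have transl: "(\<lambda>v. g (u @ v)) \<in> G" "(\<lambda>v. g (v @ u)) \<in> G" if "g \<in> G" for g u
    using that by (auto simp: G_def intro: hecke_eq_appendL hecke_eq_appendR)
  have "ideal J (free_algebra K n)"
  proof (rule idealI[OF ring_free_algebra])
    show "subgroup J (add_monoid (free_algebra K n))"
    proof (rule group.subgroupI[OF a_group])
      show "J \<subseteq> carrier (add_monoid (free_algebra K n))"
        by (auto simp: J_def)
      show "J \<noteq> {}"
        by (auto simp: J_def in_free_algebra intro!: exI[of _ 0])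
    next
      fix a
      assume a: "a \<in> J"
      then have "\<ominus>\<^bsub>free_algebra K n\<^esub> a = - a"
        by (intro minus_equality) (auto simp: J_def in_free_algebra)
      moreover have "pairing g (- a) = 0" if "g \<in> G" for g
        using a that pairing_diff[of g 0 a] by (simp add: J_def)
      ultimately show "m_inv (add_monoid (free_algebra K n)) a \<in> J"
        unfolding a_inv_def[symmetric] using a by (simp add: J_def in_free_algebra)
    next
      fix a b
      assume "a \<in> J" "b \<in> J"
      then show "a \<otimes>\<^bsub>add_monoid (free_algebra K n)\<^esub> b \<in> J"
        using a_closed[of a b] by (simp add: J_def pairing_add)
    qed
  next
    fix a x
    assume a: "a \<in> J" and x: "x \<in> carrier (free_algebra K n)"
    have "pairing g (x * a) = 0" "pairing g (a * x) = 0" if "g \<in> G" for g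
      using a transl[OF that] unfolding pairing_mult_left[of g x a] pairing_mult_right[of g a x]
      by (simp_all add: J_def)
    then show "x \<otimes>\<^bsub>free_algebra K n\<^esub> a \<in> J" "a \<otimes>\<^bsub>free_algebra K n\<^esub> x \<in> J"
      using a x m_closed[of a x] m_closed[of x a] by (simp_all add: J_def)
  qed
  moreover have "hecke_relators n \<subseteq> J"
  proof
    fix x :: "word \<Rightarrow>\<^sub>0 'k"
    assume x: "x \<in> hecke_relators n"
    have rel: "g l = g r" if "hecke_rel l r" "g \<in> G" for l r g
      using hecke_eq.rel[OF that(1), of "[]" "[]"] that(2) by (simp add: G_def)
    have "pairing g x = 0" if "g \<in> G" for g
    proof -
      have comm: "g [i, j] = g [j, i]" if "1 < \<bar>int i - int j\<bar>" for i j
        using that by (intro rel[OF hecke_rel.comm \<open>g \<in> G\<close>]) linarith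
      show ?thesis
        using x rel[OF hecke_rel.braid that] rel[OF hecke_rel.idem that] comm
        by (auto simp: hecke_relators_def gen_def mult_single plus_word_def pairing_diff)
    qed
    then show "x \<in> J"
      using x hecke_relators_subset[of n K] by (auto simp: J_def)
  qed
  ultimately have "hecke_ideal K n \<subseteq> J"
    unfolding hecke_ideal_def by (rule genideal_minimal)
  then show ?thesis
    using p g by (auto simp: J_def G_def)
qed

lemma hecke_rel_ideal:
  assumes "hecke_rel l r" "set l \<subseteq> {1..<n}"
  shows "word_monomial l 1 - word_monomial r 1 \<in> hecke_ideal (K :: 'k::field itself) n"
proof -
  interpret ring "free_algebra K n"
    by (rule ring_free_algebra)
  have relators: "x \<in> hecke_ideal K n" if "x \<in> hecke_relators n" for x
    using genideal_self[OF hecke_relators_subset[of n K]] that by (auto simp: hecke_ideal_def)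
  show ?thesis
    using assms
  proof (induction rule: hecke_rel.induct)
    case (idem i)
    then have "gen i * gen i - gen i \<in> hecke_ideal K n"
      by (intro relators) (auto simp: hecke_relators_def)
    then show ?case
      by (simp add: gen_def mult_single plus_word_def)
  next
    case (comm i j)
    then have "i \<in> {1..<n} \<and> j \<in> {1..<n} \<and> \<bar>int i - int j\<bar> > 1"
      by auto
    then have "gen i * gen j - gen j * gen i \<in> hecke_ideal K n"
      unfolding hecke_relators_def by (intro relators[unfolded hecke_relators_def]) blast
    then show ?case
      by (simp add: gen_def mult_single plus_word_def)
  next
    case (braid i)
    then have "gen i * gen (i + 1) * gen i - gen (i + 1) * gen i * gen (i + 1) \<in> hecke_ideal K n"
      by (intro relators) (auto simp: hecke_relators_def)
    then show ?case
      by (simp add: gen_def mult_single plus_word_def)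
  qed
qed

lemma hecke_eq_ideal:
  "v \<approx> w \<Longrightarrow> set v \<subseteq> {1..<n} \<Longrightarrow> word_monomial v c - word_monomial w c \<in> hecke_ideal (K :: 'k::field itself) n"
proof (induction rule: hecke_eq.induct)
  case (rel l r u v)
  have "word_monomial (u @ l @ v) c - word_monomial (u @ r @ v) c = word_monomial u c * (word_monomial l 1 - word_monomial r 1) * word_monomial v 1"
    by (simp add: mult_single plus_word_def algebra_simps)
  moreover have "word_monomial u c * (word_monomial l 1 - word_monomial r 1) * word_monomial v 1 \<in> hecke_ideal K n"
    using rel by (intro hecke_ideal_mult hecke_rel_ideal word_monomial_in_free_algebra) auto
  ultimately show ?case
    by (simp only:)
next
  case (refl w)
  then show ?case
    by (simp add: hecke_ideal_zero)
next
  case (sym v w)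
  then show ?case
    using hecke_ideal_uminus[of "word_monomial v c - word_monomial w c" K n] hecke_eq_set[of v w] by simp
next
  case (trans u v w)
  then show ?case
    using hecke_ideal_add[of "word_monomial u c - word_monomial v c" K n "word_monomial v c - word_monomial w c"] hecke_eq_set[of u v]
    by simp
qed

text \<open>The coefficient of T_w in the image of \<open>p\<close>, where \<open>y\<close> is w0
  w.\<close>

definition coef :: "nat \<Rightarrow> (word \<Rightarrow>\<^sub>0 'k::field) \<Rightarrow> (nat \<Rightarrow> nat) \<Rightarrow> 'k"
  where "coef n p y = pairing (\<lambda>w. of_bool (word_perm n w = y)) p"

lemma pairing_word_perm:
  assumes "p \<in> carrier (free_algebra K n)"
  shows "pairing (\<lambda>w. h (word_perm n w)) p = (\<Sum>y\<in>perms n. coef n p y * h y)"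
proof -
  have "(\<Sum>y\<in>perms n. coef n p y * h y) = (\<Sum>w\<in>Poly_Mapping.keys p. \<Sum>y\<in>perms n.
      Poly_Mapping.lookup p w * (of_bool (word_perm n (letters w) = y) * h y))"
    unfolding coef_def pairing_def sum_distrib_right mult.assoc by (rule sum.swap)
  also have "\<dots> = pairing (\<lambda>w. h (word_perm n w)) p"
    unfolding pairing_def
  proof (rule sum.cong[OF HOL.refl])
    fix w
    assume "w \<in> Poly_Mapping.keys p"
    then have "word_perm n (letters w) \<in> perms n"
      using assms word_perm_permutes[of "letters w" n] by (auto simp: in_free_algebra)
    then show "(\<Sum>y\<in>perms n. Poly_Mapping.lookup p w * (of_bool (word_perm n (letters w) = y) * h y)) =
        Poly_Mapping.lookup p w * h (word_perm n (letters w))"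
      by (simp add: sum_distrib_left[symmetric] of_bool_def if_distrib[of "\<lambda>x. x * _"] finite_permutations
          cong: if_cong)
  qed
  finally show ?thesis
    by simp
qed

text \<open>The basis theorem. Modulo the ideal each monomial becomes the chosen word of its
  permutation, and after collecting terms the coefficient of a chosen word is a value of
  \<open>coef\<close>. The other direction is \<open>pairing_hecke_ideal\<close>.\<close>

theorem hecke_ideal_iff:
  "p \<in> hecke_ideal (K :: 'k::field itself) n \<longleftrightarrow>
    p \<in> carrier (free_algebra K n) \<and> (\<forall>y\<in>perms n. coef n p y = 0)"
proof
  assume "p \<in> hecke_ideal K n"
  then show "p \<in> carrier (free_algebra K n) \<and> (\<forall>y\<in>perms n. coef n p y = 0)"
    using hecke_ideal_subset pairing_hecke_ideal[of p K n] hecke_eq_word_perm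
    by (fastforce simp: coef_def)
next
  assume p: "p \<in> carrier (free_algebra K n) \<and> (\<forall>y\<in>perms n. coef n p y = 0)"
  define rep where "rep y = (SOME w. set w \<subseteq> {1..<n} \<and> word_perm n w = y)" for y
  have rep: "set (rep y) \<subseteq> {1..<n} \<and> word_perm n (rep y) = y" if "y permutes {1..n}" for y
    unfolding rep_def using word_perm_surj[OF that] by (rule someI_ex)
  let ?r = "\<lambda>w. rep (word_perm n (letters w))"
  have "Poly_Mapping.single w c - word_monomial (?r w) c \<in> hecke_ideal K n" if "w \<in> Poly_Mapping.keys p" for w c
  proof -
    have w: "set (letters w) \<subseteq> {1..<n}"
      using p that by (simp add: in_free_algebra)
    then have "letters w \<approx> ?r w"
      using rep[OF word_perm_permutes[OF w]] by (intro word_perm_eq_imp_hecke_eq) auto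
    from hecke_eq_ideal[OF this w] show ?thesis
      by simp
  qed
  then have "(\<Sum>w\<in>Poly_Mapping.keys p. Poly_Mapping.single w (Poly_Mapping.lookup p w) -
      word_monomial (?r w) (Poly_Mapping.lookup p w)) \<in> hecke_ideal K n"
    by (intro hecke_ideal_sum)
  then have "p - (\<Sum>w\<in>Poly_Mapping.keys p. word_monomial (?r w) (Poly_Mapping.lookup p w)) \<in> hecke_ideal K n"
    by (simp add: sum_subtractf sum_monomials)
  moreover have "(\<Sum>w\<in>Poly_Mapping.keys p. word_monomial (?r w) (Poly_Mapping.lookup p w)) = 0"
  proof (rule poly_mapping_eqI)
    fix v
    have "Poly_Mapping.lookup (\<Sum>w\<in>Poly_Mapping.keys p. word_monomial (?r w) (Poly_Mapping.lookup p w)) v =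
        pairing (\<lambda>w. of_bool (Word (rep (word_perm n w)) = v)) p"
      unfolding lookup_sum lookup_single pairing_def by (intro sum.cong) (auto simp: when_def)
    also have "\<dots> = (\<Sum>y\<in>perms n. coef n p y * of_bool (Word (rep y) = v))"
      using p by (intro pairing_word_perm[of p K n "\<lambda>y. of_bool (Word (rep y) = v)"]) simp
    also have "\<dots> = 0"
      using p by (intro sum.neutral) simp
    finally show "Poly_Mapping.lookup (\<Sum>w\<in>Poly_Mapping.keys p. word_monomial (?r w) (Poly_Mapping.lookup p w)) v =
        Poly_Mapping.lookup 0 v"
      by simp
  qed
  ultimately show "p \<in> hecke_ideal K n"
    by simp
qed

section \<open>The center\<close>

abbreviation hecke_class :: "'k::field itself \<Rightarrow> nat \<Rightarrow> (word \<Rightarrow>\<^sub>0 'k) \<Rightarrow> (word \<Rightarrow>\<^sub>0 'k) set"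
  where "hecke_class K n p \<equiv> hecke_ideal K n +>\<^bsub>free_algebra K n\<^esub> p"

lemma coef_diff: "coef n (p - q) y = coef n p y - coef n q y"
  by (simp add: coef_def pairing_diff)

lemma coef_add: "coef n (p + q) y = coef n p y + coef n q y"
  by (simp add: coef_def pairing_add)

lemma free_algebra_closed:
  assumes "p \<in> carrier (free_algebra K n)" "q \<in> carrier (free_algebra K n)"
  shows "p + q \<in> carrier (free_algebra K n)" "p - q \<in> carrier (free_algebra K n)"
    "p * q \<in> carrier (free_algebra K n)"
proof -
  interpret ring "free_algebra K n"
    by (rule ring_free_algebra)
  show "p + q \<in> carrier (free_algebra K n)" "p - q \<in> carrier (free_algebra K n)"
    "p * q \<in> carrier (free_algebra K n)"
    using a_closed[OF assms] minus_closed[OF assms] m_closed[OF assms] minus_free_algebra[OF assms]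
    by simp_all
qed

lemma hecke_class_eq_iff:
  assumes "p \<in> carrier (free_algebra K n)" "q \<in> carrier (free_algebra K n)"
  shows "hecke_class K n p = hecke_class K n q \<longleftrightarrow> (\<forall>y\<in>perms n. coef n p y = coef n q y)"
proof -
  have "hecke_class K n p = hecke_class K n q \<longleftrightarrow> p - q \<in> hecke_ideal K n"
    using ring.quotient_eq_iff_same_a_r_cos[OF ring_free_algebra ideal_hecke_ideal assms]
    by (simp add: minus_free_algebra[OF assms])
  then show ?thesis
    using free_algebra_closed(2)[OF assms] by (simp add: hecke_ideal_iff coef_diff)
qed

lemma carrier_hecke_algebra:
  "carrier (hecke_algebra K n) = hecke_class K n ` carrier (free_algebra K n)"
  by (auto simp: hecke_algebra_def FactRing_def A_RCOSETS_def')

lemma hecke_class_hom: "hecke_class K n \<in> ring_hom (free_algebra K n) (hecke_algebra K n)"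
  unfolding hecke_algebra_def by (rule ideal.rcos_ring_hom[OF ideal_hecke_ideal])

lemma hecke_class_mult:
  assumes "p \<in> carrier (free_algebra K n)" "q \<in> carrier (free_algebra K n)"
  shows "hecke_class K n p \<otimes>\<^bsub>hecke_algebra K n\<^esub> hecke_class K n q = hecke_class K n (p * q)"
  using ring_hom_mult[OF hecke_class_hom assms] by simp

lemma hecke_class_add:
  assumes "p \<in> carrier (free_algebra K n)" "q \<in> carrier (free_algebra K n)"
  shows "hecke_class K n p \<oplus>\<^bsub>hecke_algebra K n\<^esub> hecke_class K n q = hecke_class K n (p + q)"
  using ring_hom_add[OF hecke_class_hom assms] by simp

lemma hecke_class_zero: "hecke_class K n 0 = \<zero>\<^bsub>hecke_algebra K n\<^esub>"
  using ring_hom_zero[OF hecke_class_hom ring_free_algebra ring_hecke_algebra] by simp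

lemma central_iff_commutes_gen:
  assumes p: "p \<in> carrier (free_algebra (K :: 'k::field itself) n)"
  shows "hecke_class K n p \<in> ring_center (hecke_algebra K n) \<longleftrightarrow>
    (\<forall>i\<in>{1..<n}. \<forall>y\<in>perms n. coef n (p * gen i) y = coef n (gen i * p) y)"
proof -
  have central: "hecke_class K n p \<in> ring_center (hecke_algebra K n) \<longleftrightarrow>
      (\<forall>q\<in>carrier (free_algebra K n). p * q - q * p \<in> hecke_ideal K n)"
  proof -
    have "hecke_class K n (p * q) = hecke_class K n (q * p) \<longleftrightarrow> p * q - q * p \<in> hecke_ideal K n"
      if "q \<in> carrier (free_algebra K n)" for q
    proof -
      note pq = free_algebra_closed(3)[OF p that] free_algebra_closed(3)[OF that p]
      show ?thesis
        using free_algebra_closed(2)[OF pq]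
        unfolding hecke_class_eq_iff[OF pq] by (simp add: hecke_ideal_iff coef_diff)
    qed
    then show ?thesis
      using p by (auto simp: ring_center_def carrier_hecke_algebra hecke_class_mult)
  qed
  have gens: "gen i \<in> carrier (free_algebra K n)" if "i \<in> {1..<n}" for i
    using that by (simp add: gen_def in_free_algebra)
  have "p * q - q * p \<in> hecke_ideal K n"
    if g: "\<forall>i\<in>{1..<n}. p * gen i - gen i * p \<in> hecke_ideal K n" and q: "q \<in> carrier (free_algebra K n)" for q
  proof -
    have w: "p * word_monomial w 1 - word_monomial w 1 * p \<in> hecke_ideal K n" if "set w \<subseteq> {1..<n}" for w
      using that
    proof (induction w)
      case Nil
      have "word_monomial [] (1 :: 'k) = 1"
        by (simp add: zero_word_def[symmetric])
      then show ?case
        by (simp add: hecke_ideal_zero)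
    next
      case (Cons i w)
      let ?m = "word_monomial w (1 :: 'k)"
      have eq: "word_monomial (i # w) 1 = gen i * ?m"
        by (simp add: gen_def mult_single plus_word_def)
      \<comment> \<open>The derivation rule for commutators: p(ab) - (ab)p = (pa - ap)b + a(pb -
        bp).\<close>
      have "(p * gen i - gen i * p) * ?m + gen i * (p * ?m - ?m * p) \<in> hecke_ideal K n"
        using Cons g gens by (intro hecke_ideal_add hecke_ideal_mult word_monomial_in_free_algebra) auto
      then show ?case
        unfolding eq by (simp add: algebra_simps)
    qed
    have "p * Poly_Mapping.single w c - Poly_Mapping.single w c * p \<in> hecke_ideal K n"
      if "set (letters w) \<subseteq> {1..<n}" for w c
    proof -
      have comm: "p * scalar c = scalar c * p"
        by (subst (1 2) sum_monomials[of p, symmetric])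
          (simp add: scalar_def sum_distrib_left sum_distrib_right mult_single mult.commute)
      have "Poly_Mapping.single w c = scalar c * word_monomial (letters w) 1"
        by (simp add: scalar_def mult_single)
      then have "p * Poly_Mapping.single w c - Poly_Mapping.single w c * p =
          scalar c * (p * word_monomial (letters w) 1 - word_monomial (letters w) 1 * p)"
        using comm by (simp add: algebra_simps) (metis mult.assoc)
      then show ?thesis
        using hecke_ideal_mult(1)[OF w[OF that] scalar_in_free_algebra[of c K n]] by simp
    qed
    then have "(\<Sum>w\<in>Poly_Mapping.keys q. p * Poly_Mapping.single w (Poly_Mapping.lookup q w) -
        Poly_Mapping.single w (Poly_Mapping.lookup q w) * p) \<in> hecke_ideal K n"
      using q by (intro hecke_ideal_sum) (simp add: in_free_algebra)
    then show ?thesis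
      by (simp add: sum_subtractf sum_distrib_left[symmetric] sum_distrib_right[symmetric] sum_monomials)
  qed
  moreover have "p * gen i - gen i * p \<in> hecke_ideal K n \<longleftrightarrow>
      (\<forall>y\<in>perms n. coef n (p * gen i) y = coef n (gen i * p) y)" if "i \<in> {1..<n}" for i
    using free_algebra_closed(2)[OF free_algebra_closed(3)[OF p gens[OF that]]
        free_algebra_closed(3)[OF gens[OF that] p]]
    by (simp add: hecke_ideal_iff coef_diff)
  ultimately show ?thesis
    unfolding central using gens by blast
qed

lemma sort_right_eq_iff:
  "sort_right i z = y \<longleftrightarrow> y i \<le> y (Suc i) \<and> (z = y \<or> z = y \<circ> transpose i (Suc i))"
proof
  assume "sort_right i z = y"
  then show "y i \<le> y (Suc i) \<and> (z = y \<or> z = y \<circ> transpose i (Suc i))"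
    by (auto simp: sort_right_def comp_assoc split: if_splits)
next
  assume "y i \<le> y (Suc i) \<and> (z = y \<or> z = y \<circ> transpose i (Suc i))"
  then show "sort_right i z = y"
    by (auto simp: sort_right_def comp_assoc fun_eq_iff transpose_def)
qed

lemma sort_left_eq_iff:
  assumes "z permutes {1..n}" "y permutes {1..n}"
  shows "sort_left i z = y \<longleftrightarrow> inv y i \<le> inv y (Suc i) \<and> (z = y \<or> z = transpose i (Suc i) \<circ> y)"
proof
  assume "sort_left i z = y"
  then show "inv y i \<le> inv y (Suc i) \<and> (z = y \<or> z = transpose i (Suc i) \<circ> y)"
    using assms by (auto simp: sort_left_def comp_assoc[symmetric] inv_transpose_comp split: if_splits)
next
  assume *: "inv y i \<le> inv y (Suc i) \<and> (z = y \<or> z = transpose i (Suc i) \<circ> y)"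
  have "inv y i \<noteq> inv y (Suc i)"
    using permutes_inj[OF permutes_inv[OF assms(2)]] by (metis injD n_not_Suc_n)
  with * show "sort_left i z = y"
    using assms by (auto simp: sort_left_def comp_assoc[symmetric] inv_transpose_comp)
qed

lemma sum_perms_pair:
  assumes "y \<in> perms n" "z \<in> perms n" "y \<noteq> z"
  shows "(\<Sum>x\<in>perms n. f x * of_bool (P \<and> (x = y \<or> x = z))) = (if P then f y + f z else (0 :: 'k::field))"
proof -
  have "(\<Sum>x\<in>perms n. f x * of_bool (P \<and> (x = y \<or> x = z))) = (\<Sum>x\<in>{y, z}. f x * of_bool P)"
    by (rule sum.mono_neutral_cong_right) (use assms in \<open>auto simp: finite_permutations\<close>)
  then show ?thesis
    using assms(3) by simp
qed

lemma transpose_comp_neq: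
  "inj y \<Longrightarrow> y \<noteq> y \<circ> transpose i (Suc i)" "y \<circ> z = id \<Longrightarrow> y \<noteq> transpose i (Suc i) \<circ> y"
proof -
  assume "inj y"
  then have "y i \<noteq> y (Suc i)"
    by (metis injD n_not_Suc_n)
  then have "y i \<noteq> (y \<circ> transpose i (Suc i)) i"
    by simp
  then show "y \<noteq> y \<circ> transpose i (Suc i)"
    by metis
next
  assume "y \<circ> z = id"
  then have "y (z i) = i"
    by (metis comp_apply id_apply)
  then have "y (z i) \<noteq> (transpose i (Suc i) \<circ> y) (z i)"
    by simp
  then show "y \<noteq> transpose i (Suc i) \<circ> y"
    by metis
qed

text \<open>The right side sums over the fibre of \<open>sort_right i\<close> above
  \<open>y\<close>, which is empty if \<open>y\<close> descends at \<open>i\<close> and otherwise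
  consists of \<open>y\<close> and its product with the transposition.\<close>

lemma coef_mult_gen:
  assumes p: "p \<in> carrier (free_algebra K n)" and i: "i \<in> {1..<n}" and y: "y permutes {1..n}"
  shows "coef n (p * gen i) y =
    (if y i \<le> y (Suc i) then coef n p y + coef n p (y \<circ> transpose i (Suc i)) else 0)"
proof -
  let ?z = "y \<circ> transpose i (Suc i)"
  have z: "?z \<in> perms n" "y \<noteq> ?z"
    using permutes_compose[OF transpose_permutes[OF i] y] transpose_comp_neq(1)[OF permutes_inj[OF y]] by auto
  have "coef n (p * gen i) y = pairing (\<lambda>w. of_bool (sort_right i (word_perm n w) = y)) p"
    unfolding coef_def pairing_mult_right by (simp add: gen_def word_perm_snoc)
  also have "\<dots> = (\<Sum>x\<in>perms n. coef n p x * of_bool (sort_right i x = y))"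
    by (rule pairing_word_perm[OF p])
  also have "\<dots> = (\<Sum>x\<in>perms n. coef n p x * of_bool (y i \<le> y (Suc i) \<and> (x = y \<or> x = ?z)))"
    by (simp only: sort_right_eq_iff)
  also have "\<dots> = (if y i \<le> y (Suc i) then coef n p y + coef n p ?z else 0)"
    by (rule sum_perms_pair) (use y z in auto)
  finally show ?thesis .
qed

lemma coef_gen_mult:
  assumes p: "p \<in> carrier (free_algebra K n)" and i: "i \<in> {1..<n}" and y: "y permutes {1..n}"
  shows "coef n (gen i * p) y =
    (if inv y (n - i) \<le> inv y (Suc (n - i))
     then coef n p y + coef n p (transpose (n - i) (Suc (n - i)) \<circ> y) else 0)"
proof -
  let ?z = "transpose (n - i) (Suc (n - i)) \<circ> y"
  have ni: "n - i \<in> {1..<n}"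
    using i by auto
  have z: "?z \<in> perms n" "y \<noteq> ?z"
    using permutes_compose[OF y transpose_permutes[OF ni]] transpose_comp_neq(2)[OF permutes_inv_o(1)[OF y]]
    by auto
  have "coef n (gen i * p) y = pairing (\<lambda>w. of_bool (word_perm n (i # w) = y)) p"
    unfolding coef_def pairing_mult_left by (simp add: gen_def)
  also have "\<dots> = pairing (\<lambda>w. of_bool (sort_left (n - i) (word_perm n w) = y)) p"
    unfolding pairing_def using p i by (intro sum.cong) (auto simp: in_free_algebra word_perm_Cons)
  also have "\<dots> = (\<Sum>x\<in>perms n. coef n p x * of_bool (sort_left (n - i) x = y))"
    by (rule pairing_word_perm[OF p])
  also have "\<dots> = (\<Sum>x\<in>perms n. coef n p x *
      of_bool (inv y (n - i) \<le> inv y (Suc (n - i)) \<and> (x = y \<or> x = ?z)))"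
    using y by (intro sum.cong) (auto simp: sort_left_eq_iff)
  also have "\<dots> = (if inv y (n - i) \<le> inv y (Suc (n - i)) then coef n p y + coef n p ?z else 0)"
    by (rule sum_perms_pair) (use y z in auto)
  finally show ?thesis .
qed

text \<open>
  Composing with \<open>w\<^sub>0\<close> again indexes the coefficients by \<open>w\<close> itself. The sign turns the
  equations for the coefficients of a central element into equalities of two coefficients each.
\<close>

definition signed_coef :: "nat \<Rightarrow> (word \<Rightarrow>\<^sub>0 'k::field) \<Rightarrow> (nat \<Rightarrow> nat) \<Rightarrow> 'k"
  where "signed_coef n p x = of_int (sign x) * coef n p (reversal n \<circ> x)"

lemma bij_betw_reversal_comp: "bij_betw ((\<circ>) (reversal n)) (perms n) (perms n)"
  by (rule bij_betwI[of _ _ _ "(\<circ>) (reversal n)"])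
    (auto simp: fun_eq_iff intro: permutes_compose reversal_permutes simp del: One_nat_def)

lemma ball_reversal_comp: "(\<forall>y\<in>perms n. P y) \<longleftrightarrow> (\<forall>x\<in>perms n. P (reversal n \<circ> x))"
proof -
  have "(\<forall>y\<in>(\<circ>) (reversal n) ` perms n. P y) \<longleftrightarrow> (\<forall>x\<in>perms n. P (reversal n \<circ> x))"
    by blast
  then show ?thesis
    unfolding bij_betw_imp_surj_on[OF bij_betw_reversal_comp] .
qed

lemma signed_coef_eq_iff:
  fixes p q :: "word \<Rightarrow>\<^sub>0 'k::field"
  shows "(\<forall>y\<in>perms n. coef n p y = coef n q y) \<longleftrightarrow> (\<forall>x\<in>perms n. signed_coef n p x = signed_coef n q x)"
proof -
  have "(of_int (sign x) :: 'k) * a = of_int (sign x) * b \<longleftrightarrow> a = b" for x :: "nat \<Rightarrow> nat" and a b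
    by (cases x rule: sign_cases) auto
  then show ?thesis
    unfolding ball_reversal_comp[of n "\<lambda>y. coef n p y = coef n q y"] by (simp only: signed_coef_def)
qed

text \<open>With t the transposition and a the coefficients reindexed by w0, a descent of
  \<open>x\<close> on just one side gives an equation such as a(x) + a(x t) = 0, which the sign
  turns into an equality. Descents on both sides let a(x) cancel and leave a(x t) = a(t x), where
  the signs agree. Without descents both conditions are trivial. The argument only divides by a
  sign, so it holds in every characteristic.\<close>

lemma central_iff_signed_coef:
  assumes p: "p \<in> carrier (free_algebra (K :: 'k::field itself) n)"
  shows "hecke_class K n p \<in> ring_center (hecke_algebra K n) \<longleftrightarrow>
    (\<forall>i\<in>{1..<n}. \<forall>x\<in>perms n. signed_coef n p (sort_left i x) = signed_coef n p (sort_right i x))"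
proof -
  have "coef n (p * gen i) (reversal n \<circ> x) = coef n (gen i * p) (reversal n \<circ> x) \<longleftrightarrow>
      signed_coef n p (sort_left i x) = signed_coef n p (sort_right i x)"
    if i: "i \<in> {1..<n}" and x: "x permutes {1..n}" for i x
  proof -
    let ?t = "transpose i (Suc i)" and ?y = "reversal n \<circ> x"
    let ?a = "\<lambda>x. coef n p (reversal n \<circ> x)"
    have y: "?y permutes {1..n}"
      by (rule permutes_compose[OF x reversal_permutes])
    have range: "x j \<in> {1..n}" if "j \<in> {1..n}" for j
      using permutes_in_image[OF x] that by simp
    have "?y i \<le> ?y (Suc i) \<longleftrightarrow> x (Suc i) \<le> x i"
      using range[of i] range[of "Suc i"] i by (auto simp: reversal_def)
    moreover have neq: "x (Suc i) \<noteq> x i" "inv x (Suc i) \<noteq> inv x i"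
      using permutes_inj[OF x] permutes_inj[OF permutes_inv[OF x]] by (metis injD n_not_Suc_n)+
    ultimately have right: "coef n (p * gen i) ?y = (if x (Suc i) < x i then ?a x + ?a (x \<circ> ?t) else 0)"
      unfolding coef_mult_gen[OF p i y] by (auto simp: comp_assoc)
    have "inv ?y = inv x \<circ> reversal n"
      using o_inv_distrib[OF permutes_bij[OF reversal_permutes] permutes_bij[OF x]] by simp
    then have "inv ?y (n - i) \<le> inv ?y (Suc (n - i)) \<longleftrightarrow> inv x (Suc i) < inv x i"
      using i neq(2) by (auto simp: reversal_def)
    moreover have "transpose (n - i) (Suc (n - i)) \<circ> ?y = reversal n \<circ> (?t \<circ> x)"
      using reversal_comp_transpose[OF i] by (simp add: comp_assoc[symmetric])
    ultimately have left: "coef n (gen i * p) ?y = (if inv x (Suc i) < inv x i then ?a x + ?a (?t \<circ> x) else 0)"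
      unfolding coef_gen_mult[OF p i y] by simp
    have perm: "permutation x" "permutation ?t"
      using x permutation_permutes by (auto simp: permutation_swap_id)
    have sign: "sign (x \<circ> ?t) = - sign x" "sign (?t \<circ> x) = - sign x"
      using perm by (simp_all add: sign_compose sign_swap_id)
    define s where "s = (of_int (sign x) :: 'k)"
    have s: "s \<noteq> 0"
      by (cases x rule: sign_cases) (auto simp: s_def)
    have sc: "signed_coef n p x = s * ?a x" "signed_coef n p (x \<circ> ?t) = - s * ?a (x \<circ> ?t)"
      "signed_coef n p (?t \<circ> x) = - s * ?a (?t \<circ> x)"
      by (simp_all only: signed_coef_def sign s_def of_int_minus)
    have key: "a + b = 0 \<longleftrightarrow> s * a = - s * b" "- s * a = - s * b \<longleftrightarrow> a = b" for a b :: 'k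
    proof -
      have "s * a = - s * b \<longleftrightarrow> s * (a + b) = 0"
        by (simp add: distrib_left eq_neg_iff_add_eq_0)
      then show "a + b = 0 \<longleftrightarrow> s * a = - s * b" "- s * a = - s * b \<longleftrightarrow> a = b"
        using s by simp_all
    qed
    have key': "0 = a + b \<longleftrightarrow> - s * b = s * a" for a b :: 'k
      using key(1)[of a b] by metis
    show ?thesis
      unfolding left right sort_left_def sort_right_def
      by (cases "x (Suc i) < x i"; cases "inv x (Suc i) < inv x i")
        (simp_all only: sc key key' if_True if_False add_left_cancel simp_thms eq_commute[of "?a (x \<circ> ?t)"])
  qed
  then show ?thesis
    unfolding central_iff_commutes_gen[OF p]
      ball_reversal_comp[of n "\<lambda>y. coef n (p * gen i) y = coef n (gen i * p) y" for i]
    by (simp del: One_nat_def atLeastLessThan_iff)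
qed

text \<open>A lift to the free algebra of the sum of sign(x) T_x over \<open>C\<close>; its signed
  coefficients are the indicator function of \<open>C\<close>.\<close>

definition class_elt :: "nat \<Rightarrow> (nat \<Rightarrow> nat) set \<Rightarrow> word \<Rightarrow>\<^sub>0 'k::field"
  where "class_elt n C = (\<Sum>x\<in>C. word_monomial
    (SOME w. set w \<subseteq> {1..<n} \<and> word_perm n w = reversal n \<circ> x) (of_int (sign x)))"

lemma some_word:
  assumes "x \<in> perms n"
  shows "set (SOME w. set w \<subseteq> {1..<n} \<and> word_perm n w = reversal n \<circ> x) \<subseteq> {1..<n} \<and>
    word_perm n (SOME w. set w \<subseteq> {1..<n} \<and> word_perm n w = reversal n \<circ> x) = reversal n \<circ> x"
  using word_perm_surj[OF permutes_compose[OF _ reversal_permutes], of x n] assms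
  by (intro someI_ex[of "\<lambda>w. set w \<subseteq> {1..<n} \<and> word_perm n w = reversal n \<circ> x"]) simp

lemma class_elt_in_free_algebra:
  "C \<subseteq> perms n \<Longrightarrow> class_elt n C \<in> carrier (free_algebra K n)"
  unfolding class_elt_def using some_word
  by (intro sum_in_free_algebra word_monomial_in_free_algebra) blast

lemma signed_coef_class_elt:
  assumes "C \<subseteq> perms n" "x \<in> perms n"
  shows "signed_coef n (class_elt n C) x = (of_bool (x \<in> C) :: 'k::field)"
proof -
  have "finite C"
    using assms(1) finite_permutations[of "{1..n}"] by (auto intro: finite_subset)
  have eq: "reversal n \<circ> z = reversal n \<circ> x \<longleftrightarrow> z = x" for z
    by (metis (no_types) comp_apply ext reversal_reversal)
  have "coef n (class_elt n C) (reversal n \<circ> x) = (\<Sum>z\<in>C. of_int (sign z) * of_bool (z = x) :: 'k)"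
    unfolding coef_def class_elt_def pairing_sum
  proof (rule sum.cong[OF HOL.refl])
    fix z
    assume "z \<in> C"
    then have "z \<in> perms n"
      using assms(1) by blast
    then show "pairing (\<lambda>w. of_bool (word_perm n w = reversal n \<circ> x))
        (word_monomial (SOME w. set w \<subseteq> {1..<n} \<and> word_perm n w = reversal n \<circ> z) (of_int (sign z))) =
        (of_int (sign z) * of_bool (z = x) :: 'k)"
      using some_word[of z n] eq[of z] by simp
  qed
  also have "\<dots> = of_int (sign x) * of_bool (x \<in> C)"
    using \<open>finite C\<close> by (simp add: of_bool_def if_distrib[of "\<lambda>b. _ * b"] cong: if_cong)
  finally show ?thesis
    by (cases x rule: sign_cases) (simp_all add: signed_coef_def)
qed

lemma pairing_scalar_mult: "pairing g (scalar c * p) = c * pairing g p"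
  by (cases "c = 0") (simp_all add: pairing_mult_left scalar_def zero_word_def)

lemma signed_coef_add: "signed_coef n (p + q) x = signed_coef n p x + signed_coef n q x"
  by (simp add: signed_coef_def coef_add distrib_left)

lemma signed_coef_scalar_mult: "signed_coef n (scalar c * p) x = c * signed_coef n p x"
  by (simp add: signed_coef_def coef_def pairing_scalar_mult)

text \<open>The \<open>zip\<close> imitates \<open>ring.combine\<close>, which stops at the end of
  the shorter list.\<close>

definition class_sum :: "nat \<Rightarrow> 'k::field list \<Rightarrow> (nat \<Rightarrow> nat) set list \<Rightarrow> word \<Rightarrow>\<^sub>0 'k"
  where "class_sum n cs Cs = (\<Sum>(c, C)\<leftarrow>zip cs Cs. scalar c * class_elt n C)"

lemma class_sum_in_free_algebra:
  "\<forall>C\<in>set Cs. C \<subseteq> perms n \<Longrightarrow> class_sum n cs Cs \<in> carrier (free_algebra K n)"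
proof (induction cs Cs rule: list_induct2')
  case (4 c cs C Cs)
  then have "scalar c * class_elt n C \<in> carrier (free_algebra K n)"
    by (intro free_algebra_closed scalar_in_free_algebra class_elt_in_free_algebra) simp
  with 4 show ?case
    using free_algebra_closed(1)[of "scalar c * class_elt n C" K n "class_sum n cs Cs"]
    by (simp add: class_sum_def)
qed (simp_all add: class_sum_def in_free_algebra)

lemma combine_hecke_class:
  assumes "\<forall>C\<in>set Cs. C \<subseteq> perms n"
  shows "ring.combine (hecke_algebra K n) (map (\<lambda>c. hecke_class K n (scalar c)) cs)
      (map (\<lambda>C. hecke_class K n (class_elt n C)) Cs) = hecke_class K n (class_sum n cs Cs)"
  using assms
proof (induction cs Cs rule: list_induct2')
  case (4 c cs C Cs)
  interpret H: ring "hecke_algebra K n"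
    by (rule ring_hecke_algebra)
  have elt: "class_elt n C \<in> carrier (free_algebra K n)"
    using 4 by (intro class_elt_in_free_algebra) simp
  have "class_sum n cs Cs \<in> carrier (free_algebra K n)"
    using 4 by (intro class_sum_in_free_algebra) simp
  note closed = scalar_in_free_algebra[of c K n] elt
    free_algebra_closed(3)[OF scalar_in_free_algebra[of c K n] elt] this
  moreover have "class_sum n (c # cs) (C # Cs) = scalar c * class_elt n C + class_sum n cs Cs"
    by (simp add: class_sum_def)
  ultimately show ?case
    using 4 by (simp add: hecke_class_mult[OF closed(1,2)] hecke_class_add[OF closed(3,4)])
qed (simp_all add: ring.combine.simps[OF ring_hecke_algebra] class_sum_def hecke_class_zero)

lemma signed_coef_class_sum:
  assumes "\<forall>C\<in>set Cs. C \<subseteq> perms n" "x \<in> perms n"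
  shows "signed_coef n (class_sum n cs Cs) x = (\<Sum>(c, C)\<leftarrow>zip cs Cs. c * of_bool (x \<in> C))"
  using assms(1)
  by (induction cs Cs rule: list_induct2')
    (use assms(2) in \<open>simp_all add: class_sum_def signed_coef_add signed_coef_scalar_mult
      signed_coef_class_elt signed_coef_def[of _ 0] coef_def[of _ 0]\<close>)

text \<open>The class elements form a basis: signed coefficients separate the disjoint classes, and
  a central element is recovered from its signed coefficients at one representative of each
  class.\<close>

theorem dimension_hecke_center:
  fixes K :: "'k::field itself"
  shows "ring.dimension (hecke_algebra K n) (card (perms n // sort_rel n)) (hecke_scalars K n)
    (ring_center (hecke_algebra K n))"
proof -
  let ?H = "hecke_algebra K n"
  interpret H: ring ?H
    by (rule ring_hecke_algebra)
  have "finite (perms n // sort_rel n)"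
    by (rule finite_quotient[OF finite_permutations]) (use equiv_sort_rel in \<open>auto simp: equiv_def\<close>)
  then obtain Cs where Cs: "set Cs = perms n // sort_rel n" "distinct Cs"
    using finite_distinct_list by blast
  have sub: "\<forall>C\<in>set Cs. C \<subseteq> perms n"
    using Union_quotient[OF equiv_sort_rel] Cs(1) by blast
  define s where "s c = hecke_class K n (scalar c)" for c
  define u where "u C = hecke_class K n (class_elt n C)" for C
  have scalars: "hecke_scalars K n = range s"
    by (simp add: hecke_scalars_def s_def)
  have u: "set (map u Cs) \<subseteq> carrier ?H"
  proof -
    have "u C \<in> carrier ?H" if "C \<in> set Cs" for C
      unfolding u_def carrier_hecke_algebra
      by (rule imageI, rule class_elt_in_free_algebra) (use sub that in blast)
    then show ?thesis
      by auto
  qed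
  have combine: "H.combine (map s cs) (map u Cs) = hecke_class K n (class_sum n cs Cs)" for cs
    using combine_hecke_class[OF sub] by (simp add: s_def[abs_def] u_def[abs_def])
  have carrier: "class_sum n cs Cs \<in> carrier (free_algebra K n)" for cs
    by (rule class_sum_in_free_algebra[OF sub])
  have coef: "signed_coef n (class_sum n cs Cs) x = (if t < length cs then cs ! t else 0)"
    if "t < length Cs" "x \<in> Cs ! t" for cs :: "'k list" and t x
  proof -
    have "x \<in> perms n"
      using sub that nth_mem by blast
    moreover have "x \<in> Cs ! t' \<longleftrightarrow> t' = t" if "t' < length Cs" for t'
    proof -
      have "Cs ! t \<in> perms n // sort_rel n" "Cs ! t' \<in> perms n // sort_rel n"
        using Cs(1) that \<open>t < length Cs\<close> nth_mem by blast+
      from quotient_disj[OF equiv_sort_rel this] have "x \<in> Cs ! t' \<longleftrightarrow> Cs ! t' = Cs ! t"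
        using \<open>x \<in> Cs ! t\<close> by blast
      then show ?thesis
        using nth_eq_iff_index_eq[OF Cs(2) that \<open>t < length Cs\<close>] by simp
    qed
    ultimately have "signed_coef n (class_sum n cs Cs) x =
        (\<Sum>t'<min (length cs) (length Cs). cs ! t' * of_bool (t' = t))"
      unfolding signed_coef_class_sum[OF sub \<open>x \<in> perms n\<close>] sum_list_sum_nth atLeast0LessThan
      by (intro sum.cong) auto
    also have "\<dots> = (if t < length cs then cs ! t else 0)"
      using that(1) by (simp add: of_bool_def if_distrib[of "\<lambda>b. _ * b"] cong: if_cong)
    finally show ?thesis .
  qed
  have cover: "\<exists>t<length Cs. x \<in> Cs ! t" if "x \<in> perms n" for x
    using Union_quotient[OF equiv_sort_rel, of n] that Cs(1) by (metis UnionE in_set_conv_nth)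
  have "H.independent (hecke_scalars K n) (map u Cs)"
  proof (rule H.trivial_combine_imp_independent[OF subfield_hecke_scalars u])
    fix Ks
    assume Ks: "set Ks \<subseteq> hecke_scalars K n" "H.combine Ks (map u Cs) = \<zero>\<^bsub>?H\<^esub>"
    then obtain cs where cs: "Ks = map s cs"
      unfolding scalars by (metis ex_map_conv image_iff subset_iff)
    have "hecke_class K n (class_sum n cs Cs) = hecke_class K n 0"
      using Ks(2) by (simp add: cs combine hecke_class_zero)
    then have zero: "signed_coef n (class_sum n cs Cs) x = 0" if "x \<in> perms n" for x
    proof -
      have "(0 :: word \<Rightarrow>\<^sub>0 'k) \<in> carrier (free_algebra K n)"
        by (simp add: in_free_algebra)
      with \<open>hecke_class K n (class_sum n cs Cs) = hecke_class K n 0\<close>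
      have "signed_coef n (class_sum n cs Cs) x = signed_coef n 0 x"
        using that unfolding hecke_class_eq_iff[OF carrier \<open>0 \<in> _\<close>] signed_coef_eq_iff by blast
      then show ?thesis
        by (simp add: signed_coef_def[of _ 0] coef_def)
    qed
    have "cs ! t = 0" if t: "t < length cs" "t < length Cs" for t
    proof -
      have "Cs ! t \<in> perms n // sort_rel n"
        using Cs(1) t(2) nth_mem by blast
      then obtain x where x: "x \<in> Cs ! t"
        using in_quotient_imp_non_empty[OF equiv_sort_rel] by blast
      then have "x \<in> perms n"
        using sub t(2) nth_mem by blast
      from zero[OF this] show ?thesis
        using coef[OF t(2) x, of cs] t(1) by simp
    qed
    moreover have "s 0 = \<zero>\<^bsub>?H\<^esub>"
      using hecke_class_zero[of K n] by (simp add: s_def scalar_def)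
    ultimately show "set (take (length (map u Cs)) Ks) \<subseteq> {\<zero>\<^bsub>?H\<^esub>}"
      by (auto simp: cs in_set_conv_nth)
  qed
  from H.dimension_independent[OF this]
  have "H.dimension (length Cs) (hecke_scalars K n) (H.Span (hecke_scalars K n) (map u Cs))"
    by simp
  moreover have "length Cs = card (perms n // sort_rel n)"
    using Cs distinct_card by metis
  moreover have "H.Span (hecke_scalars K n) (map u Cs) = ring_center ?H"
  proof
    show "H.Span (hecke_scalars K n) (map u Cs) \<subseteq> ring_center ?H"
    proof
      fix z
      assume "z \<in> H.Span (hecke_scalars K n) (map u Cs)"
      then obtain Ks where "set Ks \<subseteq> hecke_scalars K n" "z = H.combine Ks (map u Cs)"
        unfolding H.Span_eq_combine_set[OF subfield_hecke_scalars u] by blast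
      then obtain cs where z: "z = hecke_class K n (class_sum n cs Cs)"
        unfolding scalars using combine by (metis ex_map_conv image_iff subset_iff)
      have "signed_coef n (class_sum n cs Cs) (sort_left i x) = signed_coef n (class_sum n cs Cs) (sort_right i x)"
        if i: "i \<in> {1..<n}" and x: "x \<in> perms n" for i x
      proof -
        have rel: "(sort_left i x, sort_right i x) \<in> sort_rel n"
          using sort_equiv.sort[of x n i] i x by (simp add: sort_rel_def)
        obtain t where t: "t < length Cs" "sort_left i x \<in> Cs ! t"
          using cover[of "sort_left i x"] sort_left_permutes[of x n i] i x by auto
        moreover have "sort_right i x \<in> Cs ! t"
          using in_quotient_imp_closed[OF equiv_sort_rel _ t(2) rel] Cs(1) t(1) nth_mem by blast
        ultimately show ?thesis
          using coef by simp
      qed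
      then show "z \<in> ring_center ?H"
        unfolding z central_iff_signed_coef[OF carrier] by blast
    qed
    show "ring_center ?H \<subseteq> H.Span (hecke_scalars K n) (map u Cs)"
    proof
      fix z
      assume z: "z \<in> ring_center ?H"
      then obtain p where p: "p \<in> carrier (free_algebra K n)" "z = hecke_class K n p"
        by (auto simp: ring_center_def carrier_hecke_algebra)
      define cs where "cs = map (\<lambda>C. signed_coef n p (SOME x. x \<in> C)) Cs"
      have "signed_coef n p x = signed_coef n (class_sum n cs Cs) x" if x: "x \<in> perms n" for x
      proof -
        obtain t where t: "t < length Cs" "x \<in> Cs ! t"
          using cover[OF x] by blast
        define x' where "x' = (SOME x. x \<in> Cs ! t)"
        have x': "x' \<in> Cs ! t"
          unfolding x'_def using t(2) by (rule someI[of "\<lambda>x. x \<in> Cs ! t"])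
        have "Cs ! t \<in> perms n // sort_rel n"
          using Cs(1) t(1) nth_mem by blast
        from quotient_eq_iff[OF equiv_sort_rel this this t(2) x'] have "(x, x') \<in> sort_rel n"
          by blast
        then have xx': "sort_equiv n x x'"
          by (simp only: sort_rel_def mem_Collect_eq case_prod_conv)
        have "signed_coef n p x = signed_coef n p x'"
          using xx'
        proof (rule sort_equiv_invariant)
          show "signed_coef n p (sort_left i y) = signed_coef n p (sort_right i y)"
            if "y permutes {1..n}" "i \<in> {1..<n}" for y i
            using z that unfolding p(2) central_iff_signed_coef[OF p(1)] by blast
        qed
        then show ?thesis
          using coef[OF t, of cs] t(1) by (simp add: cs_def x'_def)
      qed
      then have "z = H.combine (map s cs) (map u Cs)"
        unfolding p(2) combine hecke_class_eq_iff[OF p(1) carrier] signed_coef_eq_iff by blast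
      moreover have "set (map s cs) \<subseteq> hecke_scalars K n"
        unfolding scalars by auto
      ultimately show "z \<in> H.Span (hecke_scalars K n) (map u Cs)"
        unfolding H.Span_eq_combine_set[OF subfield_hecke_scalars u] by blast
    qed
  qed
  ultimately show ?thesis
    by simp
qed

theorem mainTheorem2:
  fixes K :: "'k::field itself" and n :: nat
  assumes "n \<ge> 1"
  shows "\<exists>d. ring.dimension (hecke_algebra K n) d (hecke_scalars K n)
               (ring_center (hecke_algebra K n)) \<and>
             (of_nat d :: rat) =
               (\<Sum>l\<in>partitions n. fact (num_even_parts l) / of_nat (even_mult_fact l))"
  using dimension_hecke_center[of K n] of_nat_card_sort_classes[of n] by blast

end
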